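(* Let $\Lambda_{\mathbf A}$ be the free $\lambda$-ring over $\mathbb Q$ with generators $A_{\lambda,\mu}$ ($\lambda,\mu$ running over all partitions, including the empty one), let $\mathbf A[X,X^*]=\sum_{\lambda,\mu}A_{\lambda,\mu}\,p_\lambda[X]\,p_\mu[X^*]$, and define $L(\mathbf A)$ by $$\int_X\mathrm{Exp}\left[\mathbf A[X,X^*]\right]=\mathrm{Exp}[L(\mathbf A)].$$ Then $$L(\mathbf A)=\sum_{\Gamma}\phi_{b(\Gamma)}(g(\Gamma))\,\frac{w(\Gamma)(\mathbf A)}{\#\mathrm{Aut}(\Gamma)},$$ where the sum is over isomorphism classes of connected admissible colored directed graphs $\Gamma$, $g(\Gamma)$ is the greatest common divisor of all the values of the coloring, $b(\Gamma)$ is the first Betti number, and $\phi_k(n)=\prod_{p\mid n,\ p\text{ prime}}(1-p^{-k})$.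
   Context: A $\lambda$-ring is a $\mathbb Q$-algebra with an action $F[G]$ of the ring of symmetric functions over $\mathbb Q$ in which the power sums $p_n$ act by ring endomorphisms, $p_1=\mathrm{id}$, $p_mp_n=p_{mn}$. Thus $\Lambda_{\mathbf A}$ is the polynomial ring over $\mathbb Q$ in the symbols $p_k[A_{\lambda,\mu}]$ ($k\ge1$). Identities hold in the completion of $\Lambda_{\mathbf A}$ for the grading in which $p_k[A_{\lambda,\mu}]$ has degree $k(|\lambda|+|\mu|)$ if $(\lambda,\mu)\ne((),())$ and $p_k[A_{(),()}]$ has degree $k$. $X$ and $X^*$ are two further free $\lambda$-ring generators (two independent infinite alphabets), $p_\lambda[X]=\prod_ip_{\lambda_i}[X]$. The plethystic exponential is $\mathrm{Exp}[G]=\exp\left(\sum_{k\ge1}p_k[G]/k\right)$. The map $\int_X$ is the linear map (extended linearly over the coefficients) on functions symmetric in $X$ and in $X^*$ determined by $\int_XF[X]G[X^*]=(F,G)$, where $(\cdot,\cdot)$ is the Hall inner product. Graphs: a colored directed graph $\Gamma=(V,E,m)$ is a finite directed graph, multiple edges and loops allowed, with a coloring $m:V\cup E\to\mathbb Z_{>0}$. It is admissible if $m(v)\mid m(e)$ whenever the edge $e$ is adjacent to the vertex $v$. The empty graph is not considered connected; a single vertex with no edges is allowed. $b(\Gamma)=\#E-\#V+1$ for connected $\Gamma$. $\mathrm{Aut}(\Gamma)$ is the group of permutations of vertices and edges preserving the coloring, incidence, and the directions of edges. For a vertex $v$, $\lambda^{(v)}$ (resp. $\mu^{(v)}$) is the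 partition whose parts are $m(e)/m(v)$ with $e$ running over the outgoing (resp. incoming) edges of $v$; a loop counts once as outgoing and once as incoming. For a partition $\lambda$ of length $l$, $\mathrm{Aut}(\lambda)=\{\pi\in S_l:\lambda_{\pi(i)}=\lambda_i\ \forall i\}$. The weight is $$w(\Gamma)(\mathbf A)=\frac{\prod_{v\in V}\#\mathrm{Aut}(\lambda^{(v)})\,\#\mathrm{Aut}(\mu^{(v)})\ \prod_{e\in E}m(e)}{\prod_{v\in V}m(v)}\ \prod_{v\in V}p_{m(v)}[A_{\lambda^{(v)},\mu^{(v)}}].$$ *)

theory Defs
  imports
    Complex_Main
    "HOL-Library.Multiset"
    "HOL-Library.Poly_Mapping"
    "HOL-Computational_Algebra.Primes"
    "HOL-Combinatorics.Permutations"
    "Graph_Theory.Graph_Theory"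
begin

section \<open>Partitions\<close>

typedef pos = "{n :: nat. 0 < n}"
  morphisms nat_of pos_of
  by auto

setup_lifting type_definition_pos

lift_definition pos_one :: pos is 1
  by simp

lift_definition pos_times :: "pos \<Rightarrow> pos \<Rightarrow> pos" is "(*)"
  by simp

lemma pos_times_inject: "pos_times n k = pos_times n k' \<longleftrightarrow> k = k'"
  by transfer auto

lemma nat_of_le_pos_times: "nat_of k \<le> nat_of (pos_times k i)"
  by transfer simp

lifting_forget pos.lifting

text \<open>A partition is identified with the finite multiset of its (positive) parts.\<close>

type_synonym partition = "pos multiset"

definition parts_list :: "partition \<Rightarrow> nat list" where
  "parts_list l = rev (sorted_list_of_multiset (image_mset nat_of l))"

definition Aut_partition :: "partition \<Rightarrow> (nat \<Rightarrow> nat) set" where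
  "Aut_partition l = {\<pi>. \<pi> permutes {..<length (parts_list l)} \<and>
     (\<forall>i<length (parts_list l). parts_list l ! \<pi> i = parts_list l ! i)}"

section \<open>Symmetric functions and the Hall inner product\<close>

text \<open>
  Over the rationals the ring of symmetric functions is the polynomial ring in the power sums
  \<open>p\<^sub>1, p\<^sub>2, \<dots>\<close>.  It is rendered as the monoid algebra of the monoid of partitions
  under union: \<^term>\<open>Poly_Mapping.single l 1\<close> is the product \<open>p\<^sub>l\<close> of the power sums indexed
  by the parts of \<open>l\<close>.
\<close>

type_synonym symfun = "partition \<Rightarrow>\<^sub>0 rat"

definition powersum :: "partition \<Rightarrow> symfun" where
  "powersum l = Poly_Mapping.single l 1"

definition z_partition :: "partition \<Rightarrow> rat" where
  "z_partition l = (\<Prod>i\<in>set_mset l. of_nat (nat_of i ^ count l i * fact (count l i)))"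

text \<open>The bilinear form for which the \<open>p\<^sub>l\<close> are orthogonal, \<open>p\<^sub>l\<close> having square \<open>z\<^sub>l\<close>.\<close>

definition hall :: "symfun \<Rightarrow> symfun \<Rightarrow> rat" where
  "hall F G = (\<Sum>l\<in>Poly_Mapping.keys F.
     Poly_Mapping.lookup F l * Poly_Mapping.lookup G l * z_partition l)"

section \<open>Completed free lambda-rings\<close>

text \<open>
  The free lambda-ring on a set \<open>'g\<close> of generators is the polynomial ring over the rationals in the
  symbols \<open>p\<^sub>k[g]\<close>; the pair \<open>(k, g)\<close> stands for \<open>p\<^sub>k[g]\<close> and a multiset of such pairs for a
  monomial.  For generators \<open>A\<^bsub>l,m\<^esub>\<close> the grading in which \<open>p\<^sub>k[A\<^bsub>l,m\<^esub>]\<close> has degree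
  \<open>k(|l|+|m|)\<close> (degree \<open>k\<close> if both partitions are empty) has only finitely many monomials in each
  degree, so the completion consists of all families of coefficients, with the convolution product.
\<close>

typedef 'g lambda_ring = "UNIV :: ((pos \<times> 'g) multiset \<Rightarrow> rat) set"
  morphisms coeff Series
  by simp

setup_lifting type_definition_lambda_ring

lemma finite_multiset_splits: "finite {(N, K). N + K = (M :: 'a multiset)}"
proof -
  have "{N. N \<subseteq># M} \<subseteq> mset ` {xs. set xs \<subseteq> set_mset M \<and> length xs \<le> size M}"
  proof
    fix N assume "N \<in> {N. N \<subseteq># M}"
    then have N: "N \<subseteq># M"
      by simp
    obtain xs where xs: "mset xs = N"
      using ex_mset by blast
    have "set xs \<subseteq> set_mset M"
      using set_mset_mono[OF N] by (simp flip: xs)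
    moreover have "length xs \<le> size M"
      using size_mset_mono[OF N] by (simp flip: xs)
    ultimately show "N \<in> mset ` {xs. set xs \<subseteq> set_mset M \<and> length xs \<le> size M}"
      using xs by blast
  qed
  then have "finite {N. N \<subseteq># M}"
    by (rule finite_subset) (auto intro: finite_lists_length_le)
  moreover have "{(N, K). N + K = M} \<subseteq> {N. N \<subseteq># M} \<times> {N. N \<subseteq># M}"
    by auto
  ultimately show ?thesis
    using finite_subset by blast
qed

instantiation lambda_ring :: (type) comm_ring_1
begin

lift_definition zero_lambda_ring :: "'a lambda_ring" is "\<lambda>_. 0" .

lift_definition one_lambda_ring :: "'a lambda_ring" is "\<lambda>M. if M = {#} then 1 else 0" .

lift_definition plus_lambda_ring :: "'a lambda_ring \<Rightarrow> 'a lambda_ring \<Rightarrow> 'a lambda_ring"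
  is "\<lambda>F G M. F M + G M" .

lift_definition minus_lambda_ring :: "'a lambda_ring \<Rightarrow> 'a lambda_ring \<Rightarrow> 'a lambda_ring"
  is "\<lambda>F G M. F M - G M" .

lift_definition uminus_lambda_ring :: "'a lambda_ring \<Rightarrow> 'a lambda_ring"
  is "\<lambda>F M. - F M" .

lift_definition times_lambda_ring :: "'a lambda_ring \<Rightarrow> 'a lambda_ring \<Rightarrow> 'a lambda_ring"
  is "\<lambda>F G M. \<Sum>(N, K) | N + K = M. F N * G K" .

instance
proof
  fix F G H :: "'a lambda_ring"
  show "F * G * H = F * (G * H)"
  proof (transfer, rule ext)
    fix F G H :: "(pos \<times> 'a) multiset \<Rightarrow> rat" and M :: "(pos \<times> 'a) multiset"
    let ?T = "{(A, B, C). A + B + C = M}"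
    let ?S = "\<lambda>N :: (pos \<times> 'a) multiset. {(A, B). A + B = N}"
    have "(\<Sum>(N, C) | N + C = M. (\<Sum>(A, B) | A + B = N. F A * G B) * H C) =
        (\<Sum>x\<in>?S M. \<Sum>y\<in>?S (fst x). F (fst y) * G (snd y) * H (snd x))"
      by (simp add: case_prod_unfold sum_distrib_right)
    also have "\<dots> = (\<Sum>(x, y)\<in>Sigma (?S M) (\<lambda>x. ?S (fst x)).
        F (fst y) * G (snd y) * H (snd x))"
      by (rule sum.Sigma) (simp_all add: finite_multiset_splits)
    also have "\<dots> = (\<Sum>(A, B, C)\<in>?T. F A * G B * H C)"
      by (rule sum.reindex_bij_witness[of _ "\<lambda>(A, B, C). ((A + B, C), (A, B))"
            "\<lambda>((N, C), (A, B)). (A, B, C)"]) auto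
    also have "\<dots> = (\<Sum>(x, y)\<in>Sigma (?S M) (\<lambda>x. ?S (snd x)).
        F (fst x) * (G (fst y) * H (snd y)))"
      by (rule sum.reindex_bij_witness[of _ "\<lambda>((A, N), (B, C)). (A, B, C)"
            "\<lambda>(A, B, C). ((A, B + C), (B, C))"]) (auto simp: add.assoc mult.assoc)
    also have "\<dots> = (\<Sum>x\<in>?S M. \<Sum>y\<in>?S (snd x). F (fst x) * (G (fst y) * H (snd y)))"
      by (rule sum.Sigma[symmetric]) (simp_all add: finite_multiset_splits)
    also have "\<dots> = (\<Sum>(A, N) | A + N = M. F A * (\<Sum>(B, C) | B + C = N. G B * H C))"
      by (simp add: case_prod_unfold sum_distrib_left)
    finally show "(\<Sum>(N, C) | N + C = M. (\<Sum>(A, B) | A + B = N. F A * G B) * H C) =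
        (\<Sum>(A, N) | A + N = M. F A * (\<Sum>(B, C) | B + C = N. G B * H C))" .
  qed
  show "F * G = G * F"
  proof (transfer, rule ext)
    fix F G :: "(pos \<times> 'a) multiset \<Rightarrow> rat" and M :: "(pos \<times> 'a) multiset"
    show "(\<Sum>(N, K) | N + K = M. F N * G K) = (\<Sum>(N, K) | N + K = M. G N * F K)"
      by (rule sum.reindex_bij_witness[of _ prod.swap prod.swap]) (auto simp: add.commute)
  qed
  show "1 * F = F"
  proof (transfer, rule ext)
    fix F :: "(pos \<times> 'a) multiset \<Rightarrow> rat" and M :: "(pos \<times> 'a) multiset"
    have "(\<Sum>(N, K) | N + K = M. (if N = {#} then 1 else 0) * F K) =
        (\<Sum>(N, K) \<in> {({#} :: (pos \<times> 'a) multiset, M)}. (if N = {#} then 1 else 0) * F K)"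
      by (intro sum.mono_neutral_right finite_multiset_splits) (auto split: if_splits)
    then show "(\<Sum>(N, K) | N + K = M. (if N = {#} then 1 else 0) * F K) = F M"
      by simp
  qed
  show "(F + G) * H = F * H + G * H"
    by (transfer, rule ext) (simp add: algebra_simps case_prod_unfold flip: sum.distrib)
  show "(0 :: 'a lambda_ring) \<noteq> 1"
    by transfer (metis zero_neq_one)
  show "F + G + H = F + (G + H)"
    by (transfer, rule ext) simp
  show "F + G = G + F"
    by (transfer, rule ext) simp
  show "0 + F = F"
    by transfer simp
  show "- F + F = 0"
    by transfer simp
  show "F - G = F + - G"
    by transfer simp
qed

end

lift_definition scale :: "rat \<Rightarrow> 'g lambda_ring \<Rightarrow> 'g lambda_ring" is "\<lambda>c F M. c * F M" .

lift_definition monomial :: "(pos \<times> 'g) multiset \<Rightarrow> 'g lambda_ring"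
  is "\<lambda>M N. if N = M then 1 else 0" .

definition gen :: "'g \<Rightarrow> 'g lambda_ring" where
  "gen g = monomial {#(pos_one, g)#}"

text \<open>
  \<open>psi n F\<close> is the action of the power sum \<open>p\<^sub>n\<close> on \<open>F\<close>: the continuous linear map sending
  the monomial \<open>\<Prod> p\<^sub>k[g]\<close> to \<open>\<Prod> p\<^bsub>nk\<^esub>[g]\<close>.  The sum below has at most one term.
\<close>

lift_definition psi :: "pos \<Rightarrow> 'g lambda_ring \<Rightarrow> 'g lambda_ring"
  is "\<lambda>n F M. \<Sum>N | image_mset (\<lambda>(k, g). (pos_times n k, g)) N = M. F N" .

definition psi_partition :: "partition \<Rightarrow> 'g lambda_ring \<Rightarrow> 'g lambda_ring" where
  "psi_partition l F = (\<Prod>k\<in>#l. psi k F)"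

text \<open>
  Infinite sums converge if every coefficient receives only finitely many nonzero contributions.
\<close>

definition formally_summable :: "('i \<Rightarrow> 'g lambda_ring) \<Rightarrow> 'i set \<Rightarrow> bool" where
  "formally_summable f I \<longleftrightarrow> (\<forall>M. finite {i \<in> I. coeff (f i) M \<noteq> 0})"

definition formal_sum :: "('i \<Rightarrow> 'g lambda_ring) \<Rightarrow> 'i set \<Rightarrow> 'g lambda_ring" where
  "formal_sum f I = Series (\<lambda>M. \<Sum>i | i \<in> I \<and> coeff (f i) M \<noteq> 0. coeff (f i) M)"

definition exp_series :: "'g lambda_ring \<Rightarrow> 'g lambda_ring" where
  "exp_series F = formal_sum (\<lambda>n. scale (1 / fact n) (F ^ n)) (UNIV :: nat set)"

text \<open>Plethystic exponential of a series without constant term.\<close>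

definition Exp :: "'g lambda_ring \<Rightarrow> 'g lambda_ring" where
  "Exp G = exp_series (formal_sum (\<lambda>k. scale (1 / of_nat (nat_of k)) (psi k G)) UNIV)"

lemma coeff_psi_image:
  "coeff (psi n F) (image_mset (\<lambda>(k, g). (pos_times n k, g)) N) = coeff F N"
proof -
  have "inj (\<lambda>(k, g :: 'a). (pos_times n k, g))"
    by (auto simp: inj_on_def pos_times_inject)
  then have "{N'. image_mset (\<lambda>(k, g :: 'a). (pos_times n k, g)) N' =
      image_mset (\<lambda>(k, g). (pos_times n k, g)) N} = {N}"
    by (auto dest: injD[OF multiset.inj_map])
  then show ?thesis
    by (simp add: psi.rep_eq)
qed

lemma coeff_psi_nonzeroE:
  assumes "coeff (psi n F) M \<noteq> 0"
  obtains N where "M = image_mset (\<lambda>(k, g). (pos_times n k, g)) N" "coeff F N \<noteq> 0"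
proof -
  have "(\<Sum>N | image_mset (\<lambda>(k, g). (pos_times n k, g)) N = M. coeff F N) \<noteq> 0"
    using assms by (simp add: psi.rep_eq)
  then obtain N where "N \<in> {N. image_mset (\<lambda>(k, g). (pos_times n k, g)) N = M}" "coeff F N \<noteq> 0"
    by (rule sum.not_neutral_contains_not_neutral)
  then show ?thesis
    by (intro that[of N]) simp_all
qed

lemma summable_Exp_exponent:
  assumes "coeff G {#} = 0"
  shows "formally_summable (\<lambda>k. scale (1 / of_nat (nat_of k)) (psi k G)) UNIV"
  unfolding formally_summable_def
proof
  fix M :: "(pos \<times> 'a) multiset"
  show "finite {k \<in> UNIV. coeff (scale (1 / of_nat (nat_of k)) (psi k G)) M \<noteq> 0}"
  proof (cases "M = {#}")
    case True
    have "coeff (psi k G) {#} = 0" for k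
      using coeff_psi_image[of k G "{#}"] assms by simp
    then show ?thesis
      by (simp add: True scale.rep_eq)
  next
    case False
    then obtain j h where jh: "(j, h) \<in># M"
      by (metis multiset_nonemptyE surj_pair)
    have "nat_of k \<le> nat_of j" if nz: "coeff (psi k G) M \<noteq> 0" for k
    proof -
      obtain N where "M = image_mset (\<lambda>(i, g). (pos_times k i, g)) N"
        using nz by (rule coeff_psi_nonzeroE)
      with jh have "(j, h) \<in> (\<lambda>(i, g). (pos_times k i, g)) ` set_mset N"
        by simp
      then obtain i where "j = pos_times k i"
        by (auto split: prod.splits)
      then show ?thesis
        by (simp add: nat_of_le_pos_times)
    qed
    then have sub: "nat_of ` {k. coeff (psi k G) M \<noteq> 0} \<subseteq> {..nat_of j}"
      by auto
    have "finite {k. coeff (psi k G) M \<noteq> 0}"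
    proof (rule finite_imageD)
      show "finite (nat_of ` {k. coeff (psi k G) M \<noteq> 0})"
        using sub by (rule finite_subset) simp
      show "inj_on nat_of {k. coeff (psi k G) M \<noteq> 0}"
        by (simp add: inj_on_def nat_of_inject)
    qed
    moreover have "{k \<in> UNIV. coeff (scale (1 / of_nat (nat_of k)) (psi k G)) M \<noteq> 0} \<subseteq>
        {k. coeff (psi k G) M \<noteq> 0}"
      by (auto simp: scale.rep_eq)
    ultimately show ?thesis
      using finite_subset by blast
  qed
qed

lemma coeff_power_eq_0:
  assumes "coeff F {#} = 0" and "size M < n"
  shows "coeff (F ^ n) M = 0"
  using assms(2)
proof (induction n arbitrary: M)
  case (Suc n)
  have "coeff F N * coeff (F ^ n) K = 0" if "N + K = M" for N K
    using that Suc assms(1) by (cases "N = {#}") (auto simp: size_eq_0_iff_empty nonempty_has_size)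
  then show ?case
    by (auto simp: times_lambda_ring.rep_eq intro!: sum.neutral)
qed simp

lemma summable_exp_series:
  assumes "coeff F {#} = 0"
  shows "formally_summable (\<lambda>n. scale (1 / fact n) (F ^ n)) (UNIV :: nat set)"
  unfolding formally_summable_def
proof
  fix M :: "(pos \<times> 'a) multiset"
  have "n \<le> size M" if "coeff (F ^ n) M \<noteq> 0" for n
    using coeff_power_eq_0[OF assms] that by (metis not_le)
  then have "{n \<in> UNIV. coeff (scale (1 / fact n) (F ^ n)) M \<noteq> 0} \<subseteq> {..size M}"
    by (auto simp: scale.rep_eq)
  then show "finite {n \<in> UNIV. coeff (scale (1 / fact n) (F ^ n)) M \<noteq> 0}"
    using finite_subset by blast
qed

section \<open>Two additional alphabets and integration\<close>

datatype 'g adjoin = Base 'g | AlphX | AlphXstar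

definition joint_monomial ::
    "(pos \<times> 'g) multiset \<Rightarrow> partition \<Rightarrow> partition \<Rightarrow> (pos \<times> 'g adjoin) multiset" where
  "joint_monomial M a b = image_mset (map_prod id Base) M +
     image_mset (\<lambda>k. (k, AlphX)) a + image_mset (\<lambda>k. (k, AlphXstar)) b"

text \<open>
  The elements to be integrated are the series whose coefficient at each monomial in the base
  generators is a polynomial in the \<open>p\<^sub>k[X]\<close>, \<open>p\<^sub>k[X\<^sup>*]\<close>, that is, a function symmetric in \<open>X\<close> and in
  \<open>X\<^sup>*\<close>.  The integral is extended linearly over the base from
  \<open>p\<^sub>a[X] p\<^sub>b[X\<^sup>*] \<mapsto> (p\<^sub>a, p\<^sub>b)\<close>.
\<close>

definition integrable_X :: "'g adjoin lambda_ring \<Rightarrow> bool" where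
  "integrable_X F \<longleftrightarrow> (\<forall>M. finite {(a, b). coeff F (joint_monomial M a b) \<noteq> 0})"

definition integral_X :: "'g adjoin lambda_ring \<Rightarrow> 'g lambda_ring" where
  "integral_X F = Series (\<lambda>M. \<Sum>(a, b) | coeff F (joint_monomial M a b) \<noteq> 0.
     coeff F (joint_monomial M a b) * hall (powersum a) (powersum b))"

text \<open>The generator \<open>A\<^bsub>l,m\<^esub>\<close> is the pair \<open>(l, m)\<close>.\<close>

type_synonym A_gen = "partition \<times> partition"

definition A_XX :: "A_gen adjoin lambda_ring" where
  "A_XX = formal_sum
     (\<lambda>(l, m). gen (Base (l, m)) * psi_partition l (gen AlphX) * psi_partition m (gen AlphXstar)) UNIV"

section \<open>Colored directed graphs\<close>

record ('v, 'e) colored_digraph = "('v, 'e) pre_digraph" +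
  vcolor :: "'v \<Rightarrow> pos"
  ecolor :: "'e \<Rightarrow> pos"

definition underlying :: "('v, 'e) colored_digraph \<Rightarrow> ('v, 'e) pre_digraph" where
  "underlying \<Gamma> = pre_digraph.truncate \<Gamma>"

definition admissible :: "('v, 'e) colored_digraph \<Rightarrow> bool" where
  "admissible \<Gamma> \<longleftrightarrow> (\<forall>e\<in>arcs \<Gamma>.
     nat_of (vcolor \<Gamma> (tail \<Gamma> e)) dvd nat_of (ecolor \<Gamma> e) \<and>
     nat_of (vcolor \<Gamma> (head \<Gamma> e)) dvd nat_of (ecolor \<Gamma> e))"

definition color_iso_pair ::
    "('v, 'e) colored_digraph \<Rightarrow> ('w, 'f) colored_digraph \<Rightarrow> ('v \<Rightarrow> 'w) \<Rightarrow> ('e \<Rightarrow> 'f) \<Rightarrow> bool" where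
  "color_iso_pair \<Gamma> \<Delta> f g \<longleftrightarrow>
     bij_betw f (verts \<Gamma>) (verts \<Delta>) \<and> bij_betw g (arcs \<Gamma>) (arcs \<Delta>) \<and>
     (\<forall>v\<in>verts \<Gamma>. vcolor \<Delta> (f v) = vcolor \<Gamma> v) \<and>
     (\<forall>e\<in>arcs \<Gamma>. ecolor \<Delta> (g e) = ecolor \<Gamma> e \<and>
        tail \<Delta> (g e) = f (tail \<Gamma> e) \<and> head \<Delta> (g e) = f (head \<Gamma> e))"

definition Aut_graph :: "('v, 'e) colored_digraph \<Rightarrow> (('v \<Rightarrow> 'v) \<times> ('e \<Rightarrow> 'e)) set" where
  "Aut_graph \<Gamma> = {(f, g). f permutes verts \<Gamma> \<and> g permutes arcs \<Gamma> \<and> color_iso_pair \<Gamma> \<Gamma> f g}"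

definition out_partition :: "('v, 'e) colored_digraph \<Rightarrow> 'v \<Rightarrow> partition" where
  "out_partition \<Gamma> v = image_mset (\<lambda>e. pos_of (nat_of (ecolor \<Gamma> e) div nat_of (vcolor \<Gamma> v)))
     (mset_set {e \<in> arcs \<Gamma>. tail \<Gamma> e = v})"

definition in_partition :: "('v, 'e) colored_digraph \<Rightarrow> 'v \<Rightarrow> partition" where
  "in_partition \<Gamma> v = image_mset (\<lambda>e. pos_of (nat_of (ecolor \<Gamma> e) div nat_of (vcolor \<Gamma> v)))
     (mset_set {e \<in> arcs \<Gamma>. head \<Gamma> e = v})"

definition weight :: "('v, 'e) colored_digraph \<Rightarrow> A_gen lambda_ring" where
  "weight \<Gamma> = scale
     ((\<Prod>v\<in>verts \<Gamma>. of_nat (card (Aut_partition (out_partition \<Gamma> v))) *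
                      of_nat (card (Aut_partition (in_partition \<Gamma> v)))) *
      (\<Prod>e\<in>arcs \<Gamma>. of_nat (nat_of (ecolor \<Gamma> e))) /
      (\<Prod>v\<in>verts \<Gamma>. of_nat (nat_of (vcolor \<Gamma> v))))
     (\<Prod>v\<in>verts \<Gamma>. psi (vcolor \<Gamma> v) (gen (out_partition \<Gamma> v, in_partition \<Gamma> v)))"

definition betti :: "('v, 'e) colored_digraph \<Rightarrow> int" where
  "betti \<Gamma> = int (card (arcs \<Gamma>)) - int (card (verts \<Gamma>)) + 1"

definition color_gcd :: "('v, 'e) colored_digraph \<Rightarrow> nat" where
  "color_gcd \<Gamma> = Gcd ((nat_of \<circ> vcolor \<Gamma>) ` verts \<Gamma> \<union> (nat_of \<circ> ecolor \<Gamma>) ` arcs \<Gamma>)"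

definition phi :: "int \<Rightarrow> nat \<Rightarrow> rat" where
  "phi k n = (\<Prod>q | prime q \<and> q dvd n. 1 - of_nat q powi (- k))"

definition graph_term :: "('v, 'e) colored_digraph \<Rightarrow> A_gen lambda_ring" where
  "graph_term \<Gamma> =
     scale (phi (betti \<Gamma>) (color_gcd \<Gamma>) / of_nat (card (Aut_graph \<Gamma>))) (weight \<Gamma>)"

text \<open>
  Every finite graph is isomorphic to one whose vertices and edges are natural numbers, so these
  suffice for isomorphism classes.  The values of the record fields outside the vertex and edge
  sets are irrelevant for isomorphism.  The empty graph is not connected for the library notion.
\<close>

definition connected_admissible_graphs :: "(nat, nat) colored_digraph set" where
  "connected_admissible_graphs = {\<Gamma>. fin_digraph (underlying \<Gamma>) \<and>
     Digraph_Component.connected (underlying \<Gamma>) \<and> admissible \<Gamma>}"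

definition graph_iso :: "((nat, nat) colored_digraph \<times> (nat, nat) colored_digraph) set" where
  "graph_iso = {(\<Gamma>, \<Delta>). \<Gamma> \<in> connected_admissible_graphs \<and> \<Delta> \<in> connected_admissible_graphs \<and>
     (\<exists>f g. color_iso_pair \<Gamma> \<Delta> f g)}"

definition graph_classes :: "(nat, nat) colored_digraph set set" where
  "graph_classes = connected_admissible_graphs // graph_iso"

text \<open>The common value of \<^const>\<open>graph_term\<close> on the members of an isomorphism class.\<close>

definition class_term :: "(nat, nat) colored_digraph set \<Rightarrow> A_gen lambda_ring" where
  "class_term C = the_elem (graph_term ` C)"

end

theory Submission
  imports Defs "HOL-Library.FuncSet"
begin

text \<open>
  A vertex of colour \<open>k\<close> with outgoing partition \<open>l\<close> and incoming partition \<open>m\<close> has type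
  \<open>(k, (l, m))\<close>, which is also the index of the variable \<open>p\<^sub>k[A\<^bsub>l,m\<^esub>]\<close>.  Hence the monomial in \<open>w(\<Gamma>)\<close>
  records the multiset of vertex types of \<open>\<Gamma>\<close>, and it determines the scalar factor of the weight,
  the Betti number and the gcd of the colours.

  The coefficient of the integral at a monomial \<open>M\<close> is explicit.  It equals the scalar weight of \<open>M\<close>
  times the number of labelled, possibly disconnected, graphs with vertex types \<open>M\<close>, divided by the
  numbers of relabellings of vertices and edges; the multinomial theorem counts these graphs.
  Splitting off the connected component of a fixed vertex shows that this series is the ordinary
  exponential of the series \<open>C\<close> in which only connected graphs are counted, and by orbit counting \<open>C\<close>
  is the sum of \<open>w(\<Gamma>) / #Aut(\<Gamma>)\<close> over the classes of connected graphs.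

  Multiplying all colours by \<open>k\<close> multiplies the coefficient of \<open>C\<close> by \<open>k\<^bsup>b-1\<^esup>\<close>.  Therefore the identity
  \<open>\<Sum> d\<^bsup>-b\<^esup> \<phi>\<^sub>b(n/d) = 1\<close> (sum over \<open>d | n\<close>) turns the coefficients of \<open>C\<close>, multiplied by \<open>\<phi>\<^sub>b(g)\<close>, into a
  solution \<open>L\<close> of \<open>\<Sum>\<^sub>k p\<^sub>k[L]/k = C\<close>.
\<close>

section \<open>Counting functions with prescribed fibres\<close>

text \<open>The Hall square of p_l is the product of the parts of l times
  \<open>mult_fact l\<close>. In the integral the first factor supplies the edge colours of
  w(\<Gamma>); the second is the number of ways to join outgoing half-edges to incoming ones of
  equal colour, and this is why the integral counts graphs. Edges are labelled as well as vertices: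
  with multiple edges, vertex labels alone leave automorphisms.

  Counting graphs produces the ordinary exponential, whereas L is defined by the plethystic one.
  Passing between them requires that connected counts do not change when all colours are multiplied
  by k. No bijection between graphs and rescaled graphs is built for this: the invariance is visible
  in the explicit count of all graphs, and it descends to connected graphs because an exponential
  determines its exponent.

  Exponentials are compared through a recursion over splittings M = N + K weighted by the size of N.
  Marking a vertex of a labelled graph and cutting out its component gives the same recursion, so
  neither side has to be expanded into powers or into sets of components.\<close>

definition mult_fact :: "'a multiset \<Rightarrow> nat" where
  "mult_fact M = (\<Prod>x\<in>set_mset M. fact (count M x))"

lemma mult_fact_superset:
  assumes "finite A" "set_mset M \<subseteq> A"
  shows "mult_fact M = (\<Prod>x\<in>A. fact (count M x))"
  unfolding mult_fact_def
  by (rule prod.mono_neutral_left) (use assms in \<open>auto simp: not_in_iff\<close>)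

lemma mult_fact_pos: "mult_fact M > 0"
  by (simp add: mult_fact_def)

lemma mult_fact_empty [simp]: "mult_fact {#} = 1"
  by (simp add: mult_fact_def)

lemma mult_fact_add_mset: "mult_fact (add_mset x M) = Suc (count M x) * mult_fact M"
proof -
  let ?A = "insert x (set_mset M)"
  have "mult_fact (add_mset x M) = (\<Prod>y\<in>?A. fact (count (add_mset x M) y))"
    by (simp add: mult_fact_def)
  also have "\<dots> = fact (Suc (count M x)) * (\<Prod>y\<in>?A - {x}. fact (count M y))"
    by (subst prod.remove[of _ x]) (auto intro!: prod.cong split: if_splits)
  also have "\<dots> = Suc (count M x) * (\<Prod>y\<in>?A. fact (count M y))"
    by (subst (2) prod.remove[of _ x]) (auto simp: algebra_simps)
  also have "(\<Prod>y\<in>?A. fact (count M y)) = mult_fact M"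
    by (rule mult_fact_superset[symmetric]) auto
  finally show ?thesis .
qed

lemma mult_fact_remove:
  assumes "x \<in># M"
  shows "mult_fact M = count M x * mult_fact (M - {#x#})"
  using mult_fact_add_mset[of x "M - {#x#}"] assms by simp

lemma mult_fact_image_inj:
  assumes "inj_on f (set_mset M)"
  shows "mult_fact (image_mset f M) = mult_fact M"
proof -
  have "count (image_mset f M) (f x) = count M x" if "x \<in># M" for x
  proof -
    have "f -` {f x} \<inter> set_mset M = {x}"
      using assms that by (auto dest: inj_onD)
    then show ?thesis
      by (simp add: count_image_mset)
  qed
  with assms show ?thesis
    by (simp add: mult_fact_def prod.reindex)
qed

lemma mult_fact_replicate [simp]: "mult_fact (replicate_mset n x) = fact n"
  by (simp add: mult_fact_def)

text \<open>For the tail or head map of an admissible graph with edge colours \<open>c\<close>, this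
  is the multiset of colours of the edges leaving or entering \<open>v\<close>: the partition
  attached to \<open>v\<close> with all parts multiplied by the colour of \<open>v\<close>.\<close>

definition fibre :: "('e \<Rightarrow> 'c) \<Rightarrow> 'e set \<Rightarrow> ('e \<Rightarrow> 'v) \<Rightarrow> 'v \<Rightarrow> 'c multiset" where
  "fibre c E f v = image_mset c (mset_set {e \<in> E. f e = v})"

lemma sum_fibre:
  assumes "finite E" "finite V" "f \<in> E \<rightarrow> V"
  shows "(\<Sum>v\<in>V. fibre c E f v) = image_mset c (mset_set E)"
  using assms(1,3)
proof (induction E rule: finite_induct)
  case empty
  then show ?case
    by (simp add: fibre_def)
next
  case (insert e E)
  have *: "fibre c (insert e E) f v = fibre c E f v + (if v = f e then {#c e#} else {#})" for v
  proof (cases "v = f e")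
    case True
    then have "{x \<in> insert e E. f x = v} = insert e {x \<in> E. f x = v}"
      by auto
    with insert True show ?thesis
      by (simp add: fibre_def)
  next
    case False
    then have "{x \<in> insert e E. f x = v} = {x \<in> E. f x = v}"
      by auto
    with False show ?thesis
      by (simp add: fibre_def)
  qed
  from insert show ?case
    by (simp add: * sum.distrib sum.delta[OF assms(2)])
qed

definition functions_with_fibres ::
    "('e \<Rightarrow> 'c) \<Rightarrow> 'e set \<Rightarrow> 'v set \<Rightarrow> ('v \<Rightarrow> 'c multiset) \<Rightarrow> ('e \<Rightarrow> 'v) set" where
  "functions_with_fibres c E V R = {f \<in> E \<rightarrow>\<^sub>E V. \<forall>v\<in>V. fibre c E f v = R v}"

lemma finite_functions_with_fibres:
  "finite E \<Longrightarrow> finite V \<Longrightarrow> finite (functions_with_fibres c E V R)"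
  unfolding functions_with_fibres_def by (simp add: finite_PiE)

lemma add_mset_eq_iff_remove: "add_mset x A = B \<longleftrightarrow> x \<in># B \<and> A = B - {#x#}"
  by (metis add_mset_remove_trivial insert_DiffM union_single_eq_member)

lemma fibre_insert_upd:
  assumes "finite E" "e \<notin> E"
  shows "fibre c (insert e E) (f(e := w)) v =
    (if v = w then add_mset (c e) (fibre c E f v) else fibre c E f v)"
proof -
  have "{x \<in> insert e E. (f(e := w)) x = v} =
      (if v = w then insert e {x \<in> E. f x = v} else {x \<in> E. f x = v})"
    using assms by auto
  with assms show ?thesis
    by (simp add: fibre_def)
qed

text \<open>A multinomial count carried out for all colours at once. When an element
  \<open>e\<close> is added and sent to \<open>w\<close>, the factor
  \<open>count (R w) (c e)\<close> splits off from \<open>mult_fact (R w)\<close>. Summed over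
  \<open>w\<close>, these factors give the multiplicity of \<open>c e\<close> in the whole, which is
  exactly the new factor on the right.\<close>

lemma card_functions_with_fibres:
  assumes "finite E" "finite V" "(\<Sum>v\<in>V. R v) = image_mset c (mset_set E)"
  shows "card (functions_with_fibres c E V R) * (\<Prod>v\<in>V. mult_fact (R v)) =
    mult_fact (image_mset c (mset_set E))"
  using assms(1,3)
proof (induction E arbitrary: R rule: finite_induct)
  case empty
  then have R: "R v = {#}" if "v \<in> V" for v
    using that assms(2) by (simp add: sum_eq_empty_iff)
  then have "functions_with_fibres c {} V R = {\<lambda>_. undefined}"
    by (auto simp: functions_with_fibres_def fibre_def)
  with R show ?case
    by simp
next
  case (insert e E)
  \<comment> \<open>What \<open>w\<close> must still receive once \<open>e\<close> has been sent to
    it. If \<open>c e\<close> does not occur in \<open>R w\<close>, no admissible function sends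
    \<open>e\<close> to \<open>w\<close>, hence the case distinctions below.\<close>
  let ?R = "\<lambda>w. R(w := R w - {#c e#})"
  let ?S = "functions_with_fibres c (insert e E) V R"
  let ?T = "\<lambda>w. functions_with_fibres c E V (?R w)"
  have fib: "card {f \<in> ?S. f e = w} = (if c e \<in># R w then card (?T w) else 0)" if w: "w \<in> V" for w
  proof -
    have eq: "fibre c (insert e E) (f(e := w)) v = R v \<longleftrightarrow> c e \<in># R w \<and> fibre c E f v = ?R w v"
      if "v = w" for f v
      using that by (simp add: fibre_insert_upd[OF insert(1,2)] add_mset_eq_iff_remove)
    have eq': "fibre c (insert e E) (f(e := w)) v = R v \<longleftrightarrow> fibre c E f v = ?R w v"
      if "v \<noteq> w" for f v
      using insert that by (auto simp: fibre_insert_upd)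
    have all: "(\<forall>v\<in>V. fibre c (insert e E) (f(e := w)) v = R v) \<longleftrightarrow>
        c e \<in># R w \<and> (\<forall>v\<in>V. fibre c E f v = ?R w v)" for f
      using eq eq' w by metis
    have "bij_betw (\<lambda>f. f(e := w)) (if c e \<in># R w then ?T w else {}) {f \<in> ?S. f e = w}"
    proof (rule bij_betw_byWitness[where f' = "\<lambda>f. f(e := undefined)"])
      show "\<forall>f\<in>if c e \<in># R w then ?T w else {}. (f(e := w))(e := undefined) = f"
        using insert(2) by (auto simp: functions_with_fibres_def PiE_def extensional_def fun_eq_iff)
      show "\<forall>f\<in>{f \<in> ?S. f e = w}. (f(e := undefined))(e := w) = f"
        by auto
      show "(\<lambda>f. f(e := w)) ` (if c e \<in># R w then ?T w else {}) \<subseteq> {f \<in> ?S. f e = w}"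
      proof
        fix g assume "g \<in> (\<lambda>f. f(e := w)) ` (if c e \<in># R w then ?T w else {})"
        then obtain f where f: "g = f(e := w)" "f \<in> ?T w" "c e \<in># R w"
          by (auto split: if_splits)
        from f(2) have "f \<in> E \<rightarrow>\<^sub>E V" "\<forall>v\<in>V. fibre c E f v = ?R w v"
          by (auto simp only: functions_with_fibres_def)
        with all[of f] f w show "g \<in> {f \<in> ?S. f e = w}"
          by (auto simp: functions_with_fibres_def PiE_def extensional_def)
      qed
      show "(\<lambda>f. f(e := undefined)) ` {f \<in> ?S. f e = w} \<subseteq> (if c e \<in># R w then ?T w else {})"
      proof
        fix g assume "g \<in> (\<lambda>f. f(e := undefined)) ` {f \<in> ?S. f e = w}"
        then obtain f where f: "g = f(e := undefined)" "f \<in> ?S" "f e = w"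
          by auto
        then have "f = g(e := w)"
          by auto
        with f(2) all[of g] have "c e \<in># R w" "\<forall>v\<in>V. fibre c E g v = ?R w v"
          by (auto simp only: functions_with_fibres_def)
        moreover have "g \<in> E \<rightarrow>\<^sub>E V"
          using f insert(2) by (auto simp: functions_with_fibres_def PiE_def extensional_def)
        ultimately show "g \<in> (if c e \<in># R w then ?T w else {})"
          by (simp only: functions_with_fibres_def if_True mem_Collect_eq simp_thms)
      qed
    qed
    from bij_betw_same_card[OF this] show ?thesis
      by (simp split: if_splits)
  qed
  have fin: "finite ?S"
    using insert assms(2) by (simp add: finite_functions_with_fibres)
  have "?S = (\<Union>w\<in>V. {f \<in> ?S. f e = w})"
    by (auto simp: functions_with_fibres_def)
  then have "card ?S = card (\<Union>w\<in>V. {f \<in> ?S. f e = w})"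
    by simp
  also have "\<dots> = (\<Sum>w\<in>V. card {f \<in> ?S. f e = w})"
    by (rule card_UN_disjoint) (use fin assms(2) in auto)
  finally have card: "card ?S = (\<Sum>w\<in>V. if c e \<in># R w then card (?T w) else 0)"
    using fib by simp
  have step: "(if c e \<in># R w then card (?T w) else 0) * (\<Prod>v\<in>V. mult_fact (R v)) =
      count (R w) (c e) * mult_fact (image_mset c (mset_set E))" if w: "w \<in> V" for w
  proof (cases "c e \<in># R w")
    case True
    have 1: "(\<Sum>v\<in>V. R v) = R w + (\<Sum>v\<in>V - {w}. R v)"
      using w assms(2) by (simp add: sum.remove)
    have 2: "(\<Sum>v\<in>V. ?R w v) = (R w - {#c e#}) + (\<Sum>v\<in>V - {w}. R v)"
      using w assms(2) by (simp add: sum.remove)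
    have "add_mset (c e) (\<Sum>v\<in>V. ?R w v) =
        add_mset (c e) (R w - {#c e#}) + (\<Sum>v\<in>V - {w}. R v)"
      unfolding 2 by simp
    also have "\<dots> = (\<Sum>v\<in>V. R v)"
      unfolding 1 using True by simp
    also have "\<dots> = add_mset (c e) (image_mset c (mset_set E))"
      using insert by simp
    finally have "(\<Sum>v\<in>V. ?R w v) = image_mset c (mset_set E)"
      by (simp only: add_mset_add_mset_same_iff)
    from insert.IH[OF this]
    have IH: "card (?T w) * (\<Prod>v\<in>V. mult_fact (?R w v)) = mult_fact (image_mset c (mset_set E))" .
    have "(\<Prod>v\<in>V. mult_fact (R v)) = mult_fact (R w) * (\<Prod>v\<in>V - {w}. mult_fact (R v))"
      using w assms(2) by (simp add: prod.remove)
    also have "\<dots> = count (R w) (c e) *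
        (mult_fact (R w - {#c e#}) * (\<Prod>v\<in>V - {w}. mult_fact (R v)))"
      by (simp add: mult_fact_remove[OF True])
    also have "mult_fact (R w - {#c e#}) * (\<Prod>v\<in>V - {w}. mult_fact (R v)) =
        (\<Prod>v\<in>V. mult_fact (?R w v))"
      using w assms(2) by (simp add: prod.remove)
    finally show ?thesis
      using IH True by (simp add: mult_ac)
  next
    case False
    then show ?thesis
      by (simp add: count_eq_zero_iff)
  qed
  have "card ?S * (\<Prod>v\<in>V. mult_fact (R v)) =
      (\<Sum>w\<in>V. count (R w) (c e) * mult_fact (image_mset c (mset_set E)))"
    unfolding card sum_distrib_right by (intro sum.cong refl step)
  also have "\<dots> = count (\<Sum>w\<in>V. R w) (c e) * mult_fact (image_mset c (mset_set E))"
    by (simp add: sum_distrib_right count_sum)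
  also have "(\<Sum>w\<in>V. R w) = image_mset c (mset_set (insert e E))"
    by (fact insert.prems)
  also have "count \<dots> (c e) * mult_fact (image_mset c (mset_set E)) =
      mult_fact (image_mset c (mset_set (insert e E)))"
    using insert by (simp add: mult_fact_add_mset)
  finally show ?case .
qed

text \<open>If all elements have the same colour, a fibre is just its cardinality.\<close>

lemma card_functions_with_image_mset:
  assumes "finite E" "card E = size R"
  shows "card {f \<in> E \<rightarrow>\<^sub>E UNIV. image_mset f (mset_set E) = R} * mult_fact R = fact (card E)"
proof -
  let ?r = "\<lambda>v. replicate_mset (count R v) ()"
  have eq: "image_mset f (mset_set E) = R \<longleftrightarrow> (\<forall>v. fibre (\<lambda>_. ()) E f v = ?r v)" for f
  proof -
    have "count (image_mset f (mset_set E)) v = size (fibre (\<lambda>_. ()) E f v)" for v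
    proof -
      have "count (image_mset f (mset_set E)) v = (\<Sum>y\<in>f -` {v} \<inter> E. count (mset_set E) y)"
        using assms(1) by (simp add: count_image_mset)
      also have "\<dots> = (\<Sum>y\<in>{e \<in> E. f e = v}. 1)"
        by (rule sum.cong) (use assms(1) in auto)
      also have "\<dots> = size (fibre (\<lambda>_. ()) E f v)"
        by (simp add: fibre_def)
      finally show ?thesis .
    qed
    moreover have "fibre (\<lambda>_. ()) E f v = replicate_mset (size (fibre (\<lambda>_. ()) E f v)) ()" for v
      by (simp add: fibre_def image_mset_const_eq)
    ultimately show ?thesis
      by (metis multiset_eq_iff size_replicate_mset)
  qed
  have "{f \<in> E \<rightarrow>\<^sub>E UNIV. image_mset f (mset_set E) = R} =
      functions_with_fibres (\<lambda>_. ()) E (set_mset R) ?r"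
  proof (intro equalityI subsetI)
    fix f assume f: "f \<in> {f \<in> E \<rightarrow>\<^sub>E UNIV. image_mset f (mset_set E) = R}"
    then have "f ` E = set_mset R"
      using assms(1) by auto
    with f eq show "f \<in> functions_with_fibres (\<lambda>_. ()) E (set_mset R) ?r"
      by (auto simp: functions_with_fibres_def PiE_def)
  next
    fix f assume f: "f \<in> functions_with_fibres (\<lambda>_. ()) E (set_mset R) ?r"
    have "fibre (\<lambda>_. ()) E f v = ?r v" for v
    proof (cases "v \<in># R")
      case False
      with f have "{e \<in> E. f e = v} = {}"
        by (auto simp: functions_with_fibres_def PiE_def)
      then have "fibre (\<lambda>_. ()) E f v = {#}"
        unfolding fibre_def by (simp only: mset_set.empty image_mset_empty)
      with False show ?thesis
        by (simp add: count_eq_zero_iff)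
    qed (use f in \<open>auto simp: functions_with_fibres_def\<close>)
    with f eq show "f \<in> {f \<in> E \<rightarrow>\<^sub>E UNIV. image_mset f (mset_set E) = R}"
      by (auto simp: functions_with_fibres_def PiE_def)
  qed
  moreover have "(\<Sum>v\<in>set_mset R. ?r v) = image_mset (\<lambda>_. ()) (mset_set E)"
    using assms by (simp add: multiset_eq_iff count_sum image_mset_const_eq size_multiset_overloaded_eq)
  from card_functions_with_fibres[OF assms(1) finite_set_mset this]
  have "card (functions_with_fibres (\<lambda>_. ()) E (set_mset R) ?r) * mult_fact R =
      mult_fact (image_mset (\<lambda>_. ()) (mset_set E))"
    by (simp add: mult_fact_def[of R])
  ultimately show ?thesis
    by (simp add: image_mset_const_eq)
qed

text \<open>
  Colour preserving permutations are the functions whose fibre over \<open>v\<close> is the singleton of the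
  colour of \<open>v\<close>.
\<close>

lemma card_color_preserving_permutations:
  assumes "finite E"
  shows "card {\<pi>. \<pi> permutes E \<and> (\<forall>e\<in>E. c (\<pi> e) = c e)} = mult_fact (image_mset c (mset_set E))"
proof -
  let ?P = "{\<pi>. \<pi> permutes E \<and> (\<forall>e\<in>E. c (\<pi> e) = c e)}"
  let ?F = "functions_with_fibres c E E (\<lambda>v. {#c v#})"
  \<comment> \<open>A permutation is the identity outside \<open>E\<close>, a counted function is
    \<open>undefined\<close> there; the two maps only exchange these defaults.\<close>
  have "bij_betw (\<lambda>f. restrict f E) ?P ?F"
  proof (rule bij_betw_byWitness[where f' = "\<lambda>f x. if x \<in> E then f x else x"])
    show "\<forall>f\<in>?P. (\<lambda>x. if x \<in> E then restrict f E x else x) = f"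
      by (auto simp: fun_eq_iff permutes_not_in)
    show "\<forall>f\<in>?F. restrict (\<lambda>x. if x \<in> E then f x else x) E = f"
      by (auto simp: functions_with_fibres_def PiE_def extensional_def fun_eq_iff)
    show "(\<lambda>f. restrict f E) ` ?P \<subseteq> ?F"
    proof
      fix g assume "g \<in> (\<lambda>f. restrict f E) ` ?P"
      then obtain f where f: "g = restrict f E" "f permutes E" "\<forall>e\<in>E. c (f e) = c e"
        by auto
      have "fibre c E g v = {#c v#}" if "v \<in> E" for v
      proof -
        have "{e \<in> E. g e = v} = {inv f v}"
        proof (intro equalityI subsetI)
          fix e assume "e \<in> {e \<in> E. g e = v}"
          with f(1) have "f e = v"
            by (auto simp: restrict_def split: if_splits)
          then show "e \<in> {inv f v}"
            using permutes_inverses(2)[OF f(2), of e] by simp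
        next
          fix e assume "e \<in> {inv f v}"
          then show "e \<in> {e \<in> E. g e = v}"
            using f(1) that permutes_inverses(1)[OF f(2)] permutes_in_image[OF permutes_inv[OF f(2)]]
            by simp
        qed
        moreover have "c (inv f v) = c v"
          using f(3) that permutes_inverses(1)[OF f(2), of v]
            permutes_in_image[OF permutes_inv[OF f(2)], of v] by force
        ultimately show ?thesis
          by (simp add: fibre_def)
      qed
      with f show "g \<in> ?F"
        by (auto simp: functions_with_fibres_def permutes_in_image)
    qed
    show "(\<lambda>f x. if x \<in> E then f x else x) ` ?F \<subseteq> ?P"
    proof
      fix g assume "g \<in> (\<lambda>f x. if x \<in> E then f x else x) ` ?F"
      then obtain f where f: "g = (\<lambda>x. if x \<in> E then f x else x)" "f \<in> ?F"
        by auto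
      have sing: "\<exists>e. {e \<in> E. f e = v} = {e} \<and> c e = c v" if "v \<in> E" for v
      proof -
        have *: "image_mset c (mset_set {e \<in> E. f e = v}) = {#c v#}"
          using f that by (auto simp: functions_with_fibres_def fibre_def)
        from arg_cong[OF this, of size] have "card {e \<in> E. f e = v} = 1"
          by simp
        then obtain e where "{e \<in> E. f e = v} = {e}"
          by (rule card_1_singletonE)
        with * show ?thesis
          by auto
      qed
      have "f ` E = E"
      proof
        show "f ` E \<subseteq> E"
          using f(2) by (auto simp: functions_with_fibres_def)
        show "E \<subseteq> f ` E"
        proof
          fix v assume "v \<in> E"
          from sing[OF this] obtain e where "{e \<in> E. f e = v} = {e}"
            by blast
          then have "e \<in> E" "f e = v"
            by blast+
          then show "v \<in> f ` E"
            by blast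
        qed
      qed
      then have "bij_betw f E E"
        using assms by (simp add: bij_betw_def eq_card_imp_inj_on)
      then have "bij_betw g E E"
        using f by (simp cong: bij_betw_cong)
      then have "g permutes E"
        using f by (intro bij_imp_permutes) auto
      moreover have "c (g e) = c e" if "e \<in> E" for e
      proof -
        have "f e \<in> E"
          using \<open>f ` E = E\<close> that by blast
        from sing[OF this] obtain e' where e': "{x \<in> E. f x = f e} = {e'}" "c e' = c (f e)"
          by blast
        from that have "e \<in> {x \<in> E. f x = f e}"
          by simp
        with e' have "c (f e) = c e"
          by simp
        with that f(1) show ?thesis
          by simp
      qed
      ultimately show "g \<in> ?P"
        by blast
    qed
  qed
  then have "card ?P = card ?F"
    by (rule bij_betw_same_card)
  moreover have "(\<Sum>v\<in>E. {#c v#}) = image_mset c (mset_set E)"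
    using assms by (induction E rule: finite_induct) auto
  from card_functions_with_fibres[OF assms assms this]
  have "card ?F = mult_fact (image_mset c (mset_set E))"
    by (simp add: mult_fact_def)
  ultimately show ?thesis
    by simp
qed

text \<open>The positions of \<open>parts_list l\<close>, coloured by the part found there, turn
  \<open>Aut_partition\<close> into a group of colour preserving permutations. Only the multiset of
  parts enters the count, so the sorting is immaterial.\<close>

lemma card_Aut_partition: "card (Aut_partition l) = mult_fact l"
proof -
  let ?n = "length (parts_list l)"
  have "Aut_partition l = {\<pi>. \<pi> permutes {..<?n} \<and> (\<forall>i\<in>{..<?n}. (!) (parts_list l) (\<pi> i) = (!) (parts_list l) i)}"
    by (auto simp: Aut_partition_def)
  then have "card (Aut_partition l) = mult_fact (image_mset ((!) (parts_list l)) (mset_set {..<?n}))"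
    by (simp only: card_color_preserving_permutations[OF finite_lessThan])
  also have "image_mset ((!) (parts_list l)) (mset_set {..<?n}) = mset (parts_list l)"
    by (metis map_nth mset_map mset_set_upto_eq_mset_upto)
  also have "mset (parts_list l) = image_mset nat_of l"
    by (simp add: parts_list_def)
  also have "mult_fact (image_mset nat_of l) = mult_fact l"
    by (rule mult_fact_image_inj) (auto simp: inj_on_def nat_of_inject)
  finally show ?thesis .
qed

section \<open>Exponentials of series\<close>

lemma series_eqI: "(\<And>M. coeff F M = coeff G M) \<Longrightarrow> F = G"
  by (simp add: coeff_inject[symmetric] fun_eq_iff)

lemma coeff_Series [simp]: "coeff (Series f) = f"
  by (simp add: Series_inverse)

lemma coeff_formal_sum:
  assumes "finite A" "A \<subseteq> I" "\<And>i. i \<in> I - A \<Longrightarrow> coeff (f i) M = 0"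
  shows "coeff (formal_sum f I) M = (\<Sum>i\<in>A. coeff (f i) M)"
  unfolding formal_sum_def coeff_Series
  by (rule sum.mono_neutral_left) (use assms in auto)

text \<open>A product of \<open>i\<close> series without constant term has only monomials with at
  least \<open>i\<close> factors, so high powers do not reach \<open>M\<close>. The bound
  \<open>n\<close> is left free so that one truncation can serve all splittings of a
  monomial.\<close>

lemma coeff_exp_series:
  assumes "coeff F {#} = 0" "size M \<le> n"
  shows "coeff (exp_series F) M = (\<Sum>i\<le>n. coeff (F ^ i) M / fact i)"
  unfolding exp_series_def
  by (subst coeff_formal_sum[where A = "{..n}"])
    (use assms coeff_power_eq_0[OF assms(1)] in \<open>auto simp: scale.rep_eq\<close>)

lemma coeff_exp_series_empty:
  "coeff F {#} = 0 \<Longrightarrow> coeff (exp_series F) {#} = 1"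
  by (simp add: coeff_exp_series[where n = 0] one_lambda_ring.rep_eq)

text \<open>
  The Euler derivation turns \<open>exp\<close> into a recursion for coefficients, which determines the exponential
  and from which the exponent can be recovered.
\<close>

lift_definition euler :: "'g lambda_ring \<Rightarrow> 'g lambda_ring" is "\<lambda>F M. of_nat (size M) * F M" .

lemma euler_mult: "euler (F * G) = euler F * G + F * euler G"
proof (rule series_eqI)
  fix M
  have "coeff (euler (F * G)) M =
      (\<Sum>(N, K) | N + K = M. of_nat (size M) * (coeff F N * coeff G K))"
    by (simp add: euler.rep_eq times_lambda_ring.rep_eq sum_distrib_left case_prod_unfold)
  also have "\<dots> = (\<Sum>(N, K) | N + K = M.
      coeff (euler F) N * coeff G K + coeff F N * coeff (euler G) K)"
    by (intro sum.cong) (auto simp: euler.rep_eq algebra_simps)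
  also have "\<dots> = coeff (euler F * G + F * euler G) M"
    by (simp add: plus_lambda_ring.rep_eq times_lambda_ring.rep_eq sum.distrib case_prod_unfold)
  finally show "coeff (euler (F * G)) M = coeff (euler F * G + F * euler G) M" .
qed

lemma euler_power: "euler (F ^ Suc n) = of_nat (Suc n) * (euler F * F ^ n)"
proof (induction n)
  case 0
  then show ?case
    by simp
next
  case (Suc n)
  have "euler (F ^ Suc (Suc n)) = euler F * F ^ Suc n + F * euler (F ^ Suc n)"
    by (subst power_Suc, subst euler_mult) simp
  also have "\<dots> = of_nat (Suc (Suc n)) * (euler F * F ^ Suc n)"
    unfolding Suc by (simp add: algebra_simps)
  finally show ?case .
qed

lemma coeff_of_nat_mult: "coeff (of_nat n * F) M = of_nat n * coeff F M"
  by (induction n) (simp_all add: zero_lambda_ring.rep_eq plus_lambda_ring.rep_eq algebra_simps)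

lemma exp_series_recursion:
  assumes "coeff F {#} = 0"
  shows "of_nat (size M) * coeff (exp_series F) M =
    (\<Sum>(N, K) | N + K = M. of_nat (size N) * coeff F N * coeff (exp_series F) K)"
proof -
  \<comment> \<open>One power beyond \<open>size M\<close> is kept: differentiation lowers the
    exponent by one, and after the index shift the sum must still run up to
    \<open>size M\<close>.\<close>
  have "of_nat (size M) * coeff (exp_series F) M =
      (\<Sum>i\<le>Suc (size M). coeff (euler (F ^ i)) M / fact i)"
    by (subst coeff_exp_series[OF assms, where n = "Suc (size M)"])
      (simp_all add: euler.rep_eq sum_distrib_left algebra_simps del: sum.atMost_Suc)
  also have "\<dots> = coeff (euler 1) M + (\<Sum>i\<le>size M. coeff (euler (F ^ Suc i)) M / fact (Suc i))"
    by (subst sum.atMost_Suc_shift) simp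
  also have "coeff (euler 1) M = 0"
    by (simp add: euler.rep_eq one_lambda_ring.rep_eq)
  also have "(\<Sum>i\<le>size M. coeff (euler (F ^ Suc i)) M / fact (Suc i)) =
      (\<Sum>i\<le>size M. coeff (euler F * F ^ i) M / fact i)"
    by (intro sum.cong refl)
      (simp add: euler_power coeff_of_nat_mult del: power_Suc of_nat_Suc)
  also have "\<dots> = (\<Sum>i\<le>size M. \<Sum>(N, K) | N + K = M. coeff (euler F) N * (coeff (F ^ i) K / fact i))"
    by (simp add: times_lambda_ring.rep_eq sum_divide_distrib case_prod_unfold)
  also have "\<dots> = (\<Sum>(N, K) | N + K = M. coeff (euler F) N * (\<Sum>i\<le>size M. coeff (F ^ i) K / fact i))"
    by (subst sum.swap) (simp add: case_prod_unfold sum_distrib_left)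
  also have "\<dots> = (\<Sum>(N, K) | N + K = M. of_nat (size N) * coeff F N * coeff (exp_series F) K)"
    by (intro sum.cong)
      (auto simp: euler.rep_eq coeff_exp_series[OF assms, where n = "size M" for M] 
         simp flip: coeff_exp_series[OF assms])
  finally show ?thesis
    by simp
qed

text \<open>In the recursion the terms with empty \<open>N\<close> carry the factor 0, so the value
  at \<open>M\<close> depends only on values at smaller \<open>K\<close>. With the value 1 at the
  empty monomial this leaves a single solution, and a guessed family of coefficients is verified to
  be an exponential without computing powers.\<close>

lemma coeff_exp_series_eqI:
  assumes F: "coeff F {#} = 0" and Z: "Z {#} = 1"
    and rec: "\<And>M. of_nat (size M) * Z M =
      (\<Sum>(N, K) | N + K = M. of_nat (size N) * coeff F N * Z K)"
  shows "coeff (exp_series F) M = Z M"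
proof (induction "size M" arbitrary: M rule: less_induct)
  case less
  show ?case
  proof (cases "M = {#}")
    case True
    then show ?thesis
      using Z coeff_exp_series_empty[OF F] by simp
  next
    case False
    have "of_nat (size M) * coeff (exp_series F) M = of_nat (size M) * Z M"
      unfolding exp_series_recursion[OF F] rec
    proof (intro sum.cong refl, clarify)
      fix N K assume M: "M = N + K"
      show "of_nat (size N) * coeff F N * coeff (exp_series F) K =
          of_nat (size N) * coeff F N * Z K"
        using less[of K] M by (cases "N = {#}") (auto simp: nonempty_has_size)
    qed
    with False show ?thesis
      by simp
  qed
qed

text \<open>The splitting with empty \<open>K\<close> contributes \<open>size M\<close> times the
  coefficient of the exponent at \<open>M\<close>, because the exponential has constant term 1. All
  other splittings involve the exponent only at smaller monomials, so the coefficients can be solved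
  for one after another.\<close>

lemma exp_series_inject:
  assumes "coeff F {#} = 0" "coeff G {#} = 0" "exp_series F = exp_series G"
  shows "F = G"
proof (rule series_eqI)
  fix M
  show "coeff F M = coeff G M"
  proof (induction "size M" arbitrary: M rule: less_induct)
    case less
    let ?S = "{(N, K). N + K = M}"
    let ?t = "\<lambda>F (N, K). of_nat (size N) * coeff F N * coeff (exp_series G) K"
    have split: "(\<Sum>x\<in>?S. ?t F x) = of_nat (size M) * coeff F M + (\<Sum>x\<in>?S - {(M, {#})}. ?t F x)" for F
      by (subst sum.remove[of _ "(M, {#})"])
        (auto simp: finite_multiset_splits coeff_exp_series_empty[OF assms(2)])
    have "(\<Sum>x\<in>?S. ?t F x) = (\<Sum>x\<in>?S. ?t G x)"
      using exp_series_recursion[OF assms(1), of M] exp_series_recursion[OF assms(2), of M] assms(3)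
      by simp
    moreover have "(\<Sum>x\<in>?S - {(M, {#})}. ?t F x) = (\<Sum>x\<in>?S - {(M, {#})}. ?t G x)"
    proof (intro sum.cong refl)
      fix x assume "x \<in> ?S - {(M, {#})}"
      then obtain N K where x: "x = (N, K)" "N + K = M" "K \<noteq> {#}"
        by (cases x) auto
      then have "size N < size M"
        by (auto simp: nonempty_has_size)
      from less[OF this] show "?t F x = ?t G x"
        by (simp add: x)
    qed
    ultimately have "of_nat (size M) * coeff F M = of_nat (size M) * coeff G M"
      by (simp add: split)
    with assms(1,2) show ?case
      by (cases "M = {#}") auto
  qed
qed

section \<open>Adams operations\<close>

abbreviation adams :: "pos \<Rightarrow> (pos \<times> 'g) multiset \<Rightarrow> (pos \<times> 'g) multiset" where
  "adams n \<equiv> image_mset (\<lambda>(k, g). (pos_times n k, g))"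

text \<open>An additive weight that \<open>adams n\<close> multiplies by \<open>nat_of n\<close>,
  while \<open>size\<close> is left unchanged. It bounds the \<open>k\<close> for which
  \<open>psi k\<close> reaches a given monomial, and it drops whenever a nontrivial Adams operation
  is undone, so it serves as induction measure.\<close>

abbreviation total_color :: "(pos \<times> 'g) multiset \<Rightarrow> nat" where
  "total_color M \<equiv> (\<Sum>(k, g)\<in>#M. nat_of k)"

lemma nat_of_pos [simp]: "nat_of k > 0"
  using nat_of by simp

lemma nat_of_pos_times [simp]: "nat_of (pos_times n k) = nat_of n * nat_of k"
  by (simp add: pos_times_def nat_of_inverse map_fun_def pos_of_inverse)

lemma nat_of_pos_one [simp]: "nat_of pos_one = 1"
  by (simp add: pos_one_def pos_of_inverse)

lemma nat_of_pos_of [simp]: "n > 0 \<Longrightarrow> nat_of (pos_of n) = n"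
  by (simp add: pos_of_inverse)

lemma pos_eq_iff: "k = l \<longleftrightarrow> nat_of k = nat_of l"
  by (simp add: nat_of_inject)

lemma pos_times_one [simp]: "pos_times pos_one k = k" "pos_times k pos_one = k"
  by (simp_all add: pos_eq_iff)

lemma pos_times_assoc: "pos_times k (pos_times l m) = pos_times (pos_times k l) m"
  by (simp add: pos_eq_iff mult_ac)

lemma finite_pos_le: "finite {k. nat_of k \<le> n}"
proof (rule finite_imageD)
  show "finite (nat_of ` {k. nat_of k \<le> n})"
    by (rule finite_subset[of _ "{..n}"]) auto
qed (simp add: inj_on_def nat_of_inject)

lemma adams_one [simp]: "adams pos_one M = M"
  by (simp add: case_prod_unfold)

lemma adams_inject: "adams n M = adams n N \<longleftrightarrow> M = N"
proof -
  have "inj (\<lambda>(k, g :: 'a). (pos_times n k, g))"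
    by (auto simp: inj_on_def pos_times_inject)
  then show ?thesis
    by (auto dest: injD[OF multiset.inj_map])
qed

lemma total_color_adams: "total_color (adams n M) = nat_of n * total_color M"
  by (induction M) (auto simp: algebra_simps)

lemma total_color_pos: "M \<noteq> {#} \<Longrightarrow> total_color M > 0"
  by (cases M) auto

lemma coeff_psi_eq_0:
  assumes "\<And>N. M \<noteq> adams n N"
  shows "coeff (psi n F) M = 0"
  using assms by (metis coeff_psi_nonzeroE)

text \<open>Isolating the exponent writes \<open>Exp\<close> as a composition of this linear map
  with \<open>exp_series\<close>, and the two are inverted separately.\<close>

definition plethystic_sum :: "'g lambda_ring \<Rightarrow> 'g lambda_ring" where
  "plethystic_sum G = formal_sum (\<lambda>k. scale (1 / of_nat (nat_of k)) (psi k G)) UNIV"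

lemma Exp_eq: "Exp G = exp_series (plethystic_sum G)"
  by (simp add: Exp_def plethystic_sum_def)

lemma coeff_psi_empty [simp]: "coeff (psi k G) {#} = coeff G {#}"
  using coeff_psi_image[of k G "{#}"] by simp

lemma coeff_psi_large:
  assumes "coeff G {#} = 0" "total_color M < nat_of k"
  shows "coeff (psi k G) M = 0"
proof (rule ccontr)
  assume "coeff (psi k G) M \<noteq> 0"
  then obtain N where N: "M = adams k N" "coeff G N \<noteq> 0"
    by (rule coeff_psi_nonzeroE)
  then have "total_color N > 0"
    using assms(1) by (intro total_color_pos) auto
  then have "nat_of k \<le> total_color M"
    by (simp add: N total_color_adams)
  with assms(2) show False
    by simp
qed

lemma coeff_plethystic_sum:
  assumes "coeff G {#} = 0" "finite A" "\<And>k. k \<notin> A \<Longrightarrow> coeff (psi k G) M = 0"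
  shows "coeff (plethystic_sum G) M = (\<Sum>k\<in>A. coeff (psi k G) M / of_nat (nat_of k))"
  unfolding plethystic_sum_def
  by (subst coeff_formal_sum[where A = A]) (use assms in \<open>auto simp: scale.rep_eq\<close>)

lemma coeff_plethystic_sum_le:
  assumes "coeff G {#} = 0"
  shows "coeff (plethystic_sum G) M =
    (\<Sum>k | nat_of k \<le> total_color M. coeff (psi k G) M / of_nat (nat_of k))"
  by (rule coeff_plethystic_sum)
    (use assms in \<open>auto simp: finite_pos_le intro!: coeff_psi_large\<close>)

lemma coeff_plethystic_sum_empty:
  assumes "coeff G {#} = 0"
  shows "coeff (plethystic_sum G) {#} = 0"
  by (subst coeff_plethystic_sum_le) (use assms in auto)

text \<open>The summand for \<open>pos_one\<close> is the coefficient at \<open>M\<close> itself;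
  every other summand is a coefficient at some \<open>N\<close> with \<open>M = adams k N\<close>
  and \<open>k\<close> different from \<open>pos_one\<close>, hence of smaller total colour.\<close>

lemma plethystic_sum_inject:
  assumes "coeff F {#} = 0" "coeff G {#} = 0" "plethystic_sum F = plethystic_sum G"
  shows "F = G"
proof (rule series_eqI)
  fix M
  show "coeff F M = coeff G M"
  proof (induction "total_color M" arbitrary: M rule: less_induct)
    case less
    show ?case
    proof (cases "M = {#}")
      case False
      let ?A = "{k. nat_of k \<le> total_color M}"
      have one: "pos_one \<in> ?A"
        using total_color_pos[OF False] by simp
      have split: "coeff (plethystic_sum H) M = coeff H M +
          (\<Sum>k\<in>?A - {pos_one}. coeff (psi k H) M / of_nat (nat_of k))" if "coeff H {#} = 0" for H
        using coeff_psi_image[of pos_one H M]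
        by (simp add: coeff_plethystic_sum_le[OF that] sum.remove[OF finite_pos_le one])
      have "coeff (psi k F) M = coeff (psi k G) M" if "k \<noteq> pos_one" for k
      proof (cases "\<exists>N. M = adams k N")
        case True
        then obtain N where N: "M = adams k N"
          by blast
        have "nat_of k > 1"
          using that by (simp add: pos_eq_iff) (metis One_nat_def Suc_lessI nat_of_pos)
        moreover have "total_color N > 0"
          using N False by (intro total_color_pos) auto
        ultimately have "total_color N < total_color M"
          by (simp add: N total_color_adams)
        from less[OF this] show ?thesis
          by (simp add: N coeff_psi_image)
      qed (metis coeff_psi_eq_0)
      then have "(\<Sum>k\<in>?A - {pos_one}. coeff (psi k F) M / of_nat (nat_of k)) =
          (\<Sum>k\<in>?A - {pos_one}. coeff (psi k G) M / of_nat (nat_of k))"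
        by (intro sum.cong) auto
      with split[OF assms(1)] split[OF assms(2)] assms(3) show ?thesis
        by simp
    qed (use assms in simp)
  qed
qed

lemma Exp_inject:
  assumes "coeff F {#} = 0" "coeff G {#} = 0" "Exp F = Exp G"
  shows "F = G"
proof (rule plethystic_sum_inject[OF assms(1,2)])
  show "plethystic_sum F = plethystic_sum G"
    by (rule exp_series_inject[OF coeff_plethystic_sum_empty[OF assms(1)]
          coeff_plethystic_sum_empty[OF assms(2)]]) (use assms(3) in \<open>simp add: Exp_eq\<close>)
qed

section \<open>The integral of the exponential\<close>

abbreviation color_product :: "(pos \<times> 'g) multiset \<Rightarrow> rat" where
  "color_product M \<equiv> (\<Prod>(k, g)\<in>#M. of_nat (nat_of k))"

abbreviation part_product :: "partition \<Rightarrow> rat" where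
  "part_product l \<equiv> (\<Prod>k\<in>#l. of_nat (nat_of k))"

abbreviation scaled :: "pos \<Rightarrow> partition \<Rightarrow> partition" where
  "scaled k \<equiv> image_mset (pos_times k)"

text \<open>A part i of the outgoing partition of a vertex of colour k stands for a half-edge of
  colour k i. Thus \<open>outs M\<close> and \<open>ins M\<close> collect the colours of all
  outgoing and all incoming half-edges, and they must agree if the half-edges are to be joined to
  edges.\<close>

definition outs :: "(pos \<times> A_gen) multiset \<Rightarrow> partition" where
  "outs M = (\<Sum>(k, l, m)\<in>#M. scaled k l)"

definition ins :: "(pos \<times> A_gen) multiset \<Rightarrow> partition" where
  "ins M = (\<Sum>(k, l, m)\<in>#M. scaled k m)"

lemma nat_of_nonzero [simp]: "nat_of k \<noteq> 0"
  using nat_of_pos[of k] by simp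

lemma scaled_one [simp]: "scaled pos_one l = l"
  by (induction l) auto

lemma outs_simps [simp]:
  "outs {#} = {#}" "outs (M + N) = outs M + outs N"
  "outs (add_mset t M) = scaled (fst t) (fst (snd t)) + outs M"
  by (simp_all add: outs_def case_prod_unfold)

lemma ins_simps [simp]:
  "ins {#} = {#}" "ins (M + N) = ins M + ins N"
  "ins (add_mset t M) = scaled (fst t) (snd (snd t)) + ins M"
  by (simp_all add: ins_def case_prod_unfold)

lemma z_partition_eq: "z_partition l = part_product l * of_nat (mult_fact l)"
  by (simp add: z_partition_def mult_fact_def image_prod_mset_multiplicity prod.distrib)

lemma hall_powersum: "hall (powersum a) (powersum b) = (if a = b then z_partition a else 0)"
  by (simp add: hall_def powersum_def lookup_single when_def)

lemma color_product_nonzero: "color_product M \<noteq> 0"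
  by (induction M) auto

section \<open>Monomials in the generators and in the two alphabets\<close>

lemma monomial_mult: "monomial M * monomial N = monomial (M + N)"
proof (rule series_eqI)
  fix L
  have "coeff (monomial M * monomial N) L =
      (\<Sum>(A, B) | A + B = L. (if A = M then 1 else 0) * (if B = N then 1 else 0))"
    by (simp add: times_lambda_ring.rep_eq monomial.rep_eq)
  also have "\<dots> = (\<Sum>x\<in>{(A, B). A + B = L}. if x = (M, N) then 1 else 0)"
    by (intro sum.cong) (auto split: if_splits)
  also have "\<dots> = coeff (monomial (M + N)) L"
    by (auto simp: sum.delta' finite_multiset_splits monomial.rep_eq)
  finally show "coeff (monomial M * monomial N) L = coeff (monomial (M + N)) L" .
qed

lemma monomial_empty: "monomial {#} = 1"
  by (rule series_eqI) (simp add: monomial.rep_eq one_lambda_ring.rep_eq)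

lemma psi_monomial: "psi k (monomial M) = monomial (adams k M)"
proof (rule series_eqI)
  fix L
  show "coeff (psi k (monomial M)) L = coeff (monomial (adams k M)) L"
  proof (cases "\<exists>N. L = adams k N")
    case True
    then show ?thesis
      by (auto simp: coeff_psi_image monomial.rep_eq adams_inject)
  next
    case False
    then show ?thesis
      by (subst coeff_psi_eq_0) (auto simp: monomial.rep_eq)
  qed
qed

lemma psi_partition_gen: "psi_partition l (gen g) = monomial (image_mset (\<lambda>k. (k, g)) l)"
  unfolding psi_partition_def
  by (induction l) (simp_all add: monomial_empty gen_def psi_monomial monomial_mult)

lemma count_image_mset_Pair:
  "count (image_mset (\<lambda>k. (k, h)) c) (k, h') = (if h = h' then count c k else 0)"
  by (induction c) auto

lemma count_joint_monomial:
  "count (joint_monomial M a b) (k, Base g) = count M (k, g)"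
  "count (joint_monomial M a b) (k, AlphX) = count a k"
  "count (joint_monomial M a b) (k, AlphXstar) = count b k"
proof -
  have "count (image_mset (map_prod id Base) M) (k, Base g) = count M (k, g)"
    "count (image_mset (map_prod id Base) M) (k, AlphX) = 0"
    "count (image_mset (map_prod id Base) M) (k, AlphXstar) = 0"
    by (induction M) auto
  then show "count (joint_monomial M a b) (k, Base g) = count M (k, g)"
    "count (joint_monomial M a b) (k, AlphX) = count a k"
    "count (joint_monomial M a b) (k, AlphXstar) = count b k"
    by (simp_all add: joint_monomial_def count_image_mset_Pair)
qed

lemma joint_monomial_inject:
  "joint_monomial M a b = joint_monomial M' a' b' \<longleftrightarrow> M = M' \<and> a = a' \<and> b = b'"
proof
  assume *: "joint_monomial M a b = joint_monomial M' a' b'"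
  have "count M t = count M' t" for t
    using count_joint_monomial(1)[of M a b "fst t" "snd t"]
      count_joint_monomial(1)[of M' a' b' "fst t" "snd t"] * by simp
  moreover have "count a k = count a' k" "count b k = count b' k" for k
    using count_joint_monomial(2,3)[of M a b k] count_joint_monomial(2,3)[of M' a' b' k] * by simp_all
  ultimately show "M = M' \<and> a = a' \<and> b = b'"
    by (simp add: multiset_eq_iff)
qed simp

lemma adams_joint_monomial:
  "adams k (joint_monomial M a b) = joint_monomial (adams k M) (scaled k a) (scaled k b)"
  by (simp add: joint_monomial_def multiset.map_comp comp_def case_prod_unfold)

text \<open>Applying p_k to one term of \<open>A_XX\<close> turns p_l[X] into the product of the
  p_{ki}[X] over the parts i of l. Each p_k[A] therefore comes with fixed factors in X and X^*, and
  monomials of this shape are the only ones in \<open>Exp A_XX\<close>.\<close>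

definition joint :: "(pos \<times> A_gen) multiset \<Rightarrow> (pos \<times> A_gen adjoin) multiset" where
  "joint M = joint_monomial M (outs M) (ins M)"

lemma joint_inject: "joint M = joint N \<longleftrightarrow> M = N"
  by (auto simp: joint_def joint_monomial_inject)

lemma joint_add: "joint (M + N) = joint M + joint N"
  by (simp add: joint_def joint_monomial_def)

lemma joint_empty [simp]: "joint {#} = {#}"
  by (simp add: joint_def joint_monomial_def)

lemma outs_adams: "outs (adams k M) = scaled k (outs M)"
  and ins_adams: "ins (adams k M) = scaled k (ins M)"
  by (induction M) (auto simp: case_prod_unfold multiset.map_comp comp_def pos_times_assoc)

lemma adams_joint: "adams k (joint M) = joint (adams k M)"
  by (simp add: joint_def adams_joint_monomial outs_adams ins_adams)

lemma coeff_A_XX: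
  "coeff A_XX J = (if \<exists>g. J = joint {#(pos_one, g)#} then 1 else 0)"
proof -
  define f :: "A_gen \<Rightarrow> A_gen adjoin lambda_ring" where
    "f = (\<lambda>(l, m). gen (Base (l, m)) * psi_partition l (gen AlphX) * psi_partition m (gen AlphXstar))"
  have A_XX: "A_XX = formal_sum f UNIV"
    unfolding A_XX_def f_def ..
  have f: "f g = monomial (joint {#(pos_one, g)#})" for g
    by (cases g)
      (simp add: f_def psi_partition_gen gen_def[of "Base _"] monomial_mult joint_def joint_monomial_def)
  have eq: "coeff (f g) J = (if J = joint {#(pos_one, g)#} then 1 else 0)" for g J
    unfolding f monomial.rep_eq by simp
  show ?thesis
  proof (cases "\<exists>g. J = joint {#(pos_one, g)#}")
    case True
    then obtain g where g: "J = joint {#(pos_one, g)#}"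
      by blast
    have "coeff A_XX J = (\<Sum>g\<in>{g}. coeff (f g) J)"
      unfolding A_XX
      by (rule coeff_formal_sum) (simp_all add: eq g joint_inject)
    with g show ?thesis
      by (simp add: eq joint_inject)
  next
    case False
    have z: "coeff (f g) J = 0" for g
    proof -
      have "J \<noteq> joint {#(pos_one, g)#}"
        using False by blast
      then show ?thesis
        by (simp add: eq)
    qed
    have "coeff A_XX J = (\<Sum>g\<in>{}. coeff (f g) J)"
      unfolding A_XX
      by (rule coeff_formal_sum) (simp_all add: z)
    with False show ?thesis
      by simp
  qed
qed

lemma coeff_A_XX_empty: "coeff A_XX {#} = 0"
proof -
  have "joint {#(pos_one, g)#} \<noteq> {#}" for g
    by (metis joint_empty joint_inject add_mset_not_empty)
  then show ?thesis
    by (simp add: coeff_A_XX)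
qed

text \<open>In \<open>A_XX\<close> all generators have colour \<open>pos_one\<close>, so the colour
  \<open>k\<close> reveals which Adams operation produced the monomial, and a single summand
  survives.\<close>

lemma coeff_plethystic_sum_A_XX:
  "coeff (plethystic_sum A_XX) (joint {#(k, g)#}) = 1 / of_nat (nat_of k)"
proof -
  have adams_k: "joint {#(k, g)#} = adams k (joint {#(pos_one, g)#})"
    by (simp add: adams_joint)
  have "coeff (psi j A_XX) (joint {#(k, g)#}) = 0" if "j \<noteq> k" for j
  proof (rule ccontr)
    assume "coeff (psi j A_XX) (joint {#(k, g)#}) \<noteq> 0"
    then obtain N where N: "joint {#(k, g)#} = adams j N" "coeff A_XX N \<noteq> 0"
      by (rule coeff_psi_nonzeroE)
    then obtain h where "N = joint {#(pos_one, h)#}"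
      by (auto simp: coeff_A_XX split: if_splits)
    with N(1) that show False
      by (simp add: adams_joint joint_inject)
  qed
  then have "coeff (plethystic_sum A_XX) (joint {#(k, g)#}) =
      (\<Sum>j\<in>{k}. coeff (psi j A_XX) (joint {#(k, g)#}) / of_nat (nat_of j))"
    by (intro coeff_plethystic_sum) (auto simp: coeff_A_XX_empty)
  moreover have "coeff (psi k A_XX) (joint {#(k, g)#}) = 1"
    unfolding adams_k coeff_psi_image coeff_A_XX by (rule if_P) blast
  ultimately show ?thesis
    by simp
qed

lemma coeff_plethystic_sum_A_XX_nonzeroE:
  assumes "coeff (plethystic_sum A_XX) J \<noteq> 0"
  obtains t where "J = joint {#t#}"
proof -
  have "\<exists>k. coeff (psi k A_XX) J \<noteq> 0"
  proof (rule ccontr)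
    assume "\<not> ?thesis"
    then have "coeff (plethystic_sum A_XX) J = 0"
      by (simp add: coeff_plethystic_sum_le coeff_A_XX_empty)
    with assms show False
      by simp
  qed
  then obtain k N where N: "J = adams k N" "coeff A_XX N \<noteq> 0"
    by (metis coeff_psi_nonzeroE)
  then obtain g where "N = joint {#(pos_one, g)#}"
    by (auto simp: coeff_A_XX split: if_splits)
  with N have "J = joint {#(k, g)#}"
    by (simp add: adams_joint)
  then show ?thesis
    by (rule that)
qed

lemma sum_mset_image_multiplicity:
  fixes f :: "'a \<Rightarrow> 'b :: comm_semiring_1"
  shows "(\<Sum>x\<in>#M. f x) = (\<Sum>x\<in>set_mset M. of_nat (count M x) * f x)"
proof (induction M)
  case (add t M)
  have "(\<Sum>x\<in>set_mset (add_mset t M). of_nat (count (add_mset t M) x) * f x) =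
      (\<Sum>x\<in>insert t (set_mset M). of_nat (count M x) * f x + (if x = t then f x else 0))"
    by (intro sum.cong) (auto simp: algebra_simps)
  also have "\<dots> = (\<Sum>x\<in>insert t (set_mset M). of_nat (count M x) * f x) + f t"
    by (simp add: sum.distrib sum.delta)
  also have "(\<Sum>x\<in>insert t (set_mset M). of_nat (count M x) * f x) =
      (\<Sum>x\<in>set_mset M. of_nat (count M x) * f x)"
    by (rule sum.mono_neutral_right) (auto simp: not_in_iff)
  finally show ?case
    using add by (simp add: add.commute)
qed simp

lemma size_joint: "size (joint M) = (\<Sum>t\<in>#M. size (joint {#t#}))"
proof (induction M)
  case (add t M)
  have "joint (add_mset t M) = joint {#t#} + joint M"
    by (simp flip: joint_add)
  with add show ?case
    by simp
qed simp

text \<open>Formally \<open>Exp A_XX\<close> is the product over all types (k, g) of the exponential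
  of the monomial \<open>joint {#(k, g)#}\<close> divided by k; a type of multiplicity n thus
  contributes 1 / (k^n n!). Instead of handling an infinite product, this value is checked against
  the recursion of the exponential. The description by \<open>THE\<close> is legitimate because
  \<open>joint\<close> is injective.\<close>

lemma coeff_Exp_A_XX:
  "coeff (Exp A_XX) J =
    (if \<exists>M. J = joint M then 1 / (color_product (THE M. J = joint M) *
       of_nat (mult_fact (THE M. J = joint M))) else 0)"
proof -
  define c :: "(pos \<times> A_gen) multiset \<Rightarrow> rat"
    where "c M = 1 / (color_product M * of_nat (mult_fact M))" for M
  define Z where "Z J = (if \<exists>M. J = joint M then c (THE M. J = joint M) else 0)" for J
  have Z_joint: "Z (joint M) = c M" for M
    by (auto simp: Z_def joint_inject)
  let ?E = "coeff (plethystic_sum A_XX)"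
  let ?t = "\<lambda>(N, K). of_nat (size N) * ?E N * Z K"
  have "coeff (exp_series (plethystic_sum A_XX)) J = Z J"
  proof (rule coeff_exp_series_eqI)
    show "?E {#} = 0"
      by (rule coeff_plethystic_sum_empty[OF coeff_A_XX_empty])
    show "Z {#} = 1"
      using Z_joint[of "{#}"] by (simp add: c_def)
  next
    fix J
    have nz: "\<exists>t K'. N = joint {#t#} \<and> K = joint K' \<and> J = joint (add_mset t K')"
      if "N + K = J" "?E N * Z K \<noteq> 0" for N K
    proof -
      from that obtain t where t: "N = joint {#t#}"
        using coeff_plethystic_sum_A_XX_nonzeroE[of N] by auto
      moreover from that obtain K' where K': "K = joint K'"
        by (auto simp: Z_def split: if_splits)
      moreover have "J = joint (add_mset t K')"
        using that(1) t K' joint_add[of "{#t#}" K'] by simp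
      ultimately show ?thesis
        by blast
    qed
    show "of_nat (size J) * Z J = (\<Sum>x\<in>{(N, K). N + K = J}. ?t x)"
    proof (cases "\<exists>M. J = joint M")
      case False
      have "?t x = 0" if "x \<in> {(N, K). N + K = J}" for x
        using nz[of "fst x" "snd x"] False that by (cases x) auto
      with False show ?thesis
        by (simp add: Z_def)
    next
      case True
      then obtain M where J: "J = joint M"
        by blast
      \<comment> \<open>The exponent is supported on single types, so only the splittings that take
        one \<open>t\<close> out of \<open>M\<close> contribute.\<close>
      let ?i = "\<lambda>t. (joint {#t#}, joint (M - {#t#}))"
      have "(\<Sum>x\<in>{(N, K). N + K = J}. ?t x) = (\<Sum>x\<in>?i ` set_mset M. ?t x)"
      proof (rule sum.mono_neutral_right)
        show "finite {(N, K). N + K = J}"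
          by (rule finite_multiset_splits)
        show "?i ` set_mset M \<subseteq> {(N, K). N + K = J}"
          by (auto simp: J simp flip: joint_add)
        show "\<forall>x\<in>{(N, K). N + K = J} - ?i ` set_mset M. ?t x = 0"
        proof
          fix x assume x: "x \<in> {(N, K). N + K = J} - ?i ` set_mset M"
          show "?t x = 0"
          proof (rule ccontr)
            assume "?t x \<noteq> 0"
            with x nz[of "fst x" "snd x"] obtain t K' where
              "fst x = joint {#t#}" "snd x = joint K'" "J = joint (add_mset t K')"
              by (cases x) auto
            then have "x = ?i t" "t \<in># M"
              by (cases x, auto simp: J joint_inject)+
            with x show False
              by blast
          qed
        qed
      qed
      also have "\<dots> = (\<Sum>t\<in>set_mset M. ?t (?i t))"
        by (rule sum.reindex_cong[of ?i]) (auto simp: inj_on_def joint_inject)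
      also have "\<dots> = (\<Sum>t\<in>set_mset M. of_nat (count M t) * of_nat (size (joint {#t#})) * c M)"
      proof (intro sum.cong refl)
        fix t assume "t \<in> set_mset M"
        then obtain K where M: "M = add_mset t K"
          by (metis multi_member_split)
        obtain k g where t: "t = (k, g)"
          by (cases t)
        \<comment> \<open>The factor \<open>nat_of k\<close> cancels the 1/k in the exponent, and
          \<open>count M t\<close> makes the sum over distinct \<open>t\<close> a sum over
          \<open>M\<close> with multiplicity. There the sizes of the \<open>joint {#t#}\<close> add
          up to the size of \<open>J\<close>.\<close>
        have "c K = of_nat (nat_of k) * of_nat (count M t) * c M"
        proof -
          define n where "n = count M t"
          have "(of_nat (mult_fact M) :: rat) = of_nat n * of_nat (mult_fact K)"
            unfolding n_def M mult_fact_add_mset of_nat_mult by simp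
          moreover have "color_product M = of_nat (nat_of k) * color_product K"
            by (simp add: M t)
          moreover have "n \<noteq> 0"
            by (simp add: n_def M)
          ultimately show ?thesis
            unfolding c_def n_def[symmetric] by simp
        qed
        then show "?t (?i t) = of_nat (count M t) * of_nat (size (joint {#t#})) * c M"
          by (simp add: M t Z_joint coeff_plethystic_sum_A_XX)
      qed
      also have "\<dots> = of_nat (size J) * Z J"
        by (simp add: J Z_joint size_joint[of M] sum_mset_image_multiplicity sum_distrib_right)
      finally show ?thesis
        by simp
    qed
  qed
  then show ?thesis
    by (simp add: Exp_eq Z_def c_def)
qed

lemma coeff_Exp_A_XX_joint_monomial:
  "coeff (Exp A_XX) (joint_monomial M a b) =
    (if a = outs M \<and> b = ins M then 1 / (color_product M * of_nat (mult_fact M)) else 0)"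
proof -
  have eq: "joint_monomial M a b = joint N \<longleftrightarrow> N = M \<and> a = outs M \<and> b = ins M" for N
    by (auto simp: joint_def joint_monomial_inject)
  have *: "coeff (Exp A_XX) (joint M) = 1 / (color_product M * of_nat (mult_fact M))"
    by (simp add: coeff_Exp_A_XX joint_inject)
  show ?thesis
  proof (cases "a = outs M \<and> b = ins M")
    case True
    with * show ?thesis
      by (simp add: joint_def)
  next
    case False
    then show ?thesis
      unfolding coeff_Exp_A_XX eq by auto
  qed
qed

text \<open>The base monomial \<open>M\<close> already fixes how often each power sum of X and of
  X^* occurs. The integral therefore has at most one term at each \<open>M\<close>, which also
  settles integrability.\<close>

lemma finite_nonzero_Exp_A_XX:
  "{(a, b). coeff (Exp A_XX) (joint_monomial M a b) \<noteq> 0} = {(outs M, ins M)}"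
  by (auto simp: coeff_Exp_A_XX_joint_monomial color_product_nonzero less_imp_neq[OF mult_fact_pos, symmetric])

lemma integrable_Exp_A_XX: "integrable_X (Exp A_XX)"
  by (simp add: integrable_X_def finite_nonzero_Exp_A_XX)

text \<open>The numerator is the Hall square of the power sum product indexed by
  \<open>outs M\<close>; orthogonality of distinct products gives 0 when the half-edge colours do
  not match.\<close>

definition integral_coeff :: "(pos \<times> A_gen) multiset \<Rightarrow> rat" where
  "integral_coeff M = (if outs M = ins M then
     part_product (outs M) * of_nat (mult_fact (outs M)) / (color_product M * of_nat (mult_fact M))
     else 0)"

lemma coeff_integral_Exp_A_XX: "coeff (integral_X (Exp A_XX)) M = integral_coeff M"
  unfolding integral_X_def coeff_Series finite_nonzero_Exp_A_XX
  by (simp add: integral_coeff_def coeff_Exp_A_XX_joint_monomial hall_powersum z_partition_eq)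

section \<open>Counting labelled graphs\<close>

lemma pos_times_pos_of_div:
  assumes "nat_of k dvd nat_of c"
  shows "pos_times k (pos_of (nat_of c div nat_of k)) = c"
proof -
  from assms have "nat_of c div nat_of k > 0"
    by (metis dvd_imp_le nat_of_pos div_greater_zero_iff)
  with assms show ?thesis
    by (simp add: pos_eq_iff)
qed

lemma pos_of_div_pos_times [simp]: "pos_of (nat_of (pos_times k c) div nat_of k) = c"
  by (simp add: nat_of_inverse)

definition divided :: "pos \<Rightarrow> partition \<Rightarrow> partition" where
  "divided k = image_mset (\<lambda>c. pos_of (nat_of c div nat_of k))"

lemma divided_scaled: "divided k (scaled k l) = l"
  by (simp add: divided_def multiset.map_comp comp_def del: nat_of_pos_times)

lemma scaled_divided:
  assumes "\<And>c. c \<in># N \<Longrightarrow> nat_of k dvd nat_of c"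
  shows "scaled k (divided k N) = N"
proof -
  have "image_mset (\<lambda>c. pos_times k (pos_of (nat_of c div nat_of k))) N = image_mset (\<lambda>c. c) N"
    by (rule image_mset_cong) (simp add: assms pos_times_pos_of_div)
  then show ?thesis
    by (simp add: divided_def multiset.map_comp comp_def)
qed

lemma out_partition_eq:
  "out_partition \<Gamma> v = divided (vcolor \<Gamma> v) (fibre (ecolor \<Gamma>) (arcs \<Gamma>) (tail \<Gamma>) v)"
  by (simp add: out_partition_def divided_def fibre_def multiset.map_comp comp_def)

lemma in_partition_eq:
  "in_partition \<Gamma> v = divided (vcolor \<Gamma> v) (fibre (ecolor \<Gamma>) (arcs \<Gamma>) (head \<Gamma>) v)"
  by (simp add: in_partition_def divided_def fibre_def multiset.map_comp comp_def)

lemma in_fibre_iff: "finite E \<Longrightarrow> c' \<in># fibre c E f v \<longleftrightarrow> (\<exists>e\<in>E. f e = v \<and> c' = c e)"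
  by (auto simp: fibre_def)

lemma scaled_out_partition:
  assumes "admissible \<Gamma>" "finite (arcs \<Gamma>)"
  shows "scaled (vcolor \<Gamma> v) (out_partition \<Gamma> v) = fibre (ecolor \<Gamma>) (arcs \<Gamma>) (tail \<Gamma>) v"
  unfolding out_partition_eq
  by (rule scaled_divided) (use assms in \<open>auto simp: admissible_def in_fibre_iff\<close>)

lemma scaled_in_partition:
  assumes "admissible \<Gamma>" "finite (arcs \<Gamma>)"
  shows "scaled (vcolor \<Gamma> v) (in_partition \<Gamma> v) = fibre (ecolor \<Gamma>) (arcs \<Gamma>) (head \<Gamma>) v"
  unfolding in_partition_eq
  by (rule scaled_divided) (use assms in \<open>auto simp: admissible_def in_fibre_iff\<close>)

text \<open>The divisibility required by admissibility is built into vertex types: if the edges at a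
  vertex have colours k times the parts of a partition, k divides each of them. A graph assembled
  from vertex types is thus automatically admissible.\<close>

lemma dvd_of_fibre_eq_scaled:
  assumes "finite E" "e \<in> E" "fibre c E f (f e) = scaled k l"
  shows "nat_of k dvd nat_of (c e)"
proof -
  have "c e \<in># scaled k l"
    unfolding assms(3)[symmetric] using assms(1,2) by (auto simp: in_fibre_iff)
  then obtain x where "c e = pos_times k x"
    by auto
  then show ?thesis
    by simp
qed

definition vertex_type :: "('v, 'e) colored_digraph \<Rightarrow> 'v \<Rightarrow> pos \<times> A_gen" where
  "vertex_type \<Gamma> v = (vcolor \<Gamma> v, out_partition \<Gamma> v, in_partition \<Gamma> v)"

definition graph_monomial :: "('v, 'e) colored_digraph \<Rightarrow> (pos \<times> A_gen) multiset" where
  "graph_monomial \<Gamma> = image_mset (vertex_type \<Gamma>) (mset_set (verts \<Gamma>))"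

text \<open>
  Since the record fields are total functions, they are required to be \<^const>\<open>undefined\<close> outside the
  vertex and edge sets, so that distinct records are distinct labelled graphs.
\<close>

definition labelled_graphs ::
    "'v set \<Rightarrow> 'e set \<Rightarrow> (pos \<times> A_gen) multiset \<Rightarrow> ('v, 'e) colored_digraph set" where
  "labelled_graphs V E M = {\<Gamma>. verts \<Gamma> = V \<and> arcs \<Gamma> = E \<and>
     tail \<Gamma> \<in> E \<rightarrow>\<^sub>E V \<and> head \<Gamma> \<in> E \<rightarrow>\<^sub>E V \<and>
     vcolor \<Gamma> \<in> extensional V \<and> ecolor \<Gamma> \<in> extensional E \<and>
     admissible \<Gamma> \<and> graph_monomial \<Gamma> = M}"

lemma size_graph_monomial: "size (graph_monomial \<Gamma>) = card (verts \<Gamma>)"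
  by (simp add: graph_monomial_def)

lemma outs_image_mset:
  "outs (image_mset f (mset_set V)) = (\<Sum>v\<in>V. scaled (fst (f v)) (fst (snd (f v))))"
  "ins (image_mset f (mset_set V)) = (\<Sum>v\<in>V. scaled (fst (f v)) (snd (snd (f v))))"
  by (simp_all add: outs_def ins_def case_prod_unfold multiset.map_comp comp_def sum_unfold_sum_mset)

lemma outs_graph_monomial:
  assumes "admissible \<Gamma>" "finite (arcs \<Gamma>)" "finite (verts \<Gamma>)" "tail \<Gamma> \<in> arcs \<Gamma> \<rightarrow> verts \<Gamma>"
  shows "outs (graph_monomial \<Gamma>) = image_mset (ecolor \<Gamma>) (mset_set (arcs \<Gamma>))"
  using sum_fibre[OF assms(2,3,4), of "ecolor \<Gamma>"]
  by (simp add: graph_monomial_def outs_image_mset vertex_type_def scaled_out_partition[OF assms(1,2)])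

lemma ins_graph_monomial:
  assumes "admissible \<Gamma>" "finite (arcs \<Gamma>)" "finite (verts \<Gamma>)" "head \<Gamma> \<in> arcs \<Gamma> \<rightarrow> verts \<Gamma>"
  shows "ins (graph_monomial \<Gamma>) = image_mset (ecolor \<Gamma>) (mset_set (arcs \<Gamma>))"
  using sum_fibre[OF assms(2,3,4), of "ecolor \<Gamma>"]
  by (simp add: graph_monomial_def outs_image_mset vertex_type_def scaled_in_partition[OF assms(1,2)])

definition aut_product :: "(pos \<times> A_gen) multiset \<Rightarrow> nat" where
  "aut_product M = (\<Prod>(k, l, m)\<in>#M. mult_fact l * mult_fact m)"

lemma mult_fact_scaled: "mult_fact (scaled k l) = mult_fact l"
  by (rule mult_fact_image_inj) (simp add: inj_on_def pos_times_inject)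

text \<open>The number of labelled graphs with vertex types \<open>M\<close>, divided by the
  factorials of the numbers of vertices and edges (\<open>card_labelled_graphs\<close>).
  Equivalently, it is \<open>integral_coeff\<close> stripped of the scalar weight
  (\<open>integral_coeff_eq\<close>).\<close>

definition graph_density :: "(pos \<times> A_gen) multiset \<Rightarrow> rat" where
  "graph_density M = (if outs M = ins M then
     of_nat (mult_fact (outs M)) / of_nat (mult_fact M * aut_product M) else 0)"

lemma aut_product_pos: "aut_product M > 0"
  by (induction M) (auto simp: aut_product_def mult_fact_pos)

lemma labelled_graphsD:
  assumes "\<Gamma> \<in> labelled_graphs V E M" "finite V" "finite E"
  shows "size M = card V" "outs M = image_mset (ecolor \<Gamma>) (mset_set E)"
    "ins M = image_mset (ecolor \<Gamma>) (mset_set E)" "size (outs M) = card E"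
proof -
  from assms have \<Gamma>: "verts \<Gamma> = V" "arcs \<Gamma> = E" "tail \<Gamma> \<in> E \<rightarrow> V" "head \<Gamma> \<in> E \<rightarrow> V"
    "admissible \<Gamma>" "graph_monomial \<Gamma> = M"
    by (auto simp: labelled_graphs_def)
  with assms size_graph_monomial[of \<Gamma>] outs_graph_monomial[of \<Gamma>] ins_graph_monomial[of \<Gamma>]
  show "size M = card V" and *: "outs M = image_mset (ecolor \<Gamma>) (mset_set E)"
    "ins M = image_mset (ecolor \<Gamma>) (mset_set E)"
    by simp_all
  then show "size (outs M) = card E"
    by simp
qed

text \<open>Vertex types prescribe the fibres of the tail and head maps. So a labelled graph amounts
  to a choice of types, then of edge colours with the multiset forced by these types, then of a tail
  map and a head map. The last two choices are independent of each other, and therefore the count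
  factorizes.\<close>

lemma bij_betw_labelled_graphs:
  fixes V :: "'v set" and E :: "'e set"
  assumes "finite V" "finite E"
  shows "bij_betw (\<lambda>(\<tau>, c, t, h). \<lparr>verts = V, arcs = E, tail = t, head = h,
      vcolor = restrict (fst \<circ> \<tau>) V, ecolor = c\<rparr>)
    (SIGMA \<tau>:{\<tau> \<in> V \<rightarrow>\<^sub>E UNIV. image_mset \<tau> (mset_set V) = M}.
     SIGMA c:{c \<in> E \<rightarrow>\<^sub>E UNIV. image_mset c (mset_set E) = outs M}.
       functions_with_fibres c E V (\<lambda>v. scaled (fst (\<tau> v)) (fst (snd (\<tau> v)))) \<times>
       functions_with_fibres c E V (\<lambda>v. scaled (fst (\<tau> v)) (snd (snd (\<tau> v)))))
    (labelled_graphs V E M)"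
  (is "bij_betw ?f ?S _")
proof (rule bij_betw_byWitness[where f' = "\<lambda>\<Gamma>. (restrict (vertex_type \<Gamma>) V, ecolor \<Gamma>, tail \<Gamma>, head \<Gamma>)"])
  have types: "out_partition (?f (\<tau>, c, t, h)) v = fst (snd (\<tau> v))"
    "in_partition (?f (\<tau>, c, t, h)) v = snd (snd (\<tau> v))"
    "vertex_type (?f (\<tau>, c, t, h)) v = \<tau> v"
    if "(\<tau>, c, t, h) \<in> ?S" "v \<in> V" for \<tau> c t h v
  proof -
    from that have fib: "fibre c E t v = scaled (fst (\<tau> v)) (fst (snd (\<tau> v)))"
      "fibre c E h v = scaled (fst (\<tau> v)) (snd (snd (\<tau> v)))"
      by (auto simp: functions_with_fibres_def)
    with that show "out_partition (?f (\<tau>, c, t, h)) v = fst (snd (\<tau> v))"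
      "in_partition (?f (\<tau>, c, t, h)) v = snd (snd (\<tau> v))"
      by (simp_all add: out_partition_eq in_partition_eq divided_scaled)
    with that show "vertex_type (?f (\<tau>, c, t, h)) v = \<tau> v"
      by (simp add: vertex_type_def)
  qed
  show "\<forall>x\<in>?S. (\<lambda>\<Gamma>. (restrict (vertex_type \<Gamma>) V, ecolor \<Gamma>, tail \<Gamma>, head \<Gamma>)) (?f x) = x"
  proof
    fix x assume x: "x \<in> ?S"
    obtain \<tau> c t h where xe: "x = (\<tau>, c, t, h)"
      by (rule prod_cases4)
    have "restrict (vertex_type (?f x)) V = \<tau>"
    proof
      fix v
      show "restrict (vertex_type (?f x)) V v = \<tau> v"
        using types(3)[of \<tau> c t h v] x unfolding xe
        by (cases "v \<in> V") (auto simp: PiE_def extensional_def)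
    qed
    then show "(\<lambda>\<Gamma>. (restrict (vertex_type \<Gamma>) V, ecolor \<Gamma>, tail \<Gamma>, head \<Gamma>)) (?f x) = x"
      by (simp add: xe)
  qed
  show "\<forall>\<Gamma>\<in>labelled_graphs V E M. ?f (restrict (vertex_type \<Gamma>) V, ecolor \<Gamma>, tail \<Gamma>, head \<Gamma>) = \<Gamma>"
  proof
    fix \<Gamma> :: "('v, 'e) colored_digraph" assume \<Gamma>: "\<Gamma> \<in> labelled_graphs V E M"
    then have "restrict (fst \<circ> restrict (vertex_type \<Gamma>) V) V = vcolor \<Gamma>"
      by (auto simp: labelled_graphs_def vertex_type_def extensional_def fun_eq_iff)
    with \<Gamma> show "?f (restrict (vertex_type \<Gamma>) V, ecolor \<Gamma>, tail \<Gamma>, head \<Gamma>) = \<Gamma>"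
      by (simp add: labelled_graphs_def)
  qed
  show "?f ` ?S \<subseteq> labelled_graphs V E M"
  proof
    fix \<Gamma> assume "\<Gamma> \<in> ?f ` ?S"
    then obtain x where "x \<in> ?S" "\<Gamma> = ?f x"
      by blast
    moreover obtain \<tau> c t h where "x = (\<tau>, c, t, h)"
      by (rule prod_cases4)
    ultimately have x: "(\<tau>, c, t, h) \<in> ?S" and \<Gamma>: "\<Gamma> = ?f (\<tau>, c, t, h)"
      by simp_all
    have "image_mset (vertex_type \<Gamma>) (mset_set V) = image_mset \<tau> (mset_set V)"
      using types(3)[OF x] \<Gamma> assms by (intro image_mset_cong) auto
    with x \<Gamma> have M: "graph_monomial \<Gamma> = M"
      by (simp add: graph_monomial_def)
    have "admissible \<Gamma>"
      unfolding admissible_def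
    proof
      fix e assume "e \<in> arcs \<Gamma>"
      then have e: "e \<in> E"
        by (simp add: \<Gamma>)
      with x have "t e \<in> V" "h e \<in> V"
        by (auto simp: functions_with_fibres_def)
      with x have "fibre c E t (t e) = scaled (fst (\<tau> (t e))) (fst (snd (\<tau> (t e))))"
        "fibre c E h (h e) = scaled (fst (\<tau> (h e))) (snd (snd (\<tau> (h e))))"
        by (auto simp: functions_with_fibres_def)
      from this[THEN dvd_of_fibre_eq_scaled[OF assms(2) e]] \<open>t e \<in> V\<close> \<open>h e \<in> V\<close>
      show "nat_of (vcolor \<Gamma> (tail \<Gamma> e)) dvd nat_of (ecolor \<Gamma> e) \<and>
          nat_of (vcolor \<Gamma> (head \<Gamma> e)) dvd nat_of (ecolor \<Gamma> e)"
        by (simp add: \<Gamma>)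
    qed
    with x M show "\<Gamma> \<in> labelled_graphs V E M"
      by (auto simp: labelled_graphs_def \<Gamma> functions_with_fibres_def PiE_def)
  qed
  show "(\<lambda>\<Gamma>. (restrict (vertex_type \<Gamma>) V, ecolor \<Gamma>, tail \<Gamma>, head \<Gamma>)) ` labelled_graphs V E M \<subseteq> ?S"
  proof
    fix x assume "x \<in> (\<lambda>\<Gamma>. (restrict (vertex_type \<Gamma>) V, ecolor \<Gamma>, tail \<Gamma>, head \<Gamma>)) ` labelled_graphs V E M"
    then obtain \<Gamma> :: "('v, 'e) colored_digraph" where \<Gamma>: "\<Gamma> \<in> labelled_graphs V E M"
      and x: "x = (restrict (vertex_type \<Gamma>) V, ecolor \<Gamma>, tail \<Gamma>, head \<Gamma>)"
      by blast
    have "image_mset (restrict (vertex_type \<Gamma>) V) (mset_set V) = image_mset (vertex_type \<Gamma>) (mset_set V)"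
      using assms by (intro image_mset_cong) auto
    moreover have "image_mset (ecolor \<Gamma>) (mset_set E) = outs M"
      using labelled_graphsD[OF \<Gamma> assms] by simp
    moreover from \<Gamma> have "fibre (ecolor \<Gamma>) E (tail \<Gamma>) v = scaled (vcolor \<Gamma> v) (out_partition \<Gamma> v)"
      "fibre (ecolor \<Gamma>) E (head \<Gamma>) v = scaled (vcolor \<Gamma> v) (in_partition \<Gamma> v)" for v
      using scaled_out_partition[of \<Gamma> v] scaled_in_partition[of \<Gamma> v] assms
      by (auto simp: labelled_graphs_def)
    ultimately show "x \<in> ?S"
      using \<Gamma> by (auto simp: x labelled_graphs_def functions_with_fibres_def graph_monomial_def
          vertex_type_def PiE_def)
  qed
qed

lemma finite_functions_with_image_mset:
  assumes "finite E"
  shows "finite {f \<in> E \<rightarrow>\<^sub>E UNIV. image_mset f (mset_set E) = R}"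
proof (rule finite_subset)
  show "{f \<in> E \<rightarrow>\<^sub>E UNIV. image_mset f (mset_set E) = R} \<subseteq> E \<rightarrow>\<^sub>E set_mset R"
    using assms by (auto simp: PiE_def)
qed (simp add: finite_PiE assms)

lemma finite_labelled_graphs:
  assumes "finite V" "finite E"
  shows "finite (labelled_graphs V E M)"
  by (rule bij_betw_finite[OF bij_betw_labelled_graphs[OF assms], THEN iffD1])
    (intro finite_SigmaI finite_functions_with_image_mset finite_functions_with_fibres assms)

text \<open>With \<open>m = mult_fact (outs M)\<close>, there are
  \<open>fact (card V) / mult_fact M\<close> choices of types, \<open>fact (card E) / m\<close> of
  edge colours, and \<open>m\<close> over the relevant product of \<open>mult_fact\<close> values
  for each of the tail and head maps. One \<open>m\<close> cancels; the other remains in the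
  density. If outgoing and incoming colours differ, there is no graph.\<close>

lemma card_labelled_graphs:
  fixes V :: "'v set" and E :: "'e set"
  assumes "finite V" "finite E" "card V = size M" "card E = size (outs M)"
  shows "of_nat (card (labelled_graphs V E M)) = fact (card V) * fact (card E) * graph_density M"
proof (cases "outs M = ins M")
  case False
  then have "labelled_graphs V E M = {}"
    using labelled_graphsD(2,3)[OF _ assms(1,2)] by (metis ex_in_conv)
  with False show ?thesis
    by (simp add: graph_density_def)
next
  case True
  let ?T = "{\<tau> \<in> V \<rightarrow>\<^sub>E UNIV. image_mset \<tau> (mset_set V) = M}"
  let ?C = "{c \<in> E \<rightarrow>\<^sub>E UNIV. image_mset c (mset_set E) = outs M}"
  let ?O = "\<lambda>\<tau> c. functions_with_fibres c E V (\<lambda>v. scaled (fst (\<tau> v)) (fst (snd (\<tau> v))))"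
  let ?I = "\<lambda>\<tau> c. functions_with_fibres c E V (\<lambda>v. scaled (fst (\<tau> v)) (snd (snd (\<tau> v))))"
  let ?m = "mult_fact (outs M)"
  have inner: "card (?O \<tau> c \<times> ?I \<tau> c) * aut_product M = ?m * ?m" if "\<tau> \<in> ?T" "c \<in> ?C" for \<tau> c
  proof -
    have M: "M = image_mset \<tau> (mset_set V)"
      using that by simp
    have 1: "card (?O \<tau> c) * (\<Prod>v\<in>V. mult_fact (fst (snd (\<tau> v)))) = ?m"
      using card_functions_with_fibres[OF assms(2,1), of "\<lambda>v. scaled (fst (\<tau> v)) (fst (snd (\<tau> v)))" c] that
        outs_image_mset(1)[of \<tau> V]
      by (simp add: M mult_fact_scaled)
    have 2: "card (?I \<tau> c) * (\<Prod>v\<in>V. mult_fact (snd (snd (\<tau> v)))) = ?m"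
      using card_functions_with_fibres[OF assms(2,1), of "\<lambda>v. scaled (fst (\<tau> v)) (snd (snd (\<tau> v)))" c] that
        outs_image_mset(2)[of \<tau> V] True
      by (simp add: M mult_fact_scaled)
    have 3: "aut_product M =
        (\<Prod>v\<in>V. mult_fact (fst (snd (\<tau> v)))) * (\<Prod>v\<in>V. mult_fact (snd (snd (\<tau> v))))"
      by (simp add: aut_product_def M case_prod_unfold multiset.map_comp comp_def
          prod.distrib flip: prod_unfold_prod_mset)
    have "card (?O \<tau> c \<times> ?I \<tau> c) * aut_product M =
        (card (?O \<tau> c) * (\<Prod>v\<in>V. mult_fact (fst (snd (\<tau> v))))) *
        (card (?I \<tau> c) * (\<Prod>v\<in>V. mult_fact (snd (snd (\<tau> v)))))"
      unfolding 3 card_cartesian_product by (simp only: mult_ac)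
    then show ?thesis
      unfolding 1 2 .
  qed
  have "card (labelled_graphs V E M) =
      card (SIGMA \<tau>:?T. SIGMA c:?C. ?O \<tau> c \<times> ?I \<tau> c)"
    using bij_betw_same_card[OF bij_betw_labelled_graphs[OF assms(1,2), of M]] by simp
  also have "\<dots> = (\<Sum>\<tau>\<in>?T. \<Sum>c\<in>?C. card (?O \<tau> c \<times> ?I \<tau> c))"
    using assms(1,2)
    by (subst card_SigmaI; (subst card_SigmaI)?)
      (auto intro!: finite_functions_with_image_mset finite_functions_with_fibres finite_SigmaI
         finite_cartesian_product simp: card_cartesian_product)
  finally have "card (labelled_graphs V E M) * aut_product M =
      (\<Sum>\<tau>\<in>?T. \<Sum>c\<in>?C. card (?O \<tau> c \<times> ?I \<tau> c) * aut_product M)"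
    by (simp only: sum_distrib_right)
  also have "\<dots> = (\<Sum>\<tau>\<in>?T. \<Sum>c\<in>?C. ?m * ?m)"
    by (intro sum.cong refl inner)
  also have "\<dots> = card ?T * card ?C * (?m * ?m)"
    by (simp only: sum_constant) simp
  finally have "card (labelled_graphs V E M) * aut_product M * mult_fact M =
      (card ?T * mult_fact M) * (card ?C * ?m) * ?m"
    by (simp only: mult_ac)
  also have "\<dots> = fact (card V) * fact (card E) * ?m"
    by (simp only: card_functions_with_image_mset[OF assms(1,3)]
        card_functions_with_image_mset[OF assms(2,4)])
  finally have "of_nat (card (labelled_graphs V E M) * aut_product M * mult_fact M) =
      (of_nat (fact (card V) * fact (card E) * ?m) :: rat)"
    by (simp only:)
  then show ?thesis
    using True aut_product_pos[of M] mult_fact_pos[of M]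
    by (simp add: graph_density_def field_simps)
qed

section \<open>Connectedness\<close>

lemma underlying_simps [simp]:
  "verts (underlying \<Gamma>) = verts \<Gamma>" "arcs (underlying \<Gamma>) = arcs \<Gamma>"
  "tail (underlying \<Gamma>) = tail \<Gamma>" "head (underlying \<Gamma>) = head \<Gamma>"
  by (simp_all add: underlying_def pre_digraph.defs)

definition wf_graph :: "('v, 'e) colored_digraph \<Rightarrow> bool" where
  "wf_graph \<Gamma> \<longleftrightarrow> finite (verts \<Gamma>) \<and> finite (arcs \<Gamma>) \<and>
     tail \<Gamma> \<in> arcs \<Gamma> \<rightarrow> verts \<Gamma> \<and> head \<Gamma> \<in> arcs \<Gamma> \<rightarrow> verts \<Gamma>"

lemma fin_digraph_underlying: "fin_digraph (underlying \<Gamma>) \<longleftrightarrow> wf_graph \<Gamma>"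
  by (auto simp: fin_digraph_def fin_digraph_axioms_def wf_digraph_def wf_graph_def)

lemma wf_graphD:
  assumes "wf_graph \<Gamma>"
  shows "finite (verts \<Gamma>)" "finite (arcs \<Gamma>)"
    "e \<in> arcs \<Gamma> \<Longrightarrow> tail \<Gamma> e \<in> verts \<Gamma>" "e \<in> arcs \<Gamma> \<Longrightarrow> head \<Gamma> e \<in> verts \<Gamma>"
  using assms by (auto simp: wf_graph_def)

text \<open>Inside the vertex set these are the unions of connected components. Connectedness and
  components are treated through closed sets, so that splitting and gluing involve no paths.\<close>

definition closed_set :: "('v, 'e) colored_digraph \<Rightarrow> 'v set \<Rightarrow> bool" where
  "closed_set \<Gamma> S \<longleftrightarrow> (\<forall>e\<in>arcs \<Gamma>. tail \<Gamma> e \<in> S \<longleftrightarrow> head \<Gamma> e \<in> S)"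

definition connected_graph :: "('v, 'e) colored_digraph \<Rightarrow> bool" where
  "connected_graph \<Gamma> \<longleftrightarrow> verts \<Gamma> \<noteq> {} \<and>
     (\<forall>S\<subseteq>verts \<Gamma>. S \<noteq> {} \<and> closed_set \<Gamma> S \<longrightarrow> S = verts \<Gamma>)"

lemma connected_graphD:
  "connected_graph \<Gamma> \<Longrightarrow> S \<subseteq> verts \<Gamma> \<Longrightarrow> S \<noteq> {} \<Longrightarrow> closed_set \<Gamma> S \<Longrightarrow> S = verts \<Gamma>"
  by (simp add: connected_graph_def)

text \<open>A nonempty closed set contains everything reachable from its elements in the symmetrized
  relation; conversely the vertices reachable from a given one form a closed set.\<close>

lemma connected_underlying:
  assumes "wf_graph \<Gamma>"
  shows "Digraph_Component.connected (underlying \<Gamma>) \<longleftrightarrow> connected_graph \<Gamma>"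
proof -
  let ?H = "mk_symmetric (underlying \<Gamma>)"
  let ?R = "parcs ?H"
  interpret fin_digraph "underlying \<Gamma>"
    using assms by (simp add: fin_digraph_underlying)
  interpret H: pair_wf_digraph ?H ..
  have R: "(u, v) \<in> ?R \<longleftrightarrow> (\<exists>e\<in>arcs \<Gamma>. (u, v) = (tail \<Gamma> e, head \<Gamma> e) \<or> (u, v) = (head \<Gamma> e, tail \<Gamma> e))" for u v
    by (auto simp: parcs_mk_symmetric)
  have "Digraph_Component.connected (underlying \<Gamma>) \<longleftrightarrow>
      verts \<Gamma> \<noteq> {} \<and> (\<forall>u\<in>verts \<Gamma>. \<forall>v\<in>verts \<Gamma>. (u, v) \<in> ?R\<^sup>*)"
    by (simp add: Digraph_Component.connected_def strongly_connected_def H.reachable_conv' cong: ball_cong)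
  also have "\<dots> \<longleftrightarrow> connected_graph \<Gamma>"
  proof
    assume *: "verts \<Gamma> \<noteq> {} \<and> (\<forall>u\<in>verts \<Gamma>. \<forall>v\<in>verts \<Gamma>. (u, v) \<in> ?R\<^sup>*)"
    have "S = verts \<Gamma>" if S: "S \<subseteq> verts \<Gamma>" "S \<noteq> {}" "closed_set \<Gamma> S" for S
    proof
      from S(2) obtain u where u: "u \<in> S"
        by blast
      have step: "y \<in> S" if "(u, y) \<in> ?R\<^sup>*" for y
        using that
      proof (induction rule: rtrancl_induct)
        case base
        show ?case
          by (fact u)
      next
        case (step y z)
        from step(2) R[of y z] obtain e where e: "e \<in> arcs \<Gamma>"
          "(y = tail \<Gamma> e \<and> z = head \<Gamma> e) \<or> (y = head \<Gamma> e \<and> z = tail \<Gamma> e)"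
          by auto
        with S(3) have "tail \<Gamma> e \<in> S \<longleftrightarrow> head \<Gamma> e \<in> S"
          by (simp add: closed_set_def)
        with e(2) step(3) show ?case
          by auto
      qed
      show "verts \<Gamma> \<subseteq> S"
        using * S(1) u step by blast
    qed (fact S(1))
    with * show "connected_graph \<Gamma>"
      by (simp add: connected_graph_def)
  next
    assume c: "connected_graph \<Gamma>"
    have "(u, v) \<in> ?R\<^sup>*" if u: "u \<in> verts \<Gamma>" and v: "v \<in> verts \<Gamma>" for u v
    proof -
      let ?S = "{y \<in> verts \<Gamma>. (u, y) \<in> ?R\<^sup>*}"
      have "closed_set \<Gamma> ?S"
        unfolding closed_set_def
      proof
        fix e assume e: "e \<in> arcs \<Gamma>"
        then have "(tail \<Gamma> e, head \<Gamma> e) \<in> ?R" "(head \<Gamma> e, tail \<Gamma> e) \<in> ?R"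
          by (auto simp: R)
        then have "(u, tail \<Gamma> e) \<in> ?R\<^sup>* \<longleftrightarrow> (u, head \<Gamma> e) \<in> ?R\<^sup>*"
          by (meson rtrancl.rtrancl_into_rtrancl)
        then show "tail \<Gamma> e \<in> ?S \<longleftrightarrow> head \<Gamma> e \<in> ?S"
          using e wf_graphD(3,4)[OF assms] by simp
      qed
      moreover have "?S \<noteq> {}"
        using u by auto
      ultimately have "?S = verts \<Gamma>"
        by (intro connected_graphD[OF c]) simp_all
      with v show ?thesis
        by blast
    qed
    with c show "verts \<Gamma> \<noteq> {} \<and> (\<forall>u\<in>verts \<Gamma>. \<forall>v\<in>verts \<Gamma>. (u, v) \<in> ?R\<^sup>*)"
      by (auto simp: connected_graph_def)
  qed
  finally show ?thesis .
qed

lemma connected_admissible_graphs_eq: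
  "connected_admissible_graphs = {\<Gamma>. wf_graph \<Gamma> \<and> connected_graph \<Gamma> \<and> admissible \<Gamma>}"
  by (auto simp: connected_admissible_graphs_def fin_digraph_underlying connected_underlying)

section \<open>Isomorphisms of coloured graphs\<close>

lemma color_iso_pairD:
  assumes "color_iso_pair \<Gamma> \<Delta> f g"
  shows "bij_betw f (verts \<Gamma>) (verts \<Delta>)" "bij_betw g (arcs \<Gamma>) (arcs \<Delta>)"
    "v \<in> verts \<Gamma> \<Longrightarrow> vcolor \<Delta> (f v) = vcolor \<Gamma> v"
    "e \<in> arcs \<Gamma> \<Longrightarrow> ecolor \<Delta> (g e) = ecolor \<Gamma> e"
    "e \<in> arcs \<Gamma> \<Longrightarrow> tail \<Delta> (g e) = f (tail \<Gamma> e)"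
    "e \<in> arcs \<Gamma> \<Longrightarrow> head \<Delta> (g e) = f (head \<Gamma> e)"
  using assms by (auto simp: color_iso_pair_def)

lemma color_iso_pair_comp:
  assumes "color_iso_pair \<Gamma> \<Delta> f g" "color_iso_pair \<Delta> \<Theta> f' g'" "wf_graph \<Gamma>"
  shows "color_iso_pair \<Gamma> \<Theta> (f' \<circ> f) (g' \<circ> g)"
  using bij_betw_trans[OF color_iso_pairD(1)[OF assms(1)] color_iso_pairD(1)[OF assms(2)]]
    bij_betw_trans[OF color_iso_pairD(2)[OF assms(1)] color_iso_pairD(2)[OF assms(2)]]
    bij_betwE[OF color_iso_pairD(1)[OF assms(1)]] bij_betwE[OF color_iso_pairD(2)[OF assms(1)]]
  by (simp add: color_iso_pair_def color_iso_pairD[OF assms(1)] color_iso_pairD[OF assms(2)]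
      wf_graphD[OF assms(3)])

lemma color_iso_pair_id: "color_iso_pair \<Gamma> \<Gamma> id id"
  by (simp add: color_iso_pair_def)

lemma color_iso_pair_inv:
  assumes "color_iso_pair \<Gamma> \<Delta> f g" "wf_graph \<Gamma>"
  shows "color_iso_pair \<Delta> \<Gamma> (inv_into (verts \<Gamma>) f) (inv_into (arcs \<Gamma>) g)"
proof -
  note bf = color_iso_pairD(1)[OF assms(1)] and bg = color_iso_pairD(2)[OF assms(1)]
  let ?f = "inv_into (verts \<Gamma>) f" and ?g = "inv_into (arcs \<Gamma>) g"
  have f: "?f w \<in> verts \<Gamma>" "f (?f w) = w" if "w \<in> verts \<Delta>" for w
    using bf that by (auto simp: bij_betw_def inv_into_into f_inv_into_f)
  have g: "?g e \<in> arcs \<Gamma>" "g (?g e) = e" if "e \<in> arcs \<Delta>" for e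
    using bg that by (auto simp: bij_betw_def inv_into_into f_inv_into_f)
  have inv: "?f (f v) = v" if "v \<in> verts \<Gamma>" for v
    using bf that by (auto simp: bij_betw_def)
  have "vcolor \<Gamma> (?f w) = vcolor \<Delta> w" if "w \<in> verts \<Delta>" for w
    using color_iso_pairD(3)[OF assms(1) f(1)[OF that]] f(2)[OF that] by simp
  moreover have "ecolor \<Gamma> (?g e) = ecolor \<Delta> e" "tail \<Gamma> (?g e) = ?f (tail \<Delta> e)"
    "head \<Gamma> (?g e) = ?f (head \<Delta> e)" if e: "e \<in> arcs \<Delta>" for e
    using color_iso_pairD(4,5,6)[OF assms(1) g(1)[OF e]] g(2)[OF e]
      inv[OF wf_graphD(3)[OF assms(2) g(1)[OF e]]] inv[OF wf_graphD(4)[OF assms(2) g(1)[OF e]]]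
    by simp_all
  ultimately show ?thesis
    using bij_betw_inv_into[OF bf] bij_betw_inv_into[OF bg] by (simp add: color_iso_pair_def)
qed

lemma bij_betw_fibre:
  assumes "bij_betw g E E'" "bij_betw f V V'" "v \<in> V" "t \<in> E \<rightarrow> V"
    "\<And>e. e \<in> E \<Longrightarrow> t' (g e) = f (t e)" "\<And>e. e \<in> E \<Longrightarrow> c' (g e) = c e" "finite E"
  shows "fibre c' E' t' (f v) = fibre c E t v"
proof -
  have inj: "inj_on g E"
    using assms(1) by (simp add: bij_betw_def)
  have "{e' \<in> E'. t' e' = f v} = g ` {e \<in> E. t e = v}"
  proof (intro equalityI subsetI)
    fix e' assume e': "e' \<in> {e' \<in> E'. t' e' = f v}"
    then obtain e where e: "e \<in> E" "e' = g e"
      using assms(1) by (auto simp: bij_betw_def)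
    with e' assms(5) have "f (t e) = f v"
      by simp
    with assms(2,3,4) e(1) have "t e = v"
      by (auto simp: bij_betw_def dest: inj_onD)
    with e show "e' \<in> g ` {e \<in> E. t e = v}"
      by blast
  next
    fix e' assume "e' \<in> g ` {e \<in> E. t e = v}"
    then show "e' \<in> {e' \<in> E'. t' e' = f v}"
      using assms(1,5) by (auto simp: bij_betw_def)
  qed
  then have "fibre c' E' t' (f v) = image_mset c' (image_mset g (mset_set {e \<in> E. t e = v}))"
    unfolding fibre_def by (simp add: image_mset_mset_set inj_on_subset[OF inj])
  also have "\<dots> = image_mset c (mset_set {e \<in> E. t e = v})"
    unfolding multiset.map_comp by (rule image_mset_cong) (use assms(6,7) in auto)
  finally show ?thesis
    by (simp add: fibre_def)
qed

lemma vertex_type_iso: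
  assumes "color_iso_pair \<Gamma> \<Delta> f g" "wf_graph \<Gamma>" "v \<in> verts \<Gamma>"
  shows "vertex_type \<Delta> (f v) = vertex_type \<Gamma> v"
proof -
  note D = color_iso_pairD[OF assms(1)]
  have "fibre (ecolor \<Delta>) (arcs \<Delta>) (tail \<Delta>) (f v) = fibre (ecolor \<Gamma>) (arcs \<Gamma>) (tail \<Gamma>) v"
    by (rule bij_betw_fibre[OF D(2,1) assms(3)]) (use D assms(2) in \<open>auto simp: wf_graph_def\<close>)
  moreover have "fibre (ecolor \<Delta>) (arcs \<Delta>) (head \<Delta>) (f v) = fibre (ecolor \<Gamma>) (arcs \<Gamma>) (head \<Gamma>) v"
    by (rule bij_betw_fibre[OF D(2,1) assms(3)]) (use D assms(2) in \<open>auto simp: wf_graph_def\<close>)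
  ultimately show ?thesis
    using D(3)[OF assms(3)] by (simp add: vertex_type_def out_partition_eq in_partition_eq)
qed

lemma graph_monomial_iso:
  assumes "color_iso_pair \<Gamma> \<Delta> f g" "wf_graph \<Gamma>"
  shows "graph_monomial \<Delta> = graph_monomial \<Gamma>"
proof -
  have f: "inj_on f (verts \<Gamma>)" "verts \<Delta> = f ` verts \<Gamma>"
    using color_iso_pairD(1)[OF assms(1)] by (auto simp: bij_betw_def)
  have "graph_monomial \<Delta> = image_mset (vertex_type \<Delta> \<circ> f) (mset_set (verts \<Gamma>))"
    unfolding graph_monomial_def f(2) image_mset_mset_set[OF f(1), symmetric]
    by (simp add: multiset.map_comp)
  also have "\<dots> = graph_monomial \<Gamma>"
    unfolding graph_monomial_def
    by (rule image_mset_cong) (use assms wf_graphD(1)[OF assms(2)] in \<open>auto simp: vertex_type_iso\<close>)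
  finally show ?thesis .
qed

lemma wf_graph_iso:
  assumes "color_iso_pair \<Gamma> \<Delta> f g" "wf_graph \<Gamma>"
  shows "wf_graph \<Delta>"
proof -
  note D = color_iso_pairD[OF assms(1)]
  have "tail \<Delta> e' \<in> verts \<Delta>" "head \<Delta> e' \<in> verts \<Delta>" if "e' \<in> arcs \<Delta>" for e'
  proof -
    from that D(2) obtain e where e: "e \<in> arcs \<Gamma>" "e' = g e"
      by (auto simp: bij_betw_def)
    then show "tail \<Delta> e' \<in> verts \<Delta>" "head \<Delta> e' \<in> verts \<Delta>"
      using D(5,6)[OF e(1)] bij_betwE[OF D(1)] wf_graphD(3,4)[OF assms(2) e(1)] by simp_all
  qed
  then show ?thesis
    using bij_betw_finite[OF D(1)] bij_betw_finite[OF D(2)] wf_graphD(1,2)[OF assms(2)]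
    by (auto simp: wf_graph_def)
qed

lemma admissible_iso:
  assumes "color_iso_pair \<Gamma> \<Delta> f g" "wf_graph \<Gamma>" "admissible \<Gamma>"
  shows "admissible \<Delta>"
  unfolding admissible_def
proof
  note D = color_iso_pairD[OF assms(1)]
  fix e' assume "e' \<in> arcs \<Delta>"
  with D(2) obtain e where e: "e \<in> arcs \<Gamma>" "e' = g e"
    by (auto simp: bij_betw_def)
  with assms(3) show "nat_of (vcolor \<Delta> (tail \<Delta> e')) dvd nat_of (ecolor \<Delta> e') \<and>
      nat_of (vcolor \<Delta> (head \<Delta> e')) dvd nat_of (ecolor \<Delta> e')"
    using D(3)[OF wf_graphD(3)[OF assms(2) e(1)]] D(3)[OF wf_graphD(4)[OF assms(2) e(1)]] D(4-6)[OF e(1)]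
    by (simp add: admissible_def)
qed

lemma connected_graph_iso:
  assumes "color_iso_pair \<Gamma> \<Delta> f g" "wf_graph \<Gamma>" "connected_graph \<Gamma>"
  shows "connected_graph \<Delta>"
  unfolding connected_graph_def
proof (intro conjI allI impI)
  note D = color_iso_pairD[OF assms(1)]
  have V: "verts \<Delta> = f ` verts \<Gamma>"
    using D(1) by (auto simp: bij_betw_def)
  then show "verts \<Delta> \<noteq> {}"
    using assms(3) by (simp add: connected_graph_def)
  fix S assume S: "S \<subseteq> verts \<Delta>" "S \<noteq> {} \<and> closed_set \<Delta> S"
  let ?T = "{v \<in> verts \<Gamma>. f v \<in> S}"
  have "closed_set \<Gamma> ?T"
    unfolding closed_set_def
  proof
    fix e assume e: "e \<in> arcs \<Gamma>"
    then have "g e \<in> arcs \<Delta>"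
      using bij_betwE[OF D(2)] by blast
    with S(2) have "tail \<Delta> (g e) \<in> S \<longleftrightarrow> head \<Delta> (g e) \<in> S"
      by (simp add: closed_set_def)
    with D(5,6)[OF e] wf_graphD(3,4)[OF assms(2) e]
    show "tail \<Gamma> e \<in> ?T \<longleftrightarrow> head \<Gamma> e \<in> ?T"
      by simp
  qed
  moreover have "?T \<noteq> {}"
    using S V by auto
  ultimately have "?T = verts \<Gamma>"
    by (intro connected_graphD[OF assms(3)]) simp_all
  then have "f ` verts \<Gamma> \<subseteq> S"
    by (auto simp: set_eq_iff)
  with S(1) V show "S = verts \<Delta>"
    by simp
qed

section \<open>Transport of a graph to new label sets\<close>

lemma labelled_graphs_wf:
  assumes "\<Gamma> \<in> labelled_graphs V E M" "finite V" "finite E"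
  shows "wf_graph \<Gamma>"
  using assms by (auto simp: labelled_graphs_def wf_graph_def PiE_def)

lemma labelled_graphs_eqI:
  assumes "\<Gamma> \<in> labelled_graphs V E M" "\<Delta> \<in> labelled_graphs V E N"
    "\<And>v. v \<in> V \<Longrightarrow> vcolor \<Gamma> v = vcolor \<Delta> v"
    "\<And>e. e \<in> E \<Longrightarrow> ecolor \<Gamma> e = ecolor \<Delta> e \<and> tail \<Gamma> e = tail \<Delta> e \<and> head \<Gamma> e = head \<Delta> e"
  shows "\<Gamma> = \<Delta>"
proof -
  have "vcolor \<Gamma> = vcolor \<Delta>" "ecolor \<Gamma> = ecolor \<Delta>" "tail \<Gamma> = tail \<Delta>" "head \<Gamma> = head \<Delta>"
    using assms by (auto simp: labelled_graphs_def PiE_def intro!: extensionalityI[where A = V]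
        extensionalityI[where A = E])
  moreover have "verts \<Gamma> = verts \<Delta>" "arcs \<Gamma> = arcs \<Delta>"
    using assms by (auto simp: labelled_graphs_def)
  ultimately show ?thesis
    by simp
qed

text \<open>The maps are onto, so all structure of the target is dictated by that of \<Gamma>;
  extensionality of the record fields turns this into equality of records. It makes the parts in the
  orbit count disjoint.\<close>

lemma color_iso_pair_target_unique:
  assumes "color_iso_pair \<Gamma> \<Delta> f g" "color_iso_pair \<Gamma> \<Delta>' f g"
    "\<Delta> \<in> labelled_graphs V E M" "\<Delta>' \<in> labelled_graphs V E N"
  shows "\<Delta> = \<Delta>'"
proof (rule labelled_graphs_eqI[OF assms(3,4)])
  note D = color_iso_pairD[OF assms(1)] and D' = color_iso_pairD[OF assms(2)]
  have V: "V = f ` verts \<Gamma>" and E: "E = g ` arcs \<Gamma>"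
    using D(1,2) assms(3) by (auto simp: labelled_graphs_def bij_betw_def)
  show "vcolor \<Delta> v = vcolor \<Delta>' v" if "v \<in> V" for v
    using that D(3) D'(3) by (auto simp: V)
  show "ecolor \<Delta> e = ecolor \<Delta>' e \<and> tail \<Delta> e = tail \<Delta>' e \<and> head \<Delta> e = head \<Delta>' e" if "e \<in> E" for e
    using that D(4-6) D'(4-6) by (auto simp: E)
qed

definition relabel ::
    "('v \<Rightarrow> 'w) \<Rightarrow> ('e \<Rightarrow> 'f) \<Rightarrow> ('v, 'e) colored_digraph \<Rightarrow> ('w, 'f) colored_digraph" where
  "relabel f g \<Gamma> = \<lparr>verts = f ` verts \<Gamma>, arcs = g ` arcs \<Gamma>,
     tail = \<lambda>e\<in>g ` arcs \<Gamma>. f (tail \<Gamma> (inv_into (arcs \<Gamma>) g e)),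
     head = \<lambda>e\<in>g ` arcs \<Gamma>. f (head \<Gamma> (inv_into (arcs \<Gamma>) g e)),
     vcolor = \<lambda>v\<in>f ` verts \<Gamma>. vcolor \<Gamma> (inv_into (verts \<Gamma>) f v),
     ecolor = \<lambda>e\<in>g ` arcs \<Gamma>. ecolor \<Gamma> (inv_into (arcs \<Gamma>) g e)\<rparr>"

lemma color_iso_pair_relabel:
  assumes "inj_on f (verts \<Gamma>)" "inj_on g (arcs \<Gamma>)"
  shows "color_iso_pair \<Gamma> (relabel f g \<Gamma>) f g"
  using assms by (simp add: color_iso_pair_def relabel_def inj_on_imp_bij_betw)

lemma relabel_in_labelled_graphs:
  assumes "bij_betw f (verts \<Gamma>) V" "bij_betw g (arcs \<Gamma>) E" "wf_graph \<Gamma>" "admissible \<Gamma>"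
  shows "relabel f g \<Gamma> \<in> labelled_graphs V E (graph_monomial \<Gamma>)"
proof -
  have inj: "inj_on f (verts \<Gamma>)" "inj_on g (arcs \<Gamma>)" and VE: "f ` verts \<Gamma> = V" "g ` arcs \<Gamma> = E"
    using assms(1,2) by (auto simp: bij_betw_def)
  note iso = color_iso_pair_relabel[OF inj]
  have "wf_graph (relabel f g \<Gamma>)" "admissible (relabel f g \<Gamma>)"
    "graph_monomial (relabel f g \<Gamma>) = graph_monomial \<Gamma>"
    using wf_graph_iso[OF iso] admissible_iso[OF iso] graph_monomial_iso[OF iso] assms(3,4)
    by simp_all
  moreover have "verts (relabel f g \<Gamma>) = V" "arcs (relabel f g \<Gamma>) = E"
    "tail (relabel f g \<Gamma>) \<in> extensional E" "head (relabel f g \<Gamma>) \<in> extensional E"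
    "vcolor (relabel f g \<Gamma>) \<in> extensional V" "ecolor (relabel f g \<Gamma>) \<in> extensional E"
    by (simp_all add: relabel_def VE)
  ultimately show ?thesis
    by (simp add: labelled_graphs_def wf_graph_def PiE_def)
qed

section \<open>Orbits and automorphisms\<close>

lemma Aut_graph_subset:
  "Aut_graph \<Gamma> \<subseteq> {\<pi>. \<pi> permutes verts \<Gamma>} \<times> {\<sigma>. \<sigma> permutes arcs \<Gamma>}"
  by (auto simp: Aut_graph_def)

lemma finite_Aut_graph: "wf_graph \<Gamma> \<Longrightarrow> finite (Aut_graph \<Gamma>)"
  by (rule finite_subset[OF Aut_graph_subset]) (simp add: wf_graphD finite_permutations)

lemma Aut_graph_card_pos:
  assumes "wf_graph \<Gamma>"
  shows "card (Aut_graph \<Gamma>) > 0"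
proof -
  have "(id, id) \<in> Aut_graph \<Gamma>"
    by (simp add: Aut_graph_def permutes_id color_iso_pair_id)
  then show ?thesis
    using finite_Aut_graph[OF assms] by (auto simp: card_gt_0_iff)
qed

text \<open>Two isomorphisms from \<Gamma> onto the same \<Delta> differ by a unique automorphism of
  \<Gamma>. The fixed labellings \<open>p\<close> and \<open>q\<close> express an isomorphism as a
  pair of permutations of \<Gamma>'s own vertices and edges, which is the form that
  \<open>Aut_graph\<close> has.\<close>

lemma card_isomorphisms:
  assumes wf: "wf_graph \<Gamma>"
    and p: "inj_on p (verts \<Gamma>)" and q: "inj_on q (arcs \<Gamma>)"
    and perm: "\<pi>\<^sub>0 permutes verts \<Gamma>" "\<sigma>\<^sub>0 permutes arcs \<Gamma>"
    and iso: "color_iso_pair \<Gamma> \<Delta> (p \<circ> \<pi>\<^sub>0) (q \<circ> \<sigma>\<^sub>0)"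
  shows "card {(\<pi>, \<sigma>). \<pi> permutes verts \<Gamma> \<and> \<sigma> permutes arcs \<Gamma> \<and>
    color_iso_pair \<Gamma> \<Delta> (p \<circ> \<pi>) (q \<circ> \<sigma>)} = card (Aut_graph \<Gamma>)"
    (is "card ?S = _")
proof -
  have "bij_betw (\<lambda>(\<alpha>, \<beta>). (\<pi>\<^sub>0 \<circ> \<alpha>, \<sigma>\<^sub>0 \<circ> \<beta>)) (Aut_graph \<Gamma>) ?S"
  proof (rule bij_betw_byWitness[where f' = "\<lambda>(\<pi>, \<sigma>). (inv \<pi>\<^sub>0 \<circ> \<pi>, inv \<sigma>\<^sub>0 \<circ> \<sigma>)"])
    show "\<forall>x\<in>Aut_graph \<Gamma>. (\<lambda>(\<pi>, \<sigma>). (inv \<pi>\<^sub>0 \<circ> \<pi>, inv \<sigma>\<^sub>0 \<circ> \<sigma>)) ((\<lambda>(\<alpha>, \<beta>). (\<pi>\<^sub>0 \<circ> \<alpha>, \<sigma>\<^sub>0 \<circ> \<beta>)) x) = x"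
      using permutes_inverses(2)[OF perm(1)] permutes_inverses(2)[OF perm(2)]
      by (auto simp: fun_eq_iff)
    show "\<forall>x\<in>?S. (\<lambda>(\<alpha>, \<beta>). (\<pi>\<^sub>0 \<circ> \<alpha>, \<sigma>\<^sub>0 \<circ> \<beta>)) ((\<lambda>(\<pi>, \<sigma>). (inv \<pi>\<^sub>0 \<circ> \<pi>, inv \<sigma>\<^sub>0 \<circ> \<sigma>)) x) = x"
      using permutes_inverses(1)[OF perm(1)] permutes_inverses(1)[OF perm(2)]
      by (auto simp: fun_eq_iff)
    show "(\<lambda>(\<alpha>, \<beta>). (\<pi>\<^sub>0 \<circ> \<alpha>, \<sigma>\<^sub>0 \<circ> \<beta>)) ` Aut_graph \<Gamma> \<subseteq> ?S"
    proof
      fix x assume "x \<in> (\<lambda>(\<alpha>, \<beta>). (\<pi>\<^sub>0 \<circ> \<alpha>, \<sigma>\<^sub>0 \<circ> \<beta>)) ` Aut_graph \<Gamma>"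
      then obtain \<alpha> \<beta> where x: "x = (\<pi>\<^sub>0 \<circ> \<alpha>, \<sigma>\<^sub>0 \<circ> \<beta>)" and ab: "\<alpha> permutes verts \<Gamma>"
        "\<beta> permutes arcs \<Gamma>" "color_iso_pair \<Gamma> \<Gamma> \<alpha> \<beta>"
        by (auto simp: Aut_graph_def)
      have "color_iso_pair \<Gamma> \<Delta> (p \<circ> (\<pi>\<^sub>0 \<circ> \<alpha>)) (q \<circ> (\<sigma>\<^sub>0 \<circ> \<beta>))"
        using color_iso_pair_comp[OF ab(3) iso wf] by (simp add: comp_assoc)
      then show "x \<in> ?S"
        by (simp add: x permutes_compose ab(1,2) perm)
    qed
    show "(\<lambda>(\<pi>, \<sigma>). (inv \<pi>\<^sub>0 \<circ> \<pi>, inv \<sigma>\<^sub>0 \<circ> \<sigma>)) ` ?S \<subseteq> Aut_graph \<Gamma>"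
    proof
      fix x assume "x \<in> (\<lambda>(\<pi>, \<sigma>). (inv \<pi>\<^sub>0 \<circ> \<pi>, inv \<sigma>\<^sub>0 \<circ> \<sigma>)) ` ?S"
      then obtain \<pi> \<sigma> where x: "x = (inv \<pi>\<^sub>0 \<circ> \<pi>, inv \<sigma>\<^sub>0 \<circ> \<sigma>)" and ps: "\<pi> permutes verts \<Gamma>"
        "\<sigma> permutes arcs \<Gamma>" "color_iso_pair \<Gamma> \<Delta> (p \<circ> \<pi>) (q \<circ> \<sigma>)"
        by auto
      note D = color_iso_pairD[OF ps(3)] and D0 = color_iso_pairD[OF iso]
      have a: "inv \<pi>\<^sub>0 \<circ> \<pi> permutes verts \<Gamma>" and b: "inv \<sigma>\<^sub>0 \<circ> \<sigma> permutes arcs \<Gamma>"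
        using permutes_compose[OF ps(1) permutes_inv[OF perm(1)]]
          permutes_compose[OF ps(2) permutes_inv[OF perm(2)]] by simp_all
      have cancel: "\<pi>\<^sub>0 ((inv \<pi>\<^sub>0 \<circ> \<pi>) v) = \<pi> v" "\<sigma>\<^sub>0 ((inv \<sigma>\<^sub>0 \<circ> \<sigma>) e) = \<sigma> e" for v e
        using permutes_inverses(1)[OF perm(1)] permutes_inverses(1)[OF perm(2)] by simp_all
      have end_eq: "u = (inv \<pi>\<^sub>0 \<circ> \<pi>) v" if "u \<in> verts \<Gamma>" "v \<in> verts \<Gamma>" "p (\<pi>\<^sub>0 u) = p (\<pi> v)" for u v
      proof -
        have "\<pi>\<^sub>0 u = \<pi> v"
          using inj_onD[OF p that(3)] that(1,2) perm(1) ps(1) by (simp add: permutes_in_image)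
        then have "inv \<pi>\<^sub>0 (\<pi>\<^sub>0 u) = inv \<pi>\<^sub>0 (\<pi> v)"
          by simp
        then show ?thesis
          using permutes_inverses(2)[OF perm(1)] by simp
      qed
      have "vcolor \<Gamma> ((inv \<pi>\<^sub>0 \<circ> \<pi>) v) = vcolor \<Gamma> v" if v: "v \<in> verts \<Gamma>" for v
      proof -
        have "(inv \<pi>\<^sub>0 \<circ> \<pi>) v \<in> verts \<Gamma>"
          using v by (simp only: permutes_in_image[OF a])
        from D0(3)[OF this] D(3)[OF v] show ?thesis
          by (simp add: permutes_inverses(1)[OF perm(1)])
      qed
      moreover have "ecolor \<Gamma> ((inv \<sigma>\<^sub>0 \<circ> \<sigma>) e) = ecolor \<Gamma> e"
        "tail \<Gamma> ((inv \<sigma>\<^sub>0 \<circ> \<sigma>) e) = (inv \<pi>\<^sub>0 \<circ> \<pi>) (tail \<Gamma> e)"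
        "head \<Gamma> ((inv \<sigma>\<^sub>0 \<circ> \<sigma>) e) = (inv \<pi>\<^sub>0 \<circ> \<pi>) (head \<Gamma> e)" if e: "e \<in> arcs \<Gamma>" for e
      proof -
        have e': "(inv \<sigma>\<^sub>0 \<circ> \<sigma>) e \<in> arcs \<Gamma>"
          using e by (simp only: permutes_in_image[OF b])
        from D0(4-6)[OF e'] D(4-6)[OF e]
        have "ecolor \<Gamma> ((inv \<sigma>\<^sub>0 \<circ> \<sigma>) e) = ecolor \<Gamma> e"
          "p (\<pi>\<^sub>0 (tail \<Gamma> ((inv \<sigma>\<^sub>0 \<circ> \<sigma>) e))) = p (\<pi> (tail \<Gamma> e))"
          "p (\<pi>\<^sub>0 (head \<Gamma> ((inv \<sigma>\<^sub>0 \<circ> \<sigma>) e))) = p (\<pi> (head \<Gamma> e))"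
          by (simp_all add: permutes_inverses(1)[OF perm(2)])
        then show "ecolor \<Gamma> ((inv \<sigma>\<^sub>0 \<circ> \<sigma>) e) = ecolor \<Gamma> e"
          "tail \<Gamma> ((inv \<sigma>\<^sub>0 \<circ> \<sigma>) e) = (inv \<pi>\<^sub>0 \<circ> \<pi>) (tail \<Gamma> e)"
          "head \<Gamma> ((inv \<sigma>\<^sub>0 \<circ> \<sigma>) e) = (inv \<pi>\<^sub>0 \<circ> \<pi>) (head \<Gamma> e)"
          using end_eq wf_graphD(3,4)[OF wf e'] wf_graphD(3,4)[OF wf e] by blast+
      qed
      ultimately have "color_iso_pair \<Gamma> \<Gamma> (inv \<pi>\<^sub>0 \<circ> \<pi>) (inv \<sigma>\<^sub>0 \<circ> \<sigma>)"
        unfolding color_iso_pair_def using permutes_imp_bij[OF a] permutes_imp_bij[OF b] by blast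
      with a b show "x \<in> Aut_graph \<Gamma>"
        by (simp add: x Aut_graph_def)
    qed
  qed
  then show ?thesis
    by (rule bij_betw_same_card[symmetric])
qed

text \<open>
  The pairs of permutations of \<open>\<Gamma>\<close> are partitioned according to the labelled graph to which they carry
  \<open>\<Gamma>\<close>, and each part is a torsor under \<open>Aut(\<Gamma>)\<close>.
\<close>

lemma card_orbit:
  fixes V :: "'w set" and E :: "'f set"
  assumes wf: "wf_graph \<Gamma>" and adm: "admissible \<Gamma>"
    and fin: "finite V" "finite E" and card: "card V = card (verts \<Gamma>)" "card E = card (arcs \<Gamma>)"
  shows "card {\<Delta> \<in> labelled_graphs V E (graph_monomial \<Gamma>). \<exists>f g. color_iso_pair \<Gamma> \<Delta> f g} *
    card (Aut_graph \<Gamma>) = fact (card V) * fact (card E)"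
    (is "card ?O * _ = _")
proof -
  obtain p where p: "bij_betw p (verts \<Gamma>) V"
    using finite_same_card_bij[OF wf_graphD(1)[OF wf] fin(1)] card by auto
  obtain q where q: "bij_betw q (arcs \<Gamma>) E"
    using finite_same_card_bij[OF wf_graphD(2)[OF wf] fin(2)] card by auto
  have inj: "inj_on p (verts \<Gamma>)" "inj_on q (arcs \<Gamma>)"
    using p q by (auto simp: bij_betw_def)
  let ?P = "{\<pi>. \<pi> permutes verts \<Gamma>} \<times> {\<sigma>. \<sigma> permutes arcs \<Gamma>}"
  let ?S = "\<lambda>\<Delta> :: ('w, 'f) colored_digraph. {(\<pi>, \<sigma>). \<pi> permutes verts \<Gamma> \<and> \<sigma> permutes arcs \<Gamma> \<and>
    color_iso_pair \<Gamma> \<Delta> (p \<circ> \<pi>) (q \<circ> \<sigma>)}"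
  have finP: "finite ?P"
    by (simp add: finite_permutations wf_graphD[OF wf])
  have SP: "?S \<Delta> \<subseteq> ?P" for \<Delta>
    by auto
  have finO: "finite ?O"
    by (rule finite_subset[OF _ finite_labelled_graphs[OF fin]]) auto
  have cover: "?P = (\<Union>\<Delta>\<in>?O. ?S \<Delta>)"
  proof (intro equalityI subsetI)
    fix x assume "x \<in> ?P"
    then obtain \<pi> \<sigma> where x: "x = (\<pi>, \<sigma>)" "\<pi> permutes verts \<Gamma>" "\<sigma> permutes arcs \<Gamma>"
      by auto
    have b: "bij_betw (p \<circ> \<pi>) (verts \<Gamma>) V" "bij_betw (q \<circ> \<sigma>) (arcs \<Gamma>) E"
      using bij_betw_trans[OF permutes_imp_bij[OF x(2)] p] bij_betw_trans[OF permutes_imp_bij[OF x(3)] q] .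
    let ?\<Delta> = "relabel (p \<circ> \<pi>) (q \<circ> \<sigma>) \<Gamma>"
    have iso: "color_iso_pair \<Gamma> ?\<Delta> (p \<circ> \<pi>) (q \<circ> \<sigma>)"
      by (rule color_iso_pair_relabel) (use b in \<open>auto simp: bij_betw_def\<close>)
    then have "?\<Delta> \<in> ?O"
      using relabel_in_labelled_graphs[OF b wf adm] by blast
    with iso x show "x \<in> (\<Union>\<Delta>\<in>?O. ?S \<Delta>)"
      by blast
  qed (use SP in blast)
  have disj: "?S \<Delta> \<inter> ?S \<Delta>' = {}" if "\<Delta> \<in> ?O" "\<Delta>' \<in> ?O" "\<Delta> \<noteq> \<Delta>'" for \<Delta> \<Delta>'
    using that color_iso_pair_target_unique[of \<Gamma> \<Delta> _ _ \<Delta>' V E "graph_monomial \<Gamma>" "graph_monomial \<Gamma>"]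
    by blast
  have cardS: "card (?S \<Delta>) = card (Aut_graph \<Gamma>)" if "\<Delta> \<in> ?O" for \<Delta>
  proof -
    from that obtain f g where fg: "color_iso_pair \<Gamma> \<Delta> f g" and \<Delta>: "verts \<Delta> = V" "arcs \<Delta> = E"
      by (auto simp: labelled_graphs_def)
    have bf: "bij_betw f (verts \<Gamma>) V" and bg: "bij_betw g (arcs \<Gamma>) E"
      using color_iso_pairD(1,2)[OF fg] \<Delta> by auto
    \<comment> \<open>The given isomorphism followed by the inverse of the fixed labelling
      \<open>p\<close>, extended by the identity as \<open>permutes\<close> demands.\<close>
    let ?\<pi> = "\<lambda>v. if v \<in> verts \<Gamma> then inv_into (verts \<Gamma>) p (f v) else v"
    let ?\<sigma> = "\<lambda>e. if e \<in> arcs \<Gamma> then inv_into (arcs \<Gamma>) q (g e) else e"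
    have "bij_betw (inv_into (verts \<Gamma>) p \<circ> f) (verts \<Gamma>) (verts \<Gamma>)"
      by (rule bij_betw_trans[OF bf bij_betw_inv_into[OF p]])
    then have \<pi>: "?\<pi> permutes verts \<Gamma>"
      by (intro bij_imp_permutes) (simp_all cong: bij_betw_cong add: comp_def)
    have "bij_betw (inv_into (arcs \<Gamma>) q \<circ> g) (arcs \<Gamma>) (arcs \<Gamma>)"
      by (rule bij_betw_trans[OF bg bij_betw_inv_into[OF q]])
    then have \<sigma>: "?\<sigma> permutes arcs \<Gamma>"
      by (intro bij_imp_permutes) (simp_all cong: bij_betw_cong add: comp_def)
    have eq: "(p \<circ> ?\<pi>) v = f v" if "v \<in> verts \<Gamma>" for v
      using that p bij_betwE[OF bf] by (auto simp: bij_betw_def f_inv_into_f)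
    have eq': "(q \<circ> ?\<sigma>) e = g e" if "e \<in> arcs \<Gamma>" for e
      using that q bij_betwE[OF bg] by (auto simp: bij_betw_def f_inv_into_f)
    have "bij_betw (p \<circ> ?\<pi>) (verts \<Gamma>) V" "bij_betw (q \<circ> ?\<sigma>) (arcs \<Gamma>) E"
      using bij_betw_trans[OF permutes_imp_bij[OF \<pi>] p] bij_betw_trans[OF permutes_imp_bij[OF \<sigma>] q] .
    then have "color_iso_pair \<Gamma> \<Delta> (p \<circ> ?\<pi>) (q \<circ> ?\<sigma>)"
      unfolding color_iso_pair_def \<Delta>
      using eq eq' color_iso_pairD(3-6)[OF fg] wf_graphD(3,4)[OF wf] by simp
    then show ?thesis
      by (rule card_isomorphisms[OF wf inj \<pi> \<sigma>])
  qed
  have "card ?P = card (\<Union>\<Delta>\<in>?O. ?S \<Delta>)"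
    by (simp only: cover)
  also have "\<dots> = (\<Sum>\<Delta>\<in>?O. card (?S \<Delta>))"
    by (rule card_UN_disjoint) (use finO finite_subset[OF SP finP] disj in blast)+
  also have "\<dots> = card ?O * card (Aut_graph \<Gamma>)"
    using cardS by simp
  finally show ?thesis
    using card by (simp add: card_cartesian_product card_permutations wf_graphD[OF wf])
qed

section \<open>Splitting off a connected component\<close>

definition connected_labelled_graphs ::
    "'v set \<Rightarrow> 'e set \<Rightarrow> (pos \<times> A_gen) multiset \<Rightarrow> ('v, 'e) colored_digraph set" where
  "connected_labelled_graphs V E M = {\<Gamma> \<in> labelled_graphs V E M. connected_graph \<Gamma>}"

text \<open>For a closed \<open>S\<close> testing the tail decides about the head too
  (\<open>inner_arcs_iff\<close>). With this one-sided form the arcs of a complement are literally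
  the complementary arcs.\<close>

definition inner_arcs :: "('v, 'e) colored_digraph \<Rightarrow> 'v set \<Rightarrow> 'e set" where
  "inner_arcs \<Gamma> S = {e \<in> arcs \<Gamma>. tail \<Gamma> e \<in> S}"

definition induced :: "('v, 'e) colored_digraph \<Rightarrow> 'v set \<Rightarrow> ('v, 'e) colored_digraph" where
  "induced \<Gamma> S = \<lparr>verts = S, arcs = inner_arcs \<Gamma> S,
     tail = restrict (tail \<Gamma>) (inner_arcs \<Gamma> S), head = restrict (head \<Gamma>) (inner_arcs \<Gamma> S),
     vcolor = restrict (vcolor \<Gamma>) S, ecolor = restrict (ecolor \<Gamma>) (inner_arcs \<Gamma> S)\<rparr>"

text \<open>Used for disjoint label sets, where it is the disjoint union. Outside both sets the
  fields take the values of \<Delta>, which are \<open>undefined\<close> for a labelled graph, so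
  the result is again extensional.\<close>

definition glue ::
    "('v, 'e) colored_digraph \<Rightarrow> ('v, 'e) colored_digraph \<Rightarrow> ('v, 'e) colored_digraph" where
  "glue \<Gamma> \<Delta> = \<lparr>verts = verts \<Gamma> \<union> verts \<Delta>, arcs = arcs \<Gamma> \<union> arcs \<Delta>,
     tail = (\<lambda>e. if e \<in> arcs \<Gamma> then tail \<Gamma> e else tail \<Delta> e),
     head = (\<lambda>e. if e \<in> arcs \<Gamma> then head \<Gamma> e else head \<Delta> e),
     vcolor = (\<lambda>v. if v \<in> verts \<Gamma> then vcolor \<Gamma> v else vcolor \<Delta> v),
     ecolor = (\<lambda>e. if e \<in> arcs \<Gamma> then ecolor \<Gamma> e else ecolor \<Delta> e)\<rparr>"

definition component :: "('v, 'e) colored_digraph \<Rightarrow> 'v \<Rightarrow> 'v set" where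
  "component \<Gamma> v = \<Inter>{S. S \<subseteq> verts \<Gamma> \<and> v \<in> S \<and> closed_set \<Gamma> S}"

lemma closed_set_verts: "wf_graph \<Gamma> \<Longrightarrow> closed_set \<Gamma> (verts \<Gamma>)"
  by (simp add: closed_set_def wf_graphD)

lemma closed_set_Diff: "closed_set \<Gamma> S \<Longrightarrow> closed_set \<Gamma> T \<Longrightarrow> closed_set \<Gamma> (S - T)"
  by (simp add: closed_set_def)

lemma closed_set_Inter: "(\<And>S. S \<in> C \<Longrightarrow> closed_set \<Gamma> S) \<Longrightarrow> closed_set \<Gamma> (\<Inter>C)"
  by (simp add: closed_set_def)

lemma closed_set_component: "closed_set \<Gamma> (component \<Gamma> v)"
  unfolding component_def by (rule closed_set_Inter) simp

lemma component_subset: "S \<subseteq> verts \<Gamma> \<Longrightarrow> v \<in> S \<Longrightarrow> closed_set \<Gamma> S \<Longrightarrow> component \<Gamma> v \<subseteq> S"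
  unfolding component_def by (rule Inter_lower) simp

lemma component_subset_verts:
  "wf_graph \<Gamma> \<Longrightarrow> v \<in> verts \<Gamma> \<Longrightarrow> component \<Gamma> v \<subseteq> verts \<Gamma>"
  by (simp add: component_subset closed_set_verts)

lemma in_component: "v \<in> component \<Gamma> v"
  by (simp add: component_def)

text \<open>If \<open>v\<close> lies in \<open>S\<close>, minimality of the component gives
  equality. Otherwise the component without \<open>S\<close> would be a smaller closed set
  containing \<open>v\<close>.\<close>

lemma closed_subset_component:
  assumes "wf_graph \<Gamma>" "v \<in> verts \<Gamma>" "S \<subseteq> component \<Gamma> v" "S \<noteq> {}" "closed_set \<Gamma> S"
  shows "S = component \<Gamma> v"
proof (cases "v \<in> S")
  case True
  then have "component \<Gamma> v \<subseteq> S"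
    using assms component_subset_verts[OF assms(1,2)] by (intro component_subset) auto
  with assms(3) show ?thesis
    by simp
next
  case False
  have "component \<Gamma> v \<subseteq> component \<Gamma> v - S"
    using False in_component[of v \<Gamma>] component_subset_verts[OF assms(1,2)]
      closed_set_Diff[OF closed_set_component assms(5)] by (intro component_subset) auto
  with assms(3,4) show ?thesis
    by auto
qed

lemma vertex_type_cong:
  assumes "vcolor \<Delta> v = vcolor \<Gamma> v"
    "{e \<in> arcs \<Delta>. tail \<Delta> e = v} = {e \<in> arcs \<Gamma>. tail \<Gamma> e = v}"
    "{e \<in> arcs \<Delta>. head \<Delta> e = v} = {e \<in> arcs \<Gamma>. head \<Gamma> e = v}"
    "\<And>e. e \<in> arcs \<Gamma> \<Longrightarrow> tail \<Gamma> e = v \<or> head \<Gamma> e = v \<Longrightarrow> ecolor \<Delta> e = ecolor \<Gamma> e"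
    "finite (arcs \<Gamma>)"
  shows "vertex_type \<Delta> v = vertex_type \<Gamma> v"
proof -
  have "fibre (ecolor \<Delta>) (arcs \<Delta>) (tail \<Delta>) v = fibre (ecolor \<Gamma>) (arcs \<Gamma>) (tail \<Gamma>) v"
    unfolding fibre_def assms(2) by (rule image_mset_cong) (use assms(4,5) in auto)
  moreover have "fibre (ecolor \<Delta>) (arcs \<Delta>) (head \<Delta>) v = fibre (ecolor \<Gamma>) (arcs \<Gamma>) (head \<Gamma>) v"
    unfolding fibre_def assms(3) by (rule image_mset_cong) (use assms(4,5) in auto)
  ultimately show ?thesis
    by (simp add: vertex_type_def out_partition_eq in_partition_eq assms(1))
qed

lemma induced_simps [simp]:
  "verts (induced \<Gamma> S) = S" "arcs (induced \<Gamma> S) = inner_arcs \<Gamma> S"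
  "e \<in> inner_arcs \<Gamma> S \<Longrightarrow> tail (induced \<Gamma> S) e = tail \<Gamma> e"
  "e \<in> inner_arcs \<Gamma> S \<Longrightarrow> head (induced \<Gamma> S) e = head \<Gamma> e"
  "e \<in> inner_arcs \<Gamma> S \<Longrightarrow> ecolor (induced \<Gamma> S) e = ecolor \<Gamma> e"
  "v \<in> S \<Longrightarrow> vcolor (induced \<Gamma> S) v = vcolor \<Gamma> v"
  by (simp_all add: induced_def)

lemma inner_arcs_iff:
  "closed_set \<Gamma> S \<Longrightarrow> e \<in> inner_arcs \<Gamma> S \<longleftrightarrow> e \<in> arcs \<Gamma> \<and> tail \<Gamma> e \<in> S \<and> head \<Gamma> e \<in> S"
  by (auto simp: inner_arcs_def closed_set_def)

text \<open>A closed set keeps every edge at each of its vertices, so restricting to it changes no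
  vertex type. This is what makes monomials additive under cutting.\<close>

lemma vertex_type_induced:
  assumes "closed_set \<Gamma> S" "finite (arcs \<Gamma>)" "v \<in> S"
  shows "vertex_type (induced \<Gamma> S) v = vertex_type \<Gamma> v"
proof -
  have "{e \<in> inner_arcs \<Gamma> S. tail (induced \<Gamma> S) e = v} = {e \<in> inner_arcs \<Gamma> S. tail \<Gamma> e = v}"
    "{e \<in> inner_arcs \<Gamma> S. head (induced \<Gamma> S) e = v} = {e \<in> inner_arcs \<Gamma> S. head \<Gamma> e = v}"
    by auto
  moreover have "{e \<in> inner_arcs \<Gamma> S. tail \<Gamma> e = v} = {e \<in> arcs \<Gamma>. tail \<Gamma> e = v}"
    using assms by (auto simp: inner_arcs_def)
  moreover have "{e \<in> inner_arcs \<Gamma> S. head \<Gamma> e = v} = {e \<in> arcs \<Gamma>. head \<Gamma> e = v}"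
    using assms by (auto simp: inner_arcs_def closed_set_def)
  moreover have "e \<in> inner_arcs \<Gamma> S" if "e \<in> arcs \<Gamma>" "tail \<Gamma> e = v \<or> head \<Gamma> e = v" for e
    using that assms by (auto simp: inner_arcs_def closed_set_def)
  ultimately show ?thesis
    by (intro vertex_type_cong) (use assms in simp_all)
qed

lemma induced_in_labelled_graphs:
  assumes \<Gamma>: "\<Gamma> \<in> labelled_graphs V E M" and fin: "finite V" "finite E"
    and S: "S \<subseteq> V" "closed_set \<Gamma> S"
  shows "induced \<Gamma> S \<in> labelled_graphs S (inner_arcs \<Gamma> S) (image_mset (vertex_type \<Gamma>) (mset_set S))"
proof -
  have A: "arcs \<Gamma> = E" "admissible \<Gamma>"
    using \<Gamma> by (auto simp: labelled_graphs_def)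
  have "graph_monomial (induced \<Gamma> S) = image_mset (vertex_type \<Gamma>) (mset_set S)"
    unfolding graph_monomial_def induced_simps
    by (rule image_mset_cong)
      (use S fin finite_subset[OF S(1) fin(1)] A in \<open>auto simp: vertex_type_induced\<close>)
  moreover have "admissible (induced \<Gamma> S)"
    using A(2) by (auto simp: admissible_def inner_arcs_iff[OF S(2)])
  moreover have "restrict (tail \<Gamma>) (inner_arcs \<Gamma> S) \<in> inner_arcs \<Gamma> S \<rightarrow>\<^sub>E S"
    "restrict (head \<Gamma>) (inner_arcs \<Gamma> S) \<in> inner_arcs \<Gamma> S \<rightarrow>\<^sub>E S"
    by (auto simp: inner_arcs_iff[OF S(2)])
  ultimately show ?thesis
    by (simp add: labelled_graphs_def) (simp add: induced_def)
qed

lemma connected_induced_component: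
  assumes "wf_graph \<Gamma>" "v \<in> verts \<Gamma>"
  shows "connected_graph (induced \<Gamma> (component \<Gamma> v))"
  unfolding connected_graph_def induced_simps
proof (intro conjI allI impI)
  let ?C = "component \<Gamma> v"
  show "?C \<noteq> {}"
    using in_component[of v \<Gamma>] by auto
  fix S assume S: "S \<subseteq> ?C" "S \<noteq> {} \<and> closed_set (induced \<Gamma> ?C) S"
  have "closed_set \<Gamma> S"
    unfolding closed_set_def
  proof
    fix e assume e: "e \<in> arcs \<Gamma>"
    show "tail \<Gamma> e \<in> S \<longleftrightarrow> head \<Gamma> e \<in> S"
    proof (cases "e \<in> inner_arcs \<Gamma> ?C")
      case True
      with S(2) show ?thesis
        by (auto simp: closed_set_def)
    next
      case False
      with e have "tail \<Gamma> e \<notin> ?C" "head \<Gamma> e \<notin> ?C"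
        using closed_set_component[of \<Gamma> v] by (auto simp: inner_arcs_def closed_set_def)
      with S(1) show ?thesis
        by auto
    qed
  qed
  with S show "S = ?C"
    using closed_subset_component[OF assms] by simp
qed

section \<open>Disjoint unions of labelled graphs\<close>

lemma glue_simps [simp]:
  "verts (glue \<Gamma> \<Delta>) = verts \<Gamma> \<union> verts \<Delta>" "arcs (glue \<Gamma> \<Delta>) = arcs \<Gamma> \<union> arcs \<Delta>"
  "e \<in> arcs \<Gamma> \<Longrightarrow> tail (glue \<Gamma> \<Delta>) e = tail \<Gamma> e" "e \<in> arcs \<Gamma> \<Longrightarrow> head (glue \<Gamma> \<Delta>) e = head \<Gamma> e"
  "e \<in> arcs \<Gamma> \<Longrightarrow> ecolor (glue \<Gamma> \<Delta>) e = ecolor \<Gamma> e"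
  "v \<in> verts \<Gamma> \<Longrightarrow> vcolor (glue \<Gamma> \<Delta>) v = vcolor \<Gamma> v"
  "e \<notin> arcs \<Gamma> \<Longrightarrow> tail (glue \<Gamma> \<Delta>) e = tail \<Delta> e" "e \<notin> arcs \<Gamma> \<Longrightarrow> head (glue \<Gamma> \<Delta>) e = head \<Delta> e"
  "e \<notin> arcs \<Gamma> \<Longrightarrow> ecolor (glue \<Gamma> \<Delta>) e = ecolor \<Delta> e"
  "v \<notin> verts \<Gamma> \<Longrightarrow> vcolor (glue \<Gamma> \<Delta>) v = vcolor \<Delta> v"
  by (simp_all add: glue_def)

lemma vertex_type_glue:
  assumes "wf_graph \<Gamma>" "wf_graph \<Delta>" "verts \<Gamma> \<inter> verts \<Delta> = {}" "arcs \<Gamma> \<inter> arcs \<Delta> = {}"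
  shows "v \<in> verts \<Gamma> \<Longrightarrow> vertex_type (glue \<Gamma> \<Delta>) v = vertex_type \<Gamma> v"
    and "v \<in> verts \<Delta> \<Longrightarrow> vertex_type (glue \<Gamma> \<Delta>) v = vertex_type \<Delta> v"
proof -
  note W = wf_graphD[OF assms(1)] and W' = wf_graphD[OF assms(2)]
  assume v: "v \<in> verts \<Gamma>"
  then have "v \<notin> verts \<Delta>"
    using assms(3) by auto
  then have nd: "tail \<Delta> e \<noteq> v" "head \<Delta> e \<noteq> v" if "e \<in> arcs \<Delta>" for e
    using W'(3,4)[OF that] by auto
  show "vertex_type (glue \<Gamma> \<Delta>) v = vertex_type \<Gamma> v"
  proof (rule vertex_type_cong)
    show "{e \<in> arcs (glue \<Gamma> \<Delta>). tail (glue \<Gamma> \<Delta>) e = v} = {e \<in> arcs \<Gamma>. tail \<Gamma> e = v}"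
      "{e \<in> arcs (glue \<Gamma> \<Delta>). head (glue \<Gamma> \<Delta>) e = v} = {e \<in> arcs \<Gamma>. head \<Gamma> e = v}"
      using nd by (auto simp: glue_def split: if_splits)
  qed (use v W in auto)
next
  note W = wf_graphD[OF assms(1)] and W' = wf_graphD[OF assms(2)]
  assume v: "v \<in> verts \<Delta>"
  then have n: "v \<notin> verts \<Gamma>"
    using assms(3) by auto
  then have nd: "tail \<Gamma> e \<noteq> v" "head \<Gamma> e \<noteq> v" if "e \<in> arcs \<Gamma>" for e
    using W(3,4)[OF that] by auto
  have a: "e \<notin> arcs \<Gamma>" if "e \<in> arcs \<Delta>" for e
    using that assms(4) by auto
  show "vertex_type (glue \<Gamma> \<Delta>) v = vertex_type \<Delta> v"
  proof (rule vertex_type_cong)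
    show "{e \<in> arcs (glue \<Gamma> \<Delta>). tail (glue \<Gamma> \<Delta>) e = v} = {e \<in> arcs \<Delta>. tail \<Delta> e = v}"
      "{e \<in> arcs (glue \<Gamma> \<Delta>). head (glue \<Gamma> \<Delta>) e = v} = {e \<in> arcs \<Delta>. head \<Delta> e = v}"
      using nd a by (auto simp: glue_def split: if_splits)
  qed (use v n W' a in auto)
qed

context
  fixes \<Gamma> \<Delta> :: "('v, 'e) colored_digraph" and V V' E E' N K
  assumes \<Gamma>: "\<Gamma> \<in> labelled_graphs V E N" and \<Delta>: "\<Delta> \<in> labelled_graphs V' E' K"
    and fin: "finite V" "finite E" "finite V'" "finite E'"
    and disj: "V \<inter> V' = {}" "E \<inter> E' = {}"
begin

lemma labelled_graphs_pair_simps: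
  "verts \<Gamma> = V" "arcs \<Gamma> = E" "verts \<Delta> = V'" "arcs \<Delta> = E'" "wf_graph \<Gamma>" "wf_graph \<Delta>"
  "admissible \<Gamma>" "admissible \<Delta>" "graph_monomial \<Gamma> = N" "graph_monomial \<Delta> = K"
  using \<Gamma> \<Delta> labelled_graphs_wf[OF \<Gamma> fin(1,2)] labelled_graphs_wf[OF \<Delta> fin(3,4)]
  by (auto simp: labelled_graphs_def)

lemma arc_cases:
  "e \<in> E \<Longrightarrow> tail \<Gamma> e \<in> V" "e \<in> E \<Longrightarrow> head \<Gamma> e \<in> V" "e \<in> E' \<Longrightarrow> tail \<Delta> e \<in> V'"
  "e \<in> E' \<Longrightarrow> head \<Delta> e \<in> V'" "e \<in> E' \<Longrightarrow> e \<notin> E" "v \<in> V' \<Longrightarrow> v \<notin> V"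
  "e \<in> E \<Longrightarrow> tail \<Gamma> e \<notin> V'" "e \<in> E \<Longrightarrow> head \<Gamma> e \<notin> V'"
  "e \<in> E' \<Longrightarrow> tail \<Delta> e \<notin> V" "e \<in> E' \<Longrightarrow> head \<Delta> e \<notin> V"
  using \<Gamma> \<Delta> disj by (auto simp: labelled_graphs_def)

lemma glue_in_labelled_graphs: "glue \<Gamma> \<Delta> \<in> labelled_graphs (V \<union> V') (E \<union> E') (N + K)"
proof -
  note S = labelled_graphs_pair_simps
  have type: "v \<in> V \<Longrightarrow> vertex_type (glue \<Gamma> \<Delta>) v = vertex_type \<Gamma> v"
    "v \<in> V' \<Longrightarrow> vertex_type (glue \<Gamma> \<Delta>) v = vertex_type \<Delta> v" for v
    using vertex_type_glue[of \<Gamma> \<Delta> v] disj by (simp_all add: S)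
  have "graph_monomial (glue \<Gamma> \<Delta>) =
      image_mset (vertex_type (glue \<Gamma> \<Delta>)) (mset_set V) + image_mset (vertex_type (glue \<Gamma> \<Delta>)) (mset_set V')"
    by (simp add: graph_monomial_def S mset_set_Union fin disj)
  also have "\<dots> = image_mset (vertex_type \<Gamma>) (mset_set V) + image_mset (vertex_type \<Delta>) (mset_set V')"
    by (intro arg_cong2[of _ _ _ _ "(+)"] image_mset_cong) (use fin type in auto)
  also have "\<dots> = N + K"
    using S by (simp add: graph_monomial_def)
  finally have "graph_monomial (glue \<Gamma> \<Delta>) = N + K" .
  moreover have "admissible (glue \<Gamma> \<Delta>)"
    unfolding admissible_def
  proof
    fix e assume "e \<in> arcs (glue \<Gamma> \<Delta>)"
    then consider "e \<in> E" | "e \<in> E'"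
      by (auto simp: S)
    then show "nat_of (vcolor (glue \<Gamma> \<Delta>) (tail (glue \<Gamma> \<Delta>) e)) dvd nat_of (ecolor (glue \<Gamma> \<Delta>) e) \<and>
        nat_of (vcolor (glue \<Gamma> \<Delta>) (head (glue \<Gamma> \<Delta>) e)) dvd nat_of (ecolor (glue \<Gamma> \<Delta>) e)"
      by cases (use S(7,8) in \<open>simp_all add: S arc_cases admissible_def\<close>)
  qed
  moreover have "tail (glue \<Gamma> \<Delta>) e \<in> V \<union> V'" "head (glue \<Gamma> \<Delta>) e \<in> V \<union> V'"
    if "e \<in> E \<union> E'" for e
    using that by (cases "e \<in> E"; simp add: S arc_cases)+
  moreover have "tail \<Gamma> \<in> extensional E" "head \<Gamma> \<in> extensional E" "ecolor \<Gamma> \<in> extensional E"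
    "vcolor \<Gamma> \<in> extensional V" "tail \<Delta> \<in> extensional E'" "head \<Delta> \<in> extensional E'"
    "ecolor \<Delta> \<in> extensional E'" "vcolor \<Delta> \<in> extensional V'"
    using \<Gamma> \<Delta> by (auto simp: labelled_graphs_def PiE_def)
  then have "tail (glue \<Gamma> \<Delta>) \<in> extensional (E \<union> E')" "head (glue \<Gamma> \<Delta>) \<in> extensional (E \<union> E')"
    "vcolor (glue \<Gamma> \<Delta>) \<in> extensional (V \<union> V')" "ecolor (glue \<Gamma> \<Delta>) \<in> extensional (E \<union> E')"
    by (simp_all add: S extensional_def)
  ultimately show ?thesis
    by (simp add: labelled_graphs_def S PiE_def Pi_def arc_cases)
qed

lemma closed_set_glue: "closed_set (glue \<Gamma> \<Delta>) V" "closed_set (glue \<Gamma> \<Delta>) V'"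
  by (auto simp: closed_set_def arc_cases labelled_graphs_pair_simps)

lemma inner_arcs_glue: "inner_arcs (glue \<Gamma> \<Delta>) V = E" "inner_arcs (glue \<Gamma> \<Delta>) V' = E'"
  by (auto simp: inner_arcs_def arc_cases labelled_graphs_pair_simps split: if_splits)

lemma induced_glue: "induced (glue \<Gamma> \<Delta>) V = \<Gamma>" "induced (glue \<Gamma> \<Delta>) V' = \<Delta>"
proof -
  note S = labelled_graphs_pair_simps
  have fin': "finite (V \<union> V')" "finite (E \<union> E')"
    using fin by simp_all
  note ind = induced_in_labelled_graphs[OF glue_in_labelled_graphs fin']
  show "induced (glue \<Gamma> \<Delta>) V = \<Gamma>"
    by (rule labelled_graphs_eqI[OF _ \<Gamma>])
      (use ind[of V] closed_set_glue in \<open>auto simp: inner_arcs_glue S\<close>)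
  show "induced (glue \<Gamma> \<Delta>) V' = \<Delta>"
    by (rule labelled_graphs_eqI[OF _ \<Delta>])
      (use ind[of V'] closed_set_glue in \<open>auto simp: inner_arcs_glue arc_cases S\<close>)
qed

text \<open>The part \<open>V\<close> is closed in the union and hence contains the component; the
  component is in turn closed in \<Gamma>, so connectedness of \<Gamma> forces it to be all of
  \<open>V\<close>.\<close>

lemma component_glue:
  assumes "connected_graph \<Gamma>" "v \<in> V"
  shows "component (glue \<Gamma> \<Delta>) v = V"
proof -
  note S = labelled_graphs_pair_simps
  let ?C = "component (glue \<Gamma> \<Delta>) v"
  have sub: "?C \<subseteq> V"
    by (rule component_subset) (use assms closed_set_glue in \<open>auto simp: S\<close>)
  have "closed_set \<Gamma> ?C"
    unfolding closed_set_def
  proof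
    fix e assume e: "e \<in> arcs \<Gamma>"
    then have "e \<in> arcs (glue \<Gamma> \<Delta>)"
      by simp
    with closed_set_component[of "glue \<Gamma> \<Delta>" v]
    have "tail (glue \<Gamma> \<Delta>) e \<in> ?C \<longleftrightarrow> head (glue \<Gamma> \<Delta>) e \<in> ?C"
      unfolding closed_set_def by (rule bspec)
    with e show "tail \<Gamma> e \<in> ?C \<longleftrightarrow> head \<Gamma> e \<in> ?C"
      by simp
  qed
  then show ?thesis
    using connected_graphD[OF assms(1), of ?C] sub in_component[of v "glue \<Gamma> \<Delta>"] by (auto simp: S)
qed

end

lemma inner_arcs_Diff:
  assumes "\<Gamma> \<in> labelled_graphs V E M"
  shows "inner_arcs \<Gamma> (V - S) = E - inner_arcs \<Gamma> S"
  using assms by (auto simp: inner_arcs_def labelled_graphs_def)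

lemma glue_induced:
  assumes \<Gamma>: "\<Gamma> \<in> labelled_graphs V E M" and fin: "finite V" "finite E"
    and S: "S \<subseteq> V" "closed_set \<Gamma> S"
  shows "glue (induced \<Gamma> S) (induced \<Gamma> (V - S)) = \<Gamma>"
proof -
  have V: "verts \<Gamma> = V" "arcs \<Gamma> = E" "closed_set \<Gamma> V"
    using \<Gamma> closed_set_verts[OF labelled_graphs_wf[OF \<Gamma> fin]] by (auto simp: labelled_graphs_def)
  have S': "V - S \<subseteq> V" "closed_set \<Gamma> (V - S)"
    using closed_set_Diff[OF V(3) S(2)] by auto
  have sub: "inner_arcs \<Gamma> S \<subseteq> E"
    by (auto simp: inner_arcs_def V)
  have un: "S \<union> (V - S) = V" "inner_arcs \<Gamma> S \<union> inner_arcs \<Gamma> (V - S) = E"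
    "S \<inter> (V - S) = {}" "inner_arcs \<Gamma> S \<inter> inner_arcs \<Gamma> (V - S) = {}"
    using S(1) sub by (auto simp: inner_arcs_Diff[OF \<Gamma>])
  have fin': "finite S" "finite (inner_arcs \<Gamma> S)" "finite (V - S)" "finite (inner_arcs \<Gamma> (V - S))"
    using finite_subset[OF S(1) fin(1)] finite_subset[OF sub fin(2)] fin by (auto simp: inner_arcs_Diff[OF \<Gamma>])
  have "glue (induced \<Gamma> S) (induced \<Gamma> (V - S)) \<in> labelled_graphs V E
      (image_mset (vertex_type \<Gamma>) (mset_set S) + image_mset (vertex_type \<Gamma>) (mset_set (V - S)))"
    using glue_in_labelled_graphs[OF induced_in_labelled_graphs[OF \<Gamma> fin S]
        induced_in_labelled_graphs[OF \<Gamma> fin S'] fin' un(3,4)] by (simp only: un)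
  then show ?thesis
  proof (rule labelled_graphs_eqI[OF _ \<Gamma>])
    show "vcolor (glue (induced \<Gamma> S) (induced \<Gamma> (V - S))) v = vcolor \<Gamma> v" if "v \<in> V" for v
      using that by (cases "v \<in> S") simp_all
    show "ecolor (glue (induced \<Gamma> S) (induced \<Gamma> (V - S))) e = ecolor \<Gamma> e \<and>
        tail (glue (induced \<Gamma> S) (induced \<Gamma> (V - S))) e = tail \<Gamma> e \<and>
        head (glue (induced \<Gamma> S) (induced \<Gamma> (V - S))) e = head \<Gamma> e" if "e \<in> E" for e
      using that by (cases "e \<in> inner_arcs \<Gamma> S") (simp_all add: inner_arcs_Diff[OF \<Gamma>])
  qed
qed

text \<open>The marked vertex \<open>v\<close> singles out one component, so each graph is cut in
  exactly one way and no division by the number of components arises. The rest of the graph may be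
  empty or disconnected.\<close>

lemma bij_betw_glue:
  fixes V :: "'v set" and E :: "'e set"
  assumes fin: "finite V" "finite E" and v: "v \<in> V"
  shows "bij_betw (\<lambda>(NK, V', E', \<Gamma>, \<Delta>). glue \<Gamma> \<Delta>)
    (SIGMA NK:{(N, K). N + K = M}. SIGMA V':{V'. V' \<subseteq> V \<and> v \<in> V'}. SIGMA E':Pow E.
       connected_labelled_graphs V' E' (fst NK) \<times> labelled_graphs (V - V') (E - E') (snd NK))
    (labelled_graphs V E M)"
  (is "bij_betw ?f ?P ?L")
proof (rule bij_betw_byWitness[where f' = "\<lambda>\<Gamma>. let S = component \<Gamma> v in
    ((graph_monomial (induced \<Gamma> S), graph_monomial (induced \<Gamma> (V - S))),
     S, inner_arcs \<Gamma> S, induced \<Gamma> S, induced \<Gamma> (V - S))"])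
  let ?g = "\<lambda>\<Gamma> :: ('v, 'e) colored_digraph. let S = component \<Gamma> v in
    ((graph_monomial (induced \<Gamma> S), graph_monomial (induced \<Gamma> (V - S))),
     S, inner_arcs \<Gamma> S, induced \<Gamma> S, induced \<Gamma> (V - S))"
  have P: "?f x \<in> ?L \<and> ?g (?f x) = x" if "x \<in> ?P" for x
  proof -
    obtain NK V' E' \<Gamma> \<Delta> where x: "x = (NK, V', E', \<Gamma>, \<Delta>)"
      by (rule prod_cases5)
    obtain N K where NK: "NK = (N, K)"
      by (cases NK)
    from that have *: "N + K = M" "V' \<subseteq> V" "v \<in> V'" "E' \<subseteq> E" "\<Gamma> \<in> labelled_graphs V' E' N"
      "connected_graph \<Gamma>" "\<Delta> \<in> labelled_graphs (V - V') (E - E') K"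
      by (auto simp: x NK connected_labelled_graphs_def)
    have fin': "finite V'" "finite E'" "finite (V - V')" "finite (E - E')"
      using finite_subset[OF *(2) fin(1)] finite_subset[OF *(4) fin(2)] fin by simp_all
    note G = *(5,7) fin' Diff_disjoint Diff_disjoint
    have "V' \<union> (V - V') = V" "E' \<union> (E - E') = E"
      using * by auto
    then have "glue \<Gamma> \<Delta> \<in> labelled_graphs V E M"
      using glue_in_labelled_graphs[OF G] by (simp add: *(1))
    moreover have "?g (glue \<Gamma> \<Delta>) = x"
      using labelled_graphs_pair_simps(9,10)[OF G]
      by (simp add: Let_def component_glue[OF G *(6,3)] induced_glue[OF G] inner_arcs_glue[OF G] x NK)
    ultimately show ?thesis
      by (simp add: x)
  qed
  have L: "?g \<Gamma> \<in> ?P \<and> ?f (?g \<Gamma>) = \<Gamma>" if \<Gamma>: "\<Gamma> \<in> ?L" for \<Gamma>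
  proof -
    note wf = labelled_graphs_wf[OF \<Gamma> fin]
    have V: "verts \<Gamma> = V" "arcs \<Gamma> = E" "graph_monomial \<Gamma> = M"
      using \<Gamma> by (auto simp: labelled_graphs_def)
    let ?S = "component \<Gamma> v"
    have S: "?S \<subseteq> V" "closed_set \<Gamma> ?S" "v \<in> ?S"
      using component_subset_verts[OF wf] closed_set_component[of \<Gamma> v] in_component[of v \<Gamma>] v
      by (simp_all add: V)
    have S': "V - ?S \<subseteq> V" "closed_set \<Gamma> (V - ?S)"
      using closed_set_Diff[OF closed_set_verts[OF wf] S(2)] by (auto simp: V)
    note ind = induced_in_labelled_graphs[OF \<Gamma> fin S(1,2)]
      and ind' = induced_in_labelled_graphs[OF \<Gamma> fin S']
    have mono: "graph_monomial (induced \<Gamma> ?S) = image_mset (vertex_type \<Gamma>) (mset_set ?S)"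
      "graph_monomial (induced \<Gamma> (V - ?S)) = image_mset (vertex_type \<Gamma>) (mset_set (V - ?S))"
      using ind ind' by (auto simp: labelled_graphs_def)
    have un: "mset_set ?S + mset_set (V - ?S) = mset_set V"
      using finite_subset[OF S(1) fin(1)] fin S(1)
      by (simp add: Un_absorb1 flip: mset_set_Union)
    have sum: "graph_monomial (induced \<Gamma> ?S) + graph_monomial (induced \<Gamma> (V - ?S)) = M"
      unfolding mono image_mset_union[symmetric] un using V by (simp add: graph_monomial_def)
    have "induced \<Gamma> ?S \<in> connected_labelled_graphs ?S (inner_arcs \<Gamma> ?S) (graph_monomial (induced \<Gamma> ?S))"
      using ind connected_induced_component[OF wf, of v] v
      by (simp add: connected_labelled_graphs_def mono V)
    moreover have "induced \<Gamma> (V - ?S) \<in>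
        labelled_graphs (V - ?S) (E - inner_arcs \<Gamma> ?S) (graph_monomial (induced \<Gamma> (V - ?S)))"
      using ind' by (simp add: mono inner_arcs_Diff[OF \<Gamma>])
    moreover have "inner_arcs \<Gamma> ?S \<subseteq> E"
      by (auto simp: inner_arcs_def V)
    ultimately have "?g \<Gamma> \<in> ?P"
      using sum S by (simp add: Let_def)
    moreover have "?f (?g \<Gamma>) = \<Gamma>"
      using glue_induced[OF \<Gamma> fin S(1,2)] by (simp add: Let_def)
    ultimately show ?thesis
      by blast
  qed
  show "\<forall>x\<in>?P. ?g (?f x) = x"
    using P by blast
  show "\<forall>\<Gamma>\<in>?L. ?f (?g \<Gamma>) = \<Gamma>"
    using L by blast
  show "?f ` ?P \<subseteq> ?L"
    using P by blast
  show "?g ` ?L \<subseteq> ?P"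
    using L by blast
qed

lemma finite_connected_labelled_graphs:
  "finite V \<Longrightarrow> finite E \<Longrightarrow> finite (connected_labelled_graphs V E M)"
  unfolding connected_labelled_graphs_def
  by (rule finite_subset[OF _ finite_labelled_graphs]) auto

lemma card_labelled_graphs_split:
  fixes V :: "'v set" and E :: "'e set"
  assumes fin: "finite V" "finite E" and v: "v \<in> V"
  shows "card (labelled_graphs V E M) = (\<Sum>(N, K) | N + K = M. \<Sum>V' | V' \<subseteq> V \<and> v \<in> V'. \<Sum>E'\<in>Pow E.
    card (connected_labelled_graphs V' E' N) * card (labelled_graphs (V - V') (E - E') K))"
proof -
  let ?X = "\<lambda>NK V' E'. connected_labelled_graphs V' E' (fst NK) \<times>
    labelled_graphs (V - V') (E - E') (snd NK)"
  have finV: "finite {V'. V' \<subseteq> V \<and> v \<in> V'}"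
    by (rule finite_subset[of _ "Pow V"]) (use fin in auto)
  have finX: "finite (?X NK V' E')" if "V' \<subseteq> V" "E' \<subseteq> E" for NK V' E'
    using finite_subset[OF that(1) fin(1)] finite_subset[OF that(2) fin(2)] fin
    by (intro finite_cartesian_product finite_connected_labelled_graphs finite_labelled_graphs) auto
  have finE: "finite (SIGMA E':Pow E. ?X NK V' E')" if "V' \<subseteq> V" for NK V'
  proof (rule finite_SigmaI)
    show "finite (Pow E)"
      using fin by simp
  qed (rule finX[OF that], simp)
  have finVE: "finite (SIGMA V':{V'. V' \<subseteq> V \<and> v \<in> V'}. SIGMA E':Pow E. ?X NK V' E')" for NK
    by (rule finite_SigmaI[OF finV], rule finE) simp
  have "card (labelled_graphs V E M) = card (SIGMA NK:{(N, K). N + K = M}.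
      SIGMA V':{V'. V' \<subseteq> V \<and> v \<in> V'}. SIGMA E':Pow E. ?X NK V' E')"
    using bij_betw_same_card[OF bij_betw_glue[OF fin v, of M]] by simp
  also have "\<dots> = (\<Sum>NK | fst NK + snd NK = M.
      card (SIGMA V':{V'. V' \<subseteq> V \<and> v \<in> V'}. SIGMA E':Pow E. ?X NK V' E'))"
    using finVE finite_multiset_splits[of M]
    by (subst card_SigmaI) (auto simp only: case_prod_unfold)
  also have "\<dots> = (\<Sum>NK | fst NK + snd NK = M. \<Sum>V' | V' \<subseteq> V \<and> v \<in> V'.
      card (SIGMA E':Pow E. ?X NK V' E'))"
    by (intro sum.cong refl card_SigmaI) (simp_all add: finV finE del: finite_SigmaI)
  also have "\<dots> = (\<Sum>NK | fst NK + snd NK = M. \<Sum>V' | V' \<subseteq> V \<and> v \<in> V'. \<Sum>E'\<in>Pow E. card (?X NK V' E'))"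
    by (intro sum.cong refl card_SigmaI) (simp_all add: fin finX del: finite_SigmaI)
  finally show ?thesis
    by (simp add: card_cartesian_product case_prod_unfold)
qed

section \<open>Isomorphism classes\<close>

lemma color_iso_pair_card:
  assumes "color_iso_pair \<Gamma> \<Delta> f g"
  shows "card (verts \<Delta>) = card (verts \<Gamma>)" "card (arcs \<Delta>) = card (arcs \<Gamma>)"
  using bij_betw_same_card[OF color_iso_pairD(1)[OF assms]]
    bij_betw_same_card[OF color_iso_pairD(2)[OF assms]] by simp_all

lemma isomorphic_trans:
  assumes "color_iso_pair \<Gamma> \<Delta> f g" "wf_graph \<Gamma>"
  shows "(\<exists>f g. color_iso_pair \<Gamma> \<Theta> f g) \<longleftrightarrow> (\<exists>f g. color_iso_pair \<Delta> \<Theta> f g)"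
  using color_iso_pair_comp[OF assms(1) _ assms(2)]
    color_iso_pair_comp[OF color_iso_pair_inv[OF assms] _ wf_graph_iso[OF assms]] by blast

text \<open>Isomorphic graphs have the same orbit among the graphs on initial segments of the
  natural numbers. The orbit count then gives equal group orders without conjugating
  automorphisms.\<close>

lemma card_Aut_graph_iso:
  assumes iso: "color_iso_pair \<Gamma> \<Delta> f g" and wf: "wf_graph \<Gamma>" and adm: "admissible \<Gamma>"
  shows "card (Aut_graph \<Delta>) = card (Aut_graph \<Gamma>)"
proof -
  let ?V = "{..<card (verts \<Gamma>)}" and ?E = "{..<card (arcs \<Gamma>)}"
  let ?O = "{\<Theta> \<in> labelled_graphs ?V ?E (graph_monomial \<Gamma>). \<exists>f g. color_iso_pair \<Gamma> \<Theta> f g}"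
  have 1: "card ?O * card (Aut_graph \<Gamma>) = fact (card ?V) * fact (card ?E)"
    by (rule card_orbit) (simp_all add: wf adm)
  have O: "?O = {\<Theta> \<in> labelled_graphs ?V ?E (graph_monomial \<Delta>). \<exists>f g. color_iso_pair \<Delta> \<Theta> f g}"
    by (simp add: isomorphic_trans[OF iso wf] graph_monomial_iso[OF iso wf])
  have 2: "card ?O * card (Aut_graph \<Delta>) = fact (card ?V) * fact (card ?E)"
    unfolding O
    by (rule card_orbit)
      (simp_all add: wf_graph_iso[OF iso wf] admissible_iso[OF iso wf adm] color_iso_pair_card[OF iso])
  have "b = a" if "n * a = c" "n * b = c" "c \<noteq> 0" for n a b c :: nat
    using that by auto
  from this[OF 1 2] show ?thesis
    by simp
qed

lemma equiv_graph_iso: "equiv connected_admissible_graphs graph_iso"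
proof (rule equivI)
  show "graph_iso \<subseteq> connected_admissible_graphs \<times> connected_admissible_graphs"
    by (auto simp: graph_iso_def)
  show "refl_on connected_admissible_graphs graph_iso"
    using color_iso_pair_id by (fastforce simp: refl_on_def graph_iso_def)
  show "sym graph_iso"
    unfolding sym_def graph_iso_def connected_admissible_graphs_eq using color_iso_pair_inv by fast
  show "trans graph_iso"
    unfolding trans_def graph_iso_def connected_admissible_graphs_eq using color_iso_pair_comp by fast
qed

section \<open>Invariants of isomorphism classes\<close>

definition class_rep :: "(nat, nat) colored_digraph set \<Rightarrow> (nat, nat) colored_digraph" where
  "class_rep C = (SOME \<Gamma>. \<Gamma> \<in> C)"

lemma class_rep_in:
  assumes "C \<in> graph_classes"
  shows "class_rep C \<in> C"
proof -
  have "\<exists>\<Gamma>. \<Gamma> \<in> C"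
    using assms in_quotient_imp_non_empty[OF equiv_graph_iso] unfolding graph_classes_def by blast
  then show ?thesis
    unfolding class_rep_def by (rule someI_ex)
qed

lemma graph_classes_subset:
  "C \<in> graph_classes \<Longrightarrow> C \<subseteq> connected_admissible_graphs"
  unfolding graph_classes_def by (rule in_quotient_imp_subset[OF equiv_graph_iso])

lemma class_repD:
  assumes "C \<in> graph_classes"
  shows "wf_graph (class_rep C)" "connected_graph (class_rep C)" "admissible (class_rep C)"
  using class_rep_in[OF assms] graph_classes_subset[OF assms] by (auto simp: connected_admissible_graphs_eq)

lemma in_class_iff:
  assumes "C \<in> graph_classes"
  shows "\<Delta> \<in> C \<longleftrightarrow> \<Delta> \<in> connected_admissible_graphs \<and> (\<exists>f g. color_iso_pair (class_rep C) \<Delta> f g)"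
proof -
  have "\<Delta> \<in> C \<longleftrightarrow> (class_rep C, \<Delta>) \<in> graph_iso"
    using in_quotient_imp_closed[OF equiv_graph_iso _ class_rep_in[OF assms]]
      in_quotient_imp_in_rel[OF equiv_graph_iso _ , of C "class_rep C" \<Delta>] class_rep_in[OF assms] assms
    unfolding graph_classes_def by blast
  then show ?thesis
    using class_repD[OF assms] by (auto simp: graph_iso_def connected_admissible_graphs_eq)
qed

definition class_monomial :: "(nat, nat) colored_digraph set \<Rightarrow> (pos \<times> A_gen) multiset" where
  "class_monomial C = graph_monomial (class_rep C)"

definition class_aut :: "(nat, nat) colored_digraph set \<Rightarrow> nat" where
  "class_aut C = card (Aut_graph (class_rep C))"

definition classes_of :: "(pos \<times> A_gen) multiset \<Rightarrow> (nat, nat) colored_digraph set set" where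
  "classes_of M = {C \<in> graph_classes. class_monomial C = M}"

lemma class_invariants:
  assumes "C \<in> graph_classes" "\<Gamma> \<in> C"
  shows "graph_monomial \<Gamma> = class_monomial C" "card (Aut_graph \<Gamma>) = class_aut C"
  using in_class_iff[OF assms(1), of \<Gamma>] assms(2) graph_monomial_iso card_Aut_graph_iso class_repD[OF assms(1)]
  unfolding class_monomial_def class_aut_def by blast+

lemma class_aut_pos: "C \<in> graph_classes \<Longrightarrow> class_aut C > 0"
  unfolding class_aut_def by (rule Aut_graph_card_pos[OF class_repD(1)])

lemma class_monomial_nonempty: "C \<in> graph_classes \<Longrightarrow> class_monomial C \<noteq> {#}"
  using class_repD(1,2)[of C] size_graph_monomial[of "class_rep C"]
  by (auto simp: class_monomial_def connected_graph_def wf_graph_def)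

text \<open>The members of a class with prescribed label sets and extensional fields form the orbit
  of the representative, so \<open>card_orbit\<close> applies.\<close>

lemma card_class_labelled:
  assumes C: "C \<in> classes_of M" and fin: "finite V" "finite E"
    and card: "card V = size M" "card E = size (outs M)"
  shows "card (C \<inter> labelled_graphs V E M) * class_aut C = fact (card V) * fact (card E)"
proof -
  have C': "C \<in> graph_classes" "graph_monomial (class_rep C) = M"
    using C by (auto simp: classes_of_def class_monomial_def)
  note R = class_repD[OF C'(1)]
  have "outs M = image_mset (ecolor (class_rep C)) (mset_set (arcs (class_rep C)))"
    unfolding C'(2)[symmetric]
    by (rule outs_graph_monomial) (use R in \<open>auto simp: wf_graph_def\<close>)
  then have "card (arcs (class_rep C)) = size (outs M)"
    by simp
  moreover have "card (verts (class_rep C)) = size M"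
    using size_graph_monomial[of "class_rep C"] C'(2) by simp
  moreover have "C \<inter> labelled_graphs V E M =
      {\<Delta> \<in> labelled_graphs V E (graph_monomial (class_rep C)). \<exists>f g. color_iso_pair (class_rep C) \<Delta> f g}"
    using wf_graph_iso[OF _ R(1)] admissible_iso[OF _ R(1,3)] connected_graph_iso[OF _ R(1,2)]
    unfolding set_eq_iff Int_iff mem_Collect_eq in_class_iff[OF C'(1)] C'(2) connected_admissible_graphs_eq
    by blast
  ultimately show ?thesis
    unfolding class_aut_def using card_orbit[OF R(1,3) fin] card by simp
qed

lemma classes_disjoint:
  "C \<in> graph_classes \<Longrightarrow> D \<in> graph_classes \<Longrightarrow> C \<noteq> D \<Longrightarrow> C \<inter> D = {}"
  using quotient_disj[OF equiv_graph_iso] unfolding graph_classes_def by blast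

text \<open>By the orbit count every such class meets the finite set of labelled graphs with
  standard label sets, and distinct classes meet it in disjoint subsets.\<close>

lemma finite_classes_of: "finite (classes_of M)"
proof -
  let ?L = "labelled_graphs {..<size M} {..<size (outs M)} M"
  have "inj_on (\<lambda>C. C \<inter> ?L) (classes_of M)"
  proof (rule inj_onI, rule ccontr)
    fix C D assume C: "C \<in> classes_of M" and D: "D \<in> classes_of M"
      and eq: "C \<inter> ?L = D \<inter> ?L" and ne: "C \<noteq> D"
    have "card (C \<inter> ?L) * class_aut C \<noteq> 0"
      using card_class_labelled[OF C, of "{..<size M}" "{..<size (outs M)}"] by simp
    then have "C \<inter> ?L \<noteq> {}"
      by auto
    with eq classes_disjoint[of C D] C D ne show False
      by (auto simp: classes_of_def)
  qed
  moreover have "(\<lambda>C. C \<inter> ?L) ` classes_of M \<subseteq> Pow ?L"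
    by auto
  then have "finite ((\<lambda>C. C \<inter> ?L) ` classes_of M)"
    by (rule finite_subset) (simp add: finite_labelled_graphs)
  ultimately show ?thesis
    by (rule finite_imageD[rotated])
qed

text \<open>The connected counterpart of \<open>graph_density\<close>: the number of connected
  labelled graphs over the same product of factorials, written as a sum over classes by orbit
  counting.\<close>

definition connected_density :: "(pos \<times> A_gen) multiset \<Rightarrow> rat" where
  "connected_density M = (\<Sum>C\<in>classes_of M. 1 / of_nat (class_aut C))"

lemma connected_density_empty: "connected_density {#} = 0"
proof -
  have "classes_of {#} = {}"
    using class_monomial_nonempty by (auto simp: classes_of_def)
  then show ?thesis
    by (simp add: connected_density_def)
qed

lemma card_connected_labelled_graphs:
  fixes V E :: "nat set"
  assumes fin: "finite V" "finite E" and card: "card V = size M" "card E = size (outs M)"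
  shows "of_nat (card (connected_labelled_graphs V E M)) =
    fact (card V) * fact (card E) * connected_density M"
proof -
  let ?L = "labelled_graphs V E M"
  have "connected_labelled_graphs V E M = (\<Union>C\<in>classes_of M. C \<inter> ?L)"
  proof (intro equalityI subsetI)
    fix \<Gamma> assume "\<Gamma> \<in> connected_labelled_graphs V E M"
    then have \<Gamma>: "\<Gamma> \<in> ?L" "connected_graph \<Gamma>" "admissible \<Gamma>" "graph_monomial \<Gamma> = M"
      by (auto simp: connected_labelled_graphs_def labelled_graphs_def)
    then have G: "\<Gamma> \<in> connected_admissible_graphs"
      using labelled_graphs_wf[OF \<Gamma>(1) fin] by (simp add: connected_admissible_graphs_eq)
    let ?C = "graph_iso `` {\<Gamma>}"
    have "?C \<in> graph_classes" "\<Gamma> \<in> ?C"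
      unfolding graph_classes_def by (rule quotientI[OF G], rule equiv_class_self[OF equiv_graph_iso G])
    then have "?C \<in> classes_of M"
      using class_invariants(1)[of ?C \<Gamma>] \<Gamma>(4) by (simp add: classes_of_def)
    with \<open>\<Gamma> \<in> ?C\<close> \<Gamma>(1) show "\<Gamma> \<in> (\<Union>C\<in>classes_of M. C \<inter> ?L)"
      by blast
  next
    fix \<Gamma> assume "\<Gamma> \<in> (\<Union>C\<in>classes_of M. C \<inter> ?L)"
    then obtain C where "C \<in> graph_classes" "\<Gamma> \<in> C" "\<Gamma> \<in> ?L"
      by (auto simp: classes_of_def)
    then show "\<Gamma> \<in> connected_labelled_graphs V E M"
      using graph_classes_subset[of C] by (auto simp: connected_labelled_graphs_def connected_admissible_graphs_eq)
  qed
  moreover have "card (\<Union>C\<in>classes_of M. C \<inter> ?L) = (\<Sum>C\<in>classes_of M. card (C \<inter> ?L))"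
  proof (rule card_UN_disjoint[OF finite_classes_of])
    show "\<forall>C\<in>classes_of M. finite (C \<inter> ?L)"
      by (simp add: finite_labelled_graphs fin)
    show "\<forall>C\<in>classes_of M. \<forall>D\<in>classes_of M. C \<noteq> D \<longrightarrow> C \<inter> ?L \<inter> (D \<inter> ?L) = {}"
      using classes_disjoint by (fastforce simp: classes_of_def)
  qed
  moreover have "(of_nat (card (C \<inter> ?L)) :: rat) = fact (card V) * fact (card E) * (1 / of_nat (class_aut C))"
    if C: "C \<in> classes_of M" for C
  proof -
    have "(of_nat (card (C \<inter> ?L) * class_aut C) :: rat) = of_nat (fact (card V) * fact (card E))"
      by (simp only: card_class_labelled[OF C fin card])
    moreover have "class_aut C > 0"
      using class_aut_pos C by (simp add: classes_of_def)
    ultimately show ?thesis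
      by (simp add: field_simps)
  qed
  ultimately show ?thesis
    by (simp add: connected_density_def sum_distrib_left)
qed

section \<open>The recursion for the densities\<close>

lemma card_subsets_containing:
  assumes "finite V" "v \<in> V" "n > 0"
  shows "card {V'. V' \<subseteq> V \<and> v \<in> V' \<and> card V' = n} = (card V - 1) choose (n - 1)"
proof -
  have "bij_betw (insert v) {W. W \<subseteq> V - {v} \<and> card W = n - 1} {V'. V' \<subseteq> V \<and> v \<in> V' \<and> card V' = n}"
  proof (rule bij_betw_byWitness[where f' = "\<lambda>V'. V' - {v}"])
    show "insert v ` {W. W \<subseteq> V - {v} \<and> card W = n - 1} \<subseteq> {V'. V' \<subseteq> V \<and> v \<in> V' \<and> card V' = n}"
    proof
      fix X assume "X \<in> insert v ` {W. W \<subseteq> V - {v} \<and> card W = n - 1}"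
      then obtain W where W: "X = insert v W" "W \<subseteq> V - {v}" "card W = n - 1"
        by blast
      then have "finite W" "v \<notin> W"
        using finite_subset[of W V] assms(1) by auto
      with W assms show "X \<in> {V'. V' \<subseteq> V \<and> v \<in> V' \<and> card V' = n}"
        by auto
    qed
    show "(\<lambda>V'. V' - {v}) ` {V'. V' \<subseteq> V \<and> v \<in> V' \<and> card V' = n} \<subseteq> {W. W \<subseteq> V - {v} \<and> card W = n - 1}"
      by auto
  qed auto
  from bij_betw_same_card[OF this] show ?thesis
    using assms by (simp add: n_subsets)
qed

text \<open>Mark the vertex 0 and split off its component, with s vertices and e edges in total and
  n and m of them in the component. There are (s-1 choose n-1) (e choose m) label sets. Multiplied
  by n! (s-n)! m! (e-m)! this is n (s-1)! e!, so the marking produces the factor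
  \<open>size N\<close> and the recursion becomes that of an exponential.\<close>

lemma graph_density_recursion:
  "of_nat (size M) * graph_density M =
    (\<Sum>(N, K) | N + K = M. of_nat (size N) * connected_density N * graph_density K)"
proof (cases "M = {#}")
  case True
  then show ?thesis
    by (auto intro!: sum.neutral[symmetric])
next
  case False
  define V where "V = {..<size M}"
  define E where "E = {..<size (outs M)}"
  have fin: "finite V" "finite E" and card: "card V = size M" "card E = size (outs M)"
    by (simp_all add: V_def E_def)
  have v: "0 \<in> V"
    using False by (simp add: V_def nonempty_has_size)
  let ?s = "size M" and ?e = "size (outs M)"
  have inner: "(\<Sum>V' | V' \<subseteq> V \<and> 0 \<in> V'. \<Sum>E'\<in>Pow E.
      of_nat (card (connected_labelled_graphs V' E' N)) * of_nat (card (labelled_graphs (V - V') (E - E') K))) =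
      fact (?s - 1) * fact ?e * (of_nat (size N) * connected_density N * graph_density K)"
    (is "?lhs = _") if NK: "N + K = M" for N K
  proof -
    let ?n = "size N" and ?m = "size (outs N)"
    \<comment> \<open>The number of pairs of graphs for one choice of label sets of the right sizes;
      it does not depend on the choice.\<close>
    define c :: rat where "c = fact ?n * fact ?m * connected_density N *
      (fact (?s - ?n) * fact (?e - ?m) * graph_density K)"
    have K: "size K = ?s - ?n" "size (outs K) = ?e - ?m"
      using NK by auto
    have le: "?n \<le> ?s" "?m \<le> ?e"
      using NK by auto
    have summand: "of_nat (card (connected_labelled_graphs V' E' N)) *
        of_nat (card (labelled_graphs (V - V') (E - E') K)) =
        (if card V' = ?n then if card E' = ?m then c else 0 else 0)"
      if V': "V' \<subseteq> V" and E': "E' \<subseteq> E" for V' E'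
    proof (cases "card V' = ?n \<and> card E' = ?m")
      case True
      have f: "finite V'" "finite E'"
        using finite_subset[OF V' fin(1)] finite_subset[OF E' fin(2)] .
      have d: "card (V - V') = size K" "card (E - E') = size (outs K)"
        using True card K by (simp_all add: card_Diff_subset V' E' f)
      show ?thesis
        using True K card_connected_labelled_graphs[OF f, of N]
          card_labelled_graphs[of "V - V'" "E - E'" K] fin d by (simp add: c_def)
    next
      case False
      \<comment> \<open>The monomial \<open>N\<close> fixes the numbers of vertices and edges, so
        label sets of other sizes carry no graph.\<close>
      have "connected_labelled_graphs V' E' N = {}"
        using labelled_graphsD(1,4)[of _ V' E' N] False finite_subset[OF V' fin(1)] finite_subset[OF E' fin(2)]
        by (force simp: connected_labelled_graphs_def)
      with False show ?thesis
        by auto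
    qed
    have finV': "finite {V'. V' \<subseteq> V \<and> 0 \<in> V'}"
      by (rule finite_subset[of _ "Pow V"]) (use fin in auto)
    have "?lhs = (\<Sum>V' | V' \<subseteq> V \<and> 0 \<in> V'. \<Sum>E'\<in>Pow E. if card V' = ?n then if card E' = ?m then c else 0 else 0)"
      by (intro sum.cong refl summand) auto
    also have "\<dots> = (\<Sum>V' | V' \<subseteq> V \<and> 0 \<in> V'. if card V' = ?n then \<Sum>E'\<in>Pow E. if card E' = ?m then c else 0 else 0)"
      by (intro sum.cong refl) simp
    also have "(\<Sum>E'\<in>Pow E. if card E' = ?m then c else 0) = of_nat (?e choose ?m) * c"
    proof -
      have "(\<Sum>E'\<in>Pow E. if card E' = ?m then c else 0) = (\<Sum>E' | E' \<in> Pow E \<and> card E' = ?m. c)"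
        using fin by (intro sum.inter_filter[symmetric]) simp
      also have "\<dots> = of_nat (card {E'. E' \<subseteq> E \<and> card E' = ?m}) * c"
        by simp
      finally show ?thesis
        using fin by (simp add: n_subsets card)
    qed
    also have "(\<Sum>V' | V' \<subseteq> V \<and> 0 \<in> V'. if card V' = ?n then of_nat (?e choose ?m) * c else 0) =
        (\<Sum>V' | V' \<in> {V'. V' \<subseteq> V \<and> 0 \<in> V'} \<and> card V' = ?n. of_nat (?e choose ?m) * c)"
      by (intro sum.inter_filter[symmetric] finV')
    also have "\<dots> = of_nat (card {V'. V' \<subseteq> V \<and> 0 \<in> V' \<and> card V' = ?n}) * (of_nat (?e choose ?m) * c)"
      by (simp add: conj_assoc)
    also have "\<dots> = fact (?s - 1) * fact ?e * (of_nat ?n * connected_density N * graph_density K)"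
    \<comment> \<open>Natural subtraction makes the binomial with \<open>?n - 1\<close> wrong at 0.
      There both sides vanish, since the connected density of the empty monomial is 0.\<close>
    proof (cases "?n = 0")
      case True
      then have "N = {#}"
        by simp
      then show ?thesis
        by (simp add: c_def connected_density_empty)
    next
      case False
      have a: "of_nat ((?s - 1) choose (?n - 1)) * (fact (?n - 1) * fact (?s - ?n)) = (fact (?s - 1) :: rat)"
      proof -
        have "fact (?n - 1) * fact (?s - 1 - (?n - 1)) * ((?s - 1) choose (?n - 1)) = (fact (?s - 1) :: nat)"
          by (rule binomial_fact_lemma) (use le in simp)
        moreover have "?s - 1 - (?n - 1) = ?s - ?n"
          using False by linarith
        ultimately have "of_nat (fact (?n - 1) * fact (?s - ?n) * ((?s - 1) choose (?n - 1))) =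
            (of_nat (fact (?s - 1)) :: rat)"
          by (simp only:)
        then show ?thesis
          by (simp only: of_nat_mult of_nat_fact mult_ac)
      qed
      have b: "fact ?n = (of_nat ?n * fact (?n - 1) :: rat)"
        by (rule fact_reduce) (use False in linarith)
      have "of_nat ((?s - 1) choose (?n - 1)) * (fact ?n * fact (?s - ?n)) =
          of_nat ?n * (of_nat ((?s - 1) choose (?n - 1)) * (fact (?n - 1) * fact (?s - ?n)) :: rat)"
        unfolding b by (simp only: mult_ac)
      then have 1: "of_nat ((?s - 1) choose (?n - 1)) * (fact ?n * fact (?s - ?n)) = (of_nat ?n * fact (?s - 1) :: rat)"
        unfolding a .
      have 2: "of_nat (?e choose ?m) * (fact ?m * fact (?e - ?m)) = (fact ?e :: rat)"
      proof -
        have "of_nat (fact ?m * fact (?e - ?m) * (?e choose ?m)) = (of_nat (fact ?e) :: rat)"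
          by (simp only: binomial_fact_lemma[OF le(2)])
        then show ?thesis
          by (simp only: of_nat_mult of_nat_fact mult_ac)
      qed
      have "of_nat (card {V'. V' \<subseteq> V \<and> 0 \<in> V' \<and> card V' = ?n}) * (of_nat (?e choose ?m) * c) =
          (of_nat ((?s - 1) choose (?n - 1)) * (fact ?n * fact (?s - ?n))) *
          (of_nat (?e choose ?m) * (fact ?m * fact (?e - ?m))) * (connected_density N * graph_density K)"
        using card_subsets_containing[OF fin(1) v, of ?n] False
        by (simp add: c_def card(1) mult_ac)
      then show ?thesis
        unfolding 1 2 by (simp add: mult_ac)
    qed
    finally show ?thesis .
  qed
  have "fact ?s * fact ?e * graph_density M = of_nat (card (labelled_graphs V E M))"
    by (simp add: card_labelled_graphs[OF fin card] card)
  also have "\<dots> = (\<Sum>(N, K) | N + K = M. \<Sum>V' | V' \<subseteq> V \<and> 0 \<in> V'. \<Sum>E'\<in>Pow E.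
      of_nat (card (connected_labelled_graphs V' E' N)) * of_nat (card (labelled_graphs (V - V') (E - E') K)))"
    by (simp add: card_labelled_graphs_split[OF fin v] case_prod_unfold)
  also have "\<dots> = (\<Sum>(N, K) | N + K = M.
      fact (?s - 1) * fact ?e * (of_nat (size N) * connected_density N * graph_density K))"
    by (intro sum.cong refl) (auto simp only: inner)
  also have "\<dots> = fact (?s - 1) * fact ?e *
      (\<Sum>(N, K) | N + K = M. of_nat (size N) * connected_density N * graph_density K)"
    by (simp add: sum_distrib_left case_prod_unfold)
  finally have "fact (?s - 1) * fact ?e * (of_nat ?s * graph_density M) = fact (?s - 1) * fact ?e *
      (\<Sum>(N, K) | N + K = M. of_nat (size N) * connected_density N * graph_density K)"
    using False by (simp add: fact_reduce[of ?s] nonempty_has_size mult_ac)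
  then show ?thesis
    by simp
qed

section \<open>A divisor sum\<close>

text \<open>
  Induction on \<open>n = p m\<close> with \<open>p\<close> prime: the divisors of \<open>n\<close> are the \<open>p d\<close> with \<open>d\<close> dividing \<open>m\<close> and the
  divisors of \<open>m\<close> prime to \<open>p\<close>.
\<close>

lemma sum_divisors_prod_primes:
  fixes f :: "nat \<Rightarrow> 'a :: comm_ring_1"
  assumes f1: "f 1 = 1" and fm: "\<And>p d. prime p \<Longrightarrow> f (p * d) = f p * f d" and n: "n > 0"
  shows "(\<Sum>d | d dvd n. f d * (\<Prod>q | prime q \<and> q dvd n div d. 1 - f q)) = 1"
  using n
proof (induction n rule: less_induct)
  case (less n)
  define P where "P m = (\<Prod>q | prime q \<and> q dvd m. 1 - f q)" for m
  define S where "S m = (\<Sum>d | d dvd m. f d * P (m div d))" for m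
  have IH: "S m = 1" if "m < n" "m > 0" for m
    using less.IH[OF that] by (simp add: S_def P_def)
  have "S n = 1"
  proof (cases "n = 1")
    case True
    have "{q :: nat. prime q \<and> q dvd 1} = {}"
      by auto
    then have "P 1 = 1"
      unfolding P_def by (simp only: prod.empty)
    with True show ?thesis
      using f1 by (simp add: S_def)
  next
    case False
    then obtain p where p: "prime p" "p dvd n"
      using prime_factor_nat by blast
    then obtain m where m: "n = p * m"
      by (elim dvdE)
    have "m > 0" "p > 0" "m < n"
      using less.prems m prime_gt_1_nat[OF p(1)] by simp_all
    have Sm: "S m = 1"
      by (rule IH) fact+
    have fin: "finite {d. d dvd n}" "finite {d. d dvd m}"
      using \<open>m > 0\<close> less.prems by simp_all
    have reindex: "(\<Sum>d\<in>(*) p ` {d. d dvd k}. f d * P (p * k div d)) = f p * S k" for k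
    proof -
      have "(\<Sum>d\<in>(*) p ` {d. d dvd k}. f d * P (p * k div d)) =
          (\<Sum>d | d dvd k. f (p * d) * P (p * k div (p * d)))"
        using \<open>p > 0\<close> by (subst sum.reindex) (auto simp: inj_on_def)
      also have "\<dots> = (\<Sum>d | d dvd k. f p * (f d * P (k div d)))"
        using \<open>p > 0\<close> by (intro sum.cong refl) (simp add: fm[OF p(1)] mult.assoc)
      finally show ?thesis
        by (simp add: S_def sum_distrib_left)
    qed
    have split: "{d. d dvd n} = (*) p ` {d. d dvd m} \<union> {d. d dvd m \<and> \<not> p dvd d}"
    proof (intro equalityI subsetI)
      fix d assume d: "d \<in> {d. d dvd n}"
      show "d \<in> (*) p ` {d. d dvd m} \<union> {d. d dvd m \<and> \<not> p dvd d}"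
      proof (cases "p dvd d")
        case True
        then obtain d' where "d = p * d'"
          by (elim dvdE)
        with d m \<open>p > 0\<close> show ?thesis
          by auto
      next
        case False
        then have "coprime d p"
          using p(1) by (metis coprime_commute prime_imp_coprime)
        with d m have "d dvd m"
          by (simp add: coprime_dvd_mult_right_iff)
        with False show ?thesis
          by simp
      qed
    next
      fix d assume "d \<in> (*) p ` {d. d dvd m} \<union> {d. d dvd m \<and> \<not> p dvd d}"
      then show "d \<in> {d. d dvd n}"
        by (auto simp: m)
    qed
    have "S n = (\<Sum>d\<in>(*) p ` {d. d dvd m}. f d * P (n div d)) +
        (\<Sum>d | d dvd m \<and> \<not> p dvd d. f d * P (n div d))"
      unfolding S_def split
      by (rule sum.union_disjoint) (use fin in \<open>auto intro: finite_subset[OF _ fin(2)]\<close>)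
    also have "(\<Sum>d\<in>(*) p ` {d. d dvd m}. f d * P (n div d)) = f p * S m"
      unfolding m by (rule reindex)
    \<comment> \<open>It remains to see that the divisors prime to \<open>p\<close> contribute
      \<open>1 - f p\<close>. If \<open>p\<close> does not divide \<open>m\<close>, the prime
      \<open>p\<close> is new in every quotient and gives this factor times \<open>S m\<close>. If
      it does, the quotients by \<open>d\<close> of \<open>n\<close> and of \<open>m\<close> have
      the same primes.\<close>
    also have "(\<Sum>d | d dvd m \<and> \<not> p dvd d. f d * P (n div d)) = 1 - f p"
    proof (cases "p dvd m")
      case True
      then obtain k where k: "m = p * k"
        by (elim dvdE)
      have "k > 0"
        using \<open>m > 0\<close> k by (cases k) auto
      have "k \<le> m"
        using k \<open>p > 0\<close> by simp
      then have "k < n"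
        using \<open>m < n\<close> by (rule le_less_trans)
      have Pd: "P (n div d) = P (m div d)" if d: "d dvd m" "\<not> p dvd d" for d
      proof -
        obtain e where e: "m = d * e"
          using d(1) by (elim dvdE)
        with True d(2) p(1) have "p dvd e"
          by (simp add: prime_dvd_mult_iff)
        have "d > 0"
          using e \<open>m > 0\<close> by simp
        have "n div d = p * e" "m div d = e"
          using \<open>d > 0\<close> by (simp_all add: m e)
        moreover have "{q. prime q \<and> q dvd p * e} = {q. prime q \<and> q dvd e}"
          using \<open>p dvd e\<close> p(1) by (auto simp: prime_dvd_mult_iff primes_dvd_imp_eq)
        ultimately show ?thesis
          by (simp add: P_def)
      qed
      \<comment> \<open>The same splitting of divisors, now for \<open>m = p * k\<close>. Since both
        \<open>S m\<close> and \<open>S k\<close> equal 1, the sum over divisors prime to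
        \<open>p\<close> can be solved for.\<close>
      have "S m = (\<Sum>d\<in>(*) p ` {d. d dvd k} \<union> {d. d dvd m \<and> \<not> p dvd d}. f d * P (m div d))"
        unfolding S_def
      proof (rule sum.cong)
        show "{d. d dvd m} = (*) p ` {d. d dvd k} \<union> {d. d dvd m \<and> \<not> p dvd d}"
          using \<open>p > 0\<close> by (auto simp: k elim!: dvdE[of p])
      qed simp
      also have "\<dots> = (\<Sum>d\<in>(*) p ` {d. d dvd k}. f d * P (m div d)) +
          (\<Sum>d | d dvd m \<and> \<not> p dvd d. f d * P (m div d))"
        using \<open>k > 0\<close> by (intro sum.union_disjoint) (auto intro: finite_subset[OF _ fin(2)])
      also have "(\<Sum>d\<in>(*) p ` {d. d dvd k}. f d * P (m div d)) = f p * S k"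
        unfolding k by (rule reindex)
      also have "S k = 1"
        by (rule IH) fact+
      finally have "(\<Sum>d | d dvd m \<and> \<not> p dvd d. f d * P (m div d)) = 1 - f p"
        by (simp add: Sm algebra_simps)
      then show ?thesis
        using Pd by simp
    next
      case False
      have Pd: "P (n div d) = (1 - f p) * P (m div d)" if d: "d dvd m" for d
      proof -
        obtain e where e: "m = d * e"
          using d by (elim dvdE)
        have "d > 0" "e > 0"
          using e \<open>m > 0\<close> by simp_all
        have ne: "\<not> p dvd e"
          using False e dvd_mult[of p e d] by auto
        have div: "n div d = p * e" "m div d = e"
          using \<open>d > 0\<close> by (simp_all add: m e)
        have "{q. prime q \<and> q dvd p * e} = insert p {q. prime q \<and> q dvd e}"
          using p(1) by (auto simp: prime_dvd_mult_iff primes_dvd_imp_eq)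
        moreover have "finite {q. prime q \<and> q dvd e}"
          by (rule finite_subset[of _ "{q. q dvd e}"]) (use \<open>e > 0\<close> in auto)
        ultimately show ?thesis
          using ne by (simp add: P_def div)
      qed
      have nd: "\<not> p dvd d" if "d dvd m" for d
        using False that dvd_trans by blast
      have "(\<Sum>d | d dvd m \<and> \<not> p dvd d. f d * P (n div d)) = (\<Sum>d | d dvd m. (1 - f p) * (f d * P (m div d)))"
        by (rule sum.cong) (use nd Pd in \<open>auto simp: mult_ac\<close>)
      also have "\<dots> = (1 - f p) * S m"
        by (simp add: S_def sum_distrib_left)
      finally show ?thesis
        by (simp add: Sm)
    qed
    finally show ?thesis
      by (simp add: Sm)
  qed
  then show ?case
    by (simp add: S_def P_def)
qed

lemma sum_divisors_phi:
  assumes "n > 0"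
  shows "(\<Sum>d | d dvd n. of_nat d powi (- b) * phi b (n div d)) = 1"
proof -
  have "(of_nat (p * d) powi (- b) :: rat) = of_nat p powi (- b) * of_nat d powi (- b)" for p d :: nat
    by (simp add: power_int_mult_distrib)
  with sum_divisors_prod_primes[of "\<lambda>d. of_nat d powi (- b) :: rat", OF _ _ assms] show ?thesis
    by (simp add: phi_def)
qed

section \<open>The logarithm of the integral\<close>

text \<open>The scalar factor of w(\<Gamma>) in terms of vertex types: \<open>outs M\<close> is the
  multiset of edge colours of any admissible graph with these types, so its
  \<open>part_product\<close> is the product of the m(e).\<close>

definition monomial_weight :: "(pos \<times> A_gen) multiset \<Rightarrow> rat" where
  "monomial_weight M = of_nat (aut_product M) * part_product (outs M) / color_product M"

definition monomial_betti :: "(pos \<times> A_gen) multiset \<Rightarrow> int" where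
  "monomial_betti M = int (size (outs M)) - int (size M) + 1"

text \<open>Only vertex colours enter: an edge colour is a multiple of the colours of its endpoints
  and cannot lower the gcd.\<close>

definition monomial_gcd :: "(pos \<times> A_gen) multiset \<Rightarrow> nat" where
  "monomial_gcd M = Gcd ((nat_of \<circ> fst) ` set_mset M)"

lemma aut_product_add: "aut_product (M + N) = aut_product M * aut_product N"
  by (simp add: aut_product_def)

lemma monomial_weight_add: "monomial_weight (M + N) = monomial_weight M * monomial_weight N"
  by (simp add: monomial_weight_def aut_product_add)

lemma integral_coeff_eq: "integral_coeff M = monomial_weight M * graph_density M"
  using aut_product_pos[of M] by (simp add: integral_coeff_def monomial_weight_def graph_density_def)

text \<open>\<open>monomial_weight\<close> is multiplicative in the monomial, so multiplying the
  recursion of the densities by it yields the recursion of the weighted coefficients.\<close>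

lemma integral_eq_exp_series:
  "integral_X (Exp A_XX) = exp_series (Series (\<lambda>M. monomial_weight M * connected_density M))"
proof (rule series_eqI)
  fix M
  have "coeff (exp_series (Series (\<lambda>M. monomial_weight M * connected_density M))) M = integral_coeff M"
  proof (rule coeff_exp_series_eqI)
    show "integral_coeff {#} = 1"
      by (simp add: integral_coeff_def)
    fix M
    have "of_nat (size M) * integral_coeff M = monomial_weight M * (of_nat (size M) * graph_density M)"
      by (simp add: integral_coeff_eq)
    also have "\<dots> = (\<Sum>(N, K) | N + K = M.
        monomial_weight M * (of_nat (size N) * connected_density N * graph_density K))"
      unfolding graph_density_recursion by (simp add: sum_distrib_left case_prod_unfold)
    also have "\<dots> = (\<Sum>(N, K) | N + K = M. of_nat (size N) *
        coeff (Series (\<lambda>M. monomial_weight M * connected_density M)) N * integral_coeff K)"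
      by (intro sum.cong refl) (auto simp: integral_coeff_eq monomial_weight_add)
    finally show "of_nat (size M) * integral_coeff M = (\<Sum>(N, K) | N + K = M. of_nat (size N) *
        coeff (Series (\<lambda>M. monomial_weight M * connected_density M)) N * integral_coeff K)" .
  qed (simp add: connected_density_empty)
  then show "coeff (integral_X (Exp A_XX)) M =
      coeff (exp_series (Series (\<lambda>M. monomial_weight M * connected_density M))) M"
    by (simp add: coeff_integral_Exp_A_XX)
qed

section \<open>Effect of multiplying all colours by a constant\<close>

lemma aut_product_adams: "aut_product (adams k M) = aut_product M"
  by (simp add: aut_product_def multiset.map_comp comp_def case_prod_unfold)

lemma mult_fact_adams: "mult_fact (adams k M) = mult_fact M"
  by (rule mult_fact_image_inj) (auto simp: inj_on_def pos_times_inject)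

lemma scaled_inject: "scaled k l = scaled k m \<longleftrightarrow> l = m"
  by (metis divided_scaled)

lemma graph_density_adams: "graph_density (adams k M) = graph_density M"
  by (simp add: graph_density_def outs_adams ins_adams scaled_inject mult_fact_scaled mult_fact_adams
      aut_product_adams)

text \<open>
  The graph densities are the exponential of the connected densities, so their invariance under
  rescaling all colours carries over.
\<close>

lemma connected_density_adams: "connected_density (adams k M) = connected_density M"
proof -
  have 1: "coeff (exp_series (Series connected_density)) M = graph_density M" for M
    by (rule coeff_exp_series_eqI)
      (simp_all add: connected_density_empty graph_density_recursion, simp add: graph_density_def aut_product_def)
  have 2: "coeff (exp_series (Series (\<lambda>M. connected_density (adams k M)))) M = graph_density M" for M
  proof (rule coeff_exp_series_eqI)
    show "graph_density {#} = 1"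
      by (simp add: graph_density_def aut_product_def)
    fix M :: "(pos \<times> A_gen) multiset"
    let ?a = "\<lambda>(N, K). (adams k N, adams k K)"
    \<comment> \<open>Every splitting of \<open>adams k M\<close> comes from one of
      \<open>M\<close>. Hence the density recursion at \<open>adams k M\<close> reads as a recursion
      at \<open>M\<close> in which the connected densities are the rescaled ones.\<close>
    have image: "{(N, K). N + K = adams k M} = ?a ` {(N, K). N + K = M}"
    proof (intro equalityI subsetI)
      fix x assume "x \<in> {(N, K). N + K = adams k M}"
      then obtain N K where x: "x = (N, K)" "adams k M = N + K"
        by auto
      from image_mset_eq_plusD[OF x(2)] obtain N' K' where "M = N' + K'" "N = adams k N'" "K = adams k K'"
        by blast
      with x show "x \<in> ?a ` {(N, K). N + K = M}"
        by (intro image_eqI[of _ _ "(N', K')"]) simp_all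
    qed auto
    have "of_nat (size M) * graph_density M = of_nat (size (adams k M)) * graph_density (adams k M)"
      by (simp add: graph_density_adams)
    also have "\<dots> = (\<Sum>x\<in>?a ` {(N, K). N + K = M}.
        of_nat (size (fst x)) * connected_density (fst x) * graph_density (snd x))"
      unfolding graph_density_recursion image by (simp add: case_prod_unfold)
    also have "\<dots> = (\<Sum>(N, K) | N + K = M.
        of_nat (size N) * connected_density (adams k N) * graph_density K)"
    proof (subst sum.reindex)
      show "inj_on ?a {(N, K). N + K = M}"
        by (auto simp: inj_on_def adams_inject)
    qed (intro sum.cong refl, auto simp: graph_density_adams)
    finally show "of_nat (size M) * graph_density M = (\<Sum>(N, K) | N + K = M.
        of_nat (size N) * coeff (Series (\<lambda>M. connected_density (adams k M))) N * graph_density K)"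
      by simp
  qed (simp add: connected_density_empty)
  have "Series (\<lambda>M. connected_density (adams k M)) = Series connected_density"
    by (rule exp_series_inject) (auto simp: connected_density_empty 1 2 intro: series_eqI)
  then have "coeff (Series (\<lambda>M. connected_density (adams k M))) M = coeff (Series connected_density) M"
    by simp
  then show ?thesis
    by simp
qed

lemma part_product_scaled: "part_product (scaled k l) = of_nat (nat_of k) ^ size l * part_product l"
  by (induction l) (simp_all add: algebra_simps)

lemma color_product_adams: "color_product (adams k M) = of_nat (nat_of k) ^ size M * color_product M"
  by (induction M) (auto simp: algebra_simps)

lemma monomial_betti_adams: "monomial_betti (adams k M) = monomial_betti M"
  by (simp add: monomial_betti_def outs_adams)

text \<open>Each edge contributes a factor k and each vertex a factor 1/k, while the partitions at
  the vertices are unaffected. The exponent is the number of edges minus the number of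
  vertices.\<close>

lemma monomial_weight_adams:
  "monomial_weight (adams k M) = of_nat (nat_of k) powi (monomial_betti M - 1) * monomial_weight M"
proof -
  have "(of_nat (nat_of k) powi (monomial_betti M - 1) :: rat) =
      of_nat (nat_of k) ^ size (outs M) / of_nat (nat_of k) ^ size M"
    by (simp add: monomial_betti_def power_int_diff)
  then show ?thesis
    by (simp add: monomial_weight_def outs_adams part_product_scaled color_product_adams aut_product_adams)
qed

lemma monomial_gcd_adams: "monomial_gcd (adams k M) = nat_of k * monomial_gcd M"
proof -
  have "(nat_of \<circ> fst) ` set_mset (adams k M) = (*) (nat_of k) ` (nat_of \<circ> fst) ` set_mset M"
    by (force simp: image_iff)
  then show ?thesis
    by (simp add: monomial_gcd_def Gcd_mult)
qed

lemma monomial_gcd_pos: "M \<noteq> {#} \<Longrightarrow> monomial_gcd M > 0"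
  by (auto simp: monomial_gcd_def image_subset_iff intro!: Nat.gr0I)

text \<open>The summands of the plethystic sum that can reach \<open>M\<close> are thereby indexed
  by the divisors of its gcd.\<close>

lemma ex_adams_iff: "(\<exists>N. M = adams k N) \<longleftrightarrow> nat_of k dvd monomial_gcd M"
proof
  assume dvd: "nat_of k dvd monomial_gcd M"
  let ?f = "\<lambda>(c, g). (pos_of (nat_of c div nat_of k), g)"
  have "image_mset ((\<lambda>(c, g). (pos_times k c, g)) \<circ> ?f) M = image_mset (\<lambda>x. x) M"
  proof (rule image_mset_cong)
    fix x assume x: "x \<in># M"
    then have "monomial_gcd M dvd nat_of (fst x)"
      unfolding monomial_gcd_def by (intro Gcd_dvd) auto
    with dvd have "nat_of k dvd nat_of (fst x)"
      by (rule dvd_trans)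
    then show "((\<lambda>(c, g). (pos_times k c, g)) \<circ> ?f) x = x"
      by (cases x) (simp add: pos_times_pos_of_div)
  qed
  then have "M = adams k (image_mset ?f M)"
    by (simp add: multiset.map_comp)
  then show "\<exists>N. M = adams k N"
    by blast
qed (auto simp: monomial_gcd_adams)

text \<open>For \<open>M = adams k N\<close> the coefficient at \<open>N\<close> is k^(1-b) times
  that at \<open>M\<close>; with the 1/k of the plethystic sum this becomes k^(-b), the power in the
  divisor identity. That identity holds for every integer b, so monomials with negative
  \<open>monomial_betti\<close> are covered as well.\<close>

lemma plethystic_sum_graph_series:
  "plethystic_sum (Series (\<lambda>M. phi (monomial_betti M) (monomial_gcd M) *
      (monomial_weight M * connected_density M))) =
    Series (\<lambda>M. monomial_weight M * connected_density M)"
  (is "plethystic_sum ?L = Series ?c")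
proof (rule series_eqI)
  fix M
  have L0: "coeff ?L {#} = 0"
    by (simp add: connected_density_empty)
  show "coeff (plethystic_sum ?L) M = coeff (Series ?c) M"
  proof (cases "M = {#}")
    case True
    then show ?thesis
      by (simp add: coeff_plethystic_sum_empty[OF L0] connected_density_empty)
  next
    case False
    let ?g = "monomial_gcd M" and ?b = "monomial_betti M"
    let ?A = "{k. nat_of k dvd ?g}"
    have g: "?g > 0"
      by (rule monomial_gcd_pos[OF False])
    have "?A \<subseteq> {k. nat_of k \<le> ?g}"
      using g by (auto intro: dvd_imp_le)
    then have fin: "finite ?A"
      by (rule finite_subset) (rule finite_pos_le)
    have "coeff (plethystic_sum ?L) M = (\<Sum>k\<in>?A. coeff (psi k ?L) M / of_nat (nat_of k))"
    proof (rule coeff_plethystic_sum[OF L0 fin])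
      fix k assume "k \<notin> ?A"
      then show "coeff (psi k ?L) M = 0"
        using ex_adams_iff[of M k] by (intro coeff_psi_eq_0) blast
    qed
    also have "\<dots> = (\<Sum>k\<in>?A. (of_nat (nat_of k) powi (- ?b) * phi ?b (?g div nat_of k)) * ?c M)"
    proof (rule sum.cong)
      fix k assume "k \<in> ?A"
      then obtain N where N: "M = adams k N"
        using ex_adams_iff[of M k] by blast
      let ?k = "of_nat (nat_of k) :: rat"
      have 1: "coeff (psi k ?L) M = phi ?b (?g div nat_of k) * ?c N"
        by (simp add: N coeff_psi_image monomial_betti_adams monomial_gcd_adams)
      have 2: "?c M = ?k powi (?b - 1) * ?c N"
        by (simp add: N monomial_weight_adams connected_density_adams monomial_betti_adams)
      have 3: "?k powi (- ?b) * ?k powi (?b - 1) = 1 / ?k"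
        by (simp add: divide_inverse flip: power_int_add)
      have "(?k powi (- ?b) * phi ?b (?g div nat_of k)) * ?c M =
          (?k powi (- ?b) * ?k powi (?b - 1)) * (phi ?b (?g div nat_of k) * ?c N)"
        unfolding 2 by (simp only: mult_ac)
      then show "coeff (psi k ?L) M / ?k = (?k powi (- ?b) * phi ?b (?g div nat_of k)) * ?c M"
        unfolding 1 3 by simp
    qed simp
    also have "\<dots> = (\<Sum>k\<in>?A. of_nat (nat_of k) powi (- ?b) * phi ?b (?g div nat_of k)) * ?c M"
      by (simp only: sum_distrib_right)
    also have "(\<Sum>k\<in>?A. of_nat (nat_of k) powi (- ?b) * phi ?b (?g div nat_of k)) =
        (\<Sum>d | d dvd ?g. of_nat d powi (- ?b) * phi ?b (?g div d))"
    proof (rule sum.reindex_bij_witness[of _ pos_of nat_of])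
      fix d assume "d \<in> {d. d dvd ?g}"
      then have "d > 0"
        using g by (auto intro: Nat.gr0I)
      then show "nat_of (pos_of d) = d" "pos_of d \<in> ?A"
        using \<open>d \<in> {d. d dvd ?g}\<close> by simp_all
    qed (auto simp: nat_of_inverse)
    also have "\<dots> = 1"
      by (rule sum_divisors_phi[OF g])
    finally show ?thesis
      by simp
  qed
qed

section \<open>The terms of the sum over graph classes\<close>

lemma prod_monomial:
  "finite V \<Longrightarrow> (\<Prod>v\<in>V. monomial {#t v#}) = monomial (image_mset t (mset_set V))"
  by (induction V rule: finite_induct) (simp_all add: monomial_empty monomial_mult)

lemma graph_term_eq:
  fixes \<Gamma> :: "('v, 'e) colored_digraph"
  assumes "wf_graph \<Gamma>" "admissible \<Gamma>" "graph_monomial \<Gamma> = M"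
  shows "graph_term \<Gamma> = scale (phi (monomial_betti M) (monomial_gcd M) * monomial_weight M /
    of_nat (card (Aut_graph \<Gamma>))) (monomial M)"
proof -
  note W = wf_graphD[OF assms(1)]
  have M: "M = image_mset (vertex_type \<Gamma>) (mset_set (verts \<Gamma>))"
    using assms(3) by (simp add: graph_monomial_def)
  have outs: "outs M = image_mset (ecolor \<Gamma>) (mset_set (arcs \<Gamma>))"
    unfolding assms(3)[symmetric] using assms(1,2) by (intro outs_graph_monomial) (auto simp: wf_graph_def)
  have "(\<Prod>v\<in>verts \<Gamma>. psi (vcolor \<Gamma> v) (gen (out_partition \<Gamma> v, in_partition \<Gamma> v))) =
      (\<Prod>v\<in>verts \<Gamma>. monomial {#vertex_type \<Gamma> v#})"
    by (simp add: gen_def psi_monomial vertex_type_def)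
  also have "\<dots> = monomial M"
    by (simp add: prod_monomial[OF W(1)] M)
  finally have mono: "(\<Prod>v\<in>verts \<Gamma>. psi (vcolor \<Gamma> v) (gen (out_partition \<Gamma> v, in_partition \<Gamma> v))) =
      monomial M" .
  have "(\<Prod>v\<in>verts \<Gamma>. of_nat (card (Aut_partition (out_partition \<Gamma> v))) *
      of_nat (card (Aut_partition (in_partition \<Gamma> v)))) = (of_nat (aut_product M) :: rat)"
    by (simp add: M aut_product_def card_Aut_partition vertex_type_def multiset.map_comp comp_def
        flip: prod_unfold_prod_mset)
  moreover have "(\<Prod>e\<in>arcs \<Gamma>. of_nat (nat_of (ecolor \<Gamma> e))) = part_product (outs M)"
    by (simp add: outs multiset.map_comp comp_def flip: prod_unfold_prod_mset)
  moreover have "(\<Prod>v\<in>verts \<Gamma>. of_nat (nat_of (vcolor \<Gamma> v))) = color_product M"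
    by (simp add: M vertex_type_def multiset.map_comp comp_def flip: prod_unfold_prod_mset)
  ultimately have weight: "weight \<Gamma> = scale (monomial_weight M) (monomial M)"
    by (simp add: weight_def mono monomial_weight_def)
  have betti: "betti \<Gamma> = monomial_betti M"
    by (simp add: betti_def monomial_betti_def outs) (simp add: M)
  have V: "(nat_of \<circ> vcolor \<Gamma>) ` verts \<Gamma> = (nat_of \<circ> fst) ` set_mset M"
    using W(1) by (simp add: M image_image vertex_type_def)
  have "monomial_gcd M dvd color_gcd \<Gamma>"
    unfolding color_gcd_def V
  proof (rule Gcd_greatest)
    fix n assume "n \<in> (nat_of \<circ> fst) ` set_mset M \<union> (nat_of \<circ> ecolor \<Gamma>) ` arcs \<Gamma>"
    then show "monomial_gcd M dvd n"
    proof
      assume "n \<in> (nat_of \<circ> fst) ` set_mset M"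
      then show ?thesis
        unfolding monomial_gcd_def by (rule Gcd_dvd)
    next
      assume "n \<in> (nat_of \<circ> ecolor \<Gamma>) ` arcs \<Gamma>"
      then obtain e where e: "e \<in> arcs \<Gamma>" "n = nat_of (ecolor \<Gamma> e)"
        by auto
      have "monomial_gcd M dvd nat_of (vcolor \<Gamma> (tail \<Gamma> e))"
        unfolding monomial_gcd_def V[symmetric] by (rule Gcd_dvd) (use W(3)[OF e(1)] in auto)
      also have "\<dots> dvd n"
        using assms(2) e by (simp add: admissible_def)
      finally show ?thesis .
    qed
  qed
  moreover have "color_gcd \<Gamma> dvd monomial_gcd M"
    unfolding color_gcd_def V monomial_gcd_def by (rule Gcd_greatest) auto
  ultimately have gcd: "color_gcd \<Gamma> = monomial_gcd M"
    by (simp add: dvd_antisym)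
  show ?thesis
    unfolding graph_term_def weight betti gcd
    by (rule series_eqI) (simp add: scale.rep_eq)
qed

text \<open>All members of a class share their monomial and the order of their automorphism group,
  so \<open>graph_term\<close> is constant on the class and \<open>the_elem\<close> returns that
  value.\<close>

lemma coeff_class_term:
  assumes "C \<in> graph_classes"
  shows "coeff (class_term C) M = (if M = class_monomial C then
    phi (monomial_betti M) (monomial_gcd M) * monomial_weight M / of_nat (class_aut C) else 0)"
proof -
  let ?t = "scale (phi (monomial_betti (class_monomial C)) (monomial_gcd (class_monomial C)) *
    monomial_weight (class_monomial C) / of_nat (class_aut C)) (monomial (class_monomial C))"
  have "graph_term \<Gamma> = ?t" if "\<Gamma> \<in> C" for \<Gamma>
    using graph_term_eq[OF _ _ class_invariants(1)[OF assms that]] class_invariants(2)[OF assms that]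
      graph_classes_subset[OF assms] that by (auto simp: connected_admissible_graphs_eq)
  then have "graph_term ` C = {?t}"
    using class_rep_in[OF assms] by auto
  then have "class_term C = ?t"
    by (simp add: class_term_def)
  then show ?thesis
    by (simp add: scale.rep_eq monomial.rep_eq)
qed

lemma formally_summable_class_term: "formally_summable class_term graph_classes"
  unfolding formally_summable_def
proof
  fix M
  have "{C \<in> graph_classes. coeff (class_term C) M \<noteq> 0} \<subseteq> classes_of M"
    by (auto simp: coeff_class_term classes_of_def split: if_splits)
  then show "finite {C \<in> graph_classes. coeff (class_term C) M \<noteq> 0}"
    by (rule finite_subset) (rule finite_classes_of)
qed

lemma formal_sum_class_term:
  "formal_sum class_term graph_classes = Series (\<lambda>M. phi (monomial_betti M) (monomial_gcd M) *
      (monomial_weight M * connected_density M))"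
proof (rule series_eqI)
  fix M
  have "coeff (formal_sum class_term graph_classes) M = (\<Sum>C\<in>classes_of M. coeff (class_term C) M)"
    by (rule coeff_formal_sum[OF finite_classes_of]) (auto simp: classes_of_def coeff_class_term)
  also have "\<dots> = (\<Sum>C\<in>classes_of M. phi (monomial_betti M) (monomial_gcd M) *
      (monomial_weight M * (1 / of_nat (class_aut C))))"
    by (intro sum.cong refl) (simp add: classes_of_def coeff_class_term)
  finally show "coeff (formal_sum class_term graph_classes) M =
      coeff (Series (\<lambda>M. phi (monomial_betti M) (monomial_gcd M) *
        (monomial_weight M * connected_density M))) M"
    by (simp add: connected_density_def sum_distrib_left)
qed

text \<open>The equivalence expresses existence and uniqueness of L among series without constant
  term, the domain on which \<open>Exp\<close> converges and is injective. As
  \<open>integral_X\<close> and \<open>formal_sum\<close> are total functions, the first two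
  conjuncts certify that their values are genuine.\<close>

theorem theorem4p1:
  shows "integrable_X (Exp A_XX) \<and> formally_summable class_term graph_classes \<and>
    (\<forall>L :: A_gen lambda_ring.
       coeff L {#} = 0 \<and> integral_X (Exp A_XX) = Exp L \<longleftrightarrow>
       L = formal_sum class_term graph_classes)"
proof (intro conjI allI)
  show "integrable_X (Exp A_XX)"
    by (rule integrable_Exp_A_XX)
  show "formally_summable class_term graph_classes"
    by (rule formally_summable_class_term)
  let ?L = "formal_sum class_term graph_classes"
  have L0: "coeff ?L {#} = 0"
    by (simp add: formal_sum_class_term connected_density_empty)
  have L: "integral_X (Exp A_XX) = Exp ?L"
    unfolding formal_sum_class_term Exp_eq[of "Series f" for f] plethystic_sum_graph_series
    by (rule integral_eq_exp_series)
  fix L :: "A_gen lambda_ring"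
  show "coeff L {#} = 0 \<and> integral_X (Exp A_XX) = Exp L \<longleftrightarrow> L = ?L"
    using L0 L Exp_inject[of L ?L] by auto
qed

end
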